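(* Let $k\geq 1$ and $\ell$ be integers with $(\ell,k)=1$. Then for any integer $m\geq 1$, $$-\sum_{\substack{n\geq 2\\ p(n)\equiv \ell\ (\mathrm{mod}\ k)}}\frac{c_n(m)}{n}=\frac{1}{\varphi(k)}.$$
   Context: For an integer $n\geq 2$, $p(n)$ denotes the smallest prime divisor of $n$. $\varphi$ is the Euler totient function, and $(\ell,k)$ denotes the greatest common divisor. For positive integers $n,m$, the Ramanujan sum is $$c_n(m)=\sum_{\substack{1\leq q\leq n\\ (q,n)=1}}e^{2\pi i qm/n}.$$ The infinite series is understood as the limit as $x\to\infty$ of the partial sums over $2\leq n\leq x$ satisfying the condition (the convergence is part of the claim). *)

theory Defs
  imports "HOL-Analysis.Analysis" "HOL-Number_Theory.Number_Theory"
begin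

text \<open>Meaningful only for \<open>n \<ge> 2\<close>: no prime divides 1.\<close>
definition least_prime_divisor :: "nat \<Rightarrow> nat" where
  "least_prime_divisor n = (LEAST p. prime p \<and> p dvd n)"

definition ramanujan_sum :: "nat \<Rightarrow> nat \<Rightarrow> complex" where
  "ramanujan_sum n m =
     (\<Sum>q | q \<in> {1..n} \<and> coprime q n.
        exp (2 * of_real pi * \<i> * of_nat q * of_nat m / of_nat n))"

end

theory Submission
  imports
    Defs
    "HOL-Computational_Algebra.Squarefree"
    "HOL-Complex_Analysis.Complex_Analysis"
    "HOL-Probability.Sinc_Integral"
    "HOL-Real_Asymp.Real_Asymp"
begin

text \<open>
  Since \<open>c\<^sub>n(m)/n\<close> is the sum of \<open>\<mu>(n/d)/(n/d)\<close> over the common divisors \<open>d\<close> of \<open>n\<close> and \<open>m\<close>, the series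
  splits into one series for each \<open>d\<close> dividing \<open>m\<close>. Write \<open>M\<^sub>q(y)\<close> for the sum of \<open>\<mu>(n)/n\<close> over the
  \<open>n \<le> y\<close> whose prime factors all exceed \<open>q\<close>. For \<open>d > 1\<close> only the least prime divisors up to \<open>p(d)\<close>
  matter, so the partial sums are a fixed finite combination of such \<open>M\<^sub>q\<close>, and these tend to \<open>0\<close> by the
  prime number theorem. For \<open>d = 1\<close>, sorting by \<open>p = p(n)\<close> leaves, besides \<open>-1/\<phi>(k)\<close>, the sum of
  \<open>f(p)/p \<cdot> M\<^sub>p(x/p)\<close>, where \<open>f\<close> is the indicator of the residue class minus \<open>1/\<phi>(k)\<close>. Dirichlet's theorem,
  in the form that the tails of the series of \<open>f(p)/p\<close> are \<open>O(1/log t)\<close>, and a bound for the variation of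
  \<open>M\<^sub>p(x/p)\<close> in \<open>p\<close> from a logarithmic sieve make this sum tend to \<open>0\<close> by partial summation.

  The prime number theorem is obtained without contour integration: the function \<open>u \<mapsto> M\<^sub>0(e\<^sup>u)\<close> is bounded
  and slowly oscillating, and its Laplace transform \<open>1/(s \<zeta>(1+s))\<close> extends continuously to \<open>Re s \<ge> 0\<close>, so
  smoothing with Fejer kernels and the Riemann-Lebesgue lemma apply.
\<close>

section \<open>Moebius function and rough numbers\<close>

text \<open>For \<open>d = 1\<close> every prime up to \<open>x\<close> enters, so the limits
  \<open>M_p -> 0\<close> settle only a bounded range of \<open>p\<close>; uniformity over the
  remaining range is the obstacle. Between \<open>z\<close> and \<open>z^2\<close> the total
  variation of \<open>M_p(x/p)\<close> in \<open>p\<close> is at most an absolute constant, while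
  the tails of the series of \<open>f(p)/p\<close> have size \<open>1/log z\<close> there. Along the
  scales \<open>2^2^i\<close> these products form a geometric series, small from a fixed scale on,
  uniformly in \<open>x\<close>. The bound \<open>|M_q(y)| <= 1\<close>, uniform in \<open>q\<close>
  and \<open>y\<close>, supports this step, makes the Laplace transform converge, and starts the
  passage from \<open>M_0\<close> to \<open>M_q\<close>.

  The tails rest on the boundedness of the sums of \<open>chi(p) log p / p\<close>, hence on
  \<open>L(1, chi) \<noteq> 0\<close> for non-principal \<open>chi\<close>. Two vanishing characters
  would make a nonnegative sum negative; so a vanishing \<open>chi\<close> equals its conjugate, and
  a real \<open>chi\<close> is excluded by Monsky's Lambert series.

  On the zeta side, the Fejer kernel is the Fourier transform of a compactly supported tent, so
  boundary values enter only on bounded segments, where continuity bounds them.\<close>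

definition moebius_mu :: "nat \<Rightarrow> real" where
  "moebius_mu n = (if squarefree n then (-1) ^ card (prime_factors n) else 0)"

text \<open>The sifting level \<open>q\<close> is any natural number, not only a prime, so that it
  can move one step at a time in inductions; a step to a composite level changes nothing.\<close>

definition rough :: "nat \<Rightarrow> nat \<Rightarrow> bool" where
  "rough q n \<longleftrightarrow> n > 0 \<and> (\<forall>p. prime p \<longrightarrow> p dvd n \<longrightarrow> q < p)"

definition moebius_mean :: "nat \<Rightarrow> nat \<Rightarrow> real" where
  "moebius_mean q y = (\<Sum>n | n \<in> {1..y} \<and> rough q n. moebius_mu n / n)"

lemma moebius_1 [simp]: "moebius_mu (Suc 0) = 1"
  by (simp add: moebius_mu_def)

lemma abs_moebius_le: "\<bar>moebius_mu n\<bar> \<le> 1"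
  by (simp add: moebius_mu_def)

lemma moebius_prime_mult:
  assumes "prime p"
  shows "moebius_mu (p * n) = (if p dvd n then 0 else - moebius_mu n)"
proof (cases "p dvd n")
  case True
  have "p ^ 2 dvd p * n"
    using True by (simp add: power2_eq_square)
  then have "\<not> squarefree (p * n)"
    using assms by (intro not_squarefreeI[of p]) auto
  with True show ?thesis by (simp add: moebius_mu_def)
next
  case False
  then have "n > 0" using gr0I by fastforce
  have cop: "coprime p n" using False assms by (simp add: prime_imp_coprime)
  have "prime_factors (p * n) = insert p (prime_factors n)"
    using assms \<open>n > 0\<close> by (simp add: prime_factors_product prime_prime_factors)
  moreover have "p \<notin> prime_factors n" using False by auto
  moreover have "squarefree (p * n) \<longleftrightarrow> squarefree n"
    using cop assms by (auto intro: squarefree_mult_coprime squarefree_prime dest: squarefree_multD)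
  ultimately show ?thesis using False by (simp add: moebius_mu_def)
qed

lemma rough_1 [simp]: "rough q (Suc 0)"
  by (auto simp: rough_def)

lemma rough_mono: "rough q n \<Longrightarrow> q' \<le> q \<Longrightarrow> rough q' n"
  by (meson order_le_less_trans rough_def)

lemma rough_0_iff [simp]: "rough 0 n \<longleftrightarrow> n > 0"
  by (auto simp: rough_def prime_gt_0_nat)

lemma rough_mult_iff: "rough q (m * n) \<longleftrightarrow> rough q m \<and> rough q n"
  by (auto simp: rough_def prime_dvd_mult_iff)

lemma rough_prime_iff: "prime p \<Longrightarrow> rough q p \<longleftrightarrow> q < p"
  by (auto simp: rough_def prime_gt_0_nat dest: primes_dvd_imp_eq)

lemma rough_gt: "rough q n \<Longrightarrow> n \<noteq> 1 \<Longrightarrow> q < n"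
  by (metis dvd_imp_le order_less_le_trans prime_factor_nat rough_def)

text \<open>Pairs a rough divisor \<open>d\<close> prime to \<open>p\<close> with
  \<open>p * d\<close>, whose Moebius value is opposite. A rough divisor outside both halves is
  divisible by the square of \<open>p\<close> and contributes 0.\<close>

lemma sum_moebius_rough_eq_0:
  assumes "n > 0" "prime p" "p dvd n" "q < p"
  shows "(\<Sum>d | d dvd n \<and> rough q d. moebius_mu d) = 0"
proof -
  define D where "D = {d. d dvd n \<and> rough q d}"
  define D0 where "D0 = {d. d dvd n \<and> rough q d \<and> \<not> p dvd d}"
  have fin: "finite D" unfolding D_def using assms(1) by simp
  have sub: "D0 \<union> (*) p ` D0 \<subseteq> D"
  proof -
    have "p * d dvd n" if "d dvd n" "\<not> p dvd d" for d
      using that assms by (metis divides_mult prime_imp_coprime)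
    then show ?thesis
      using assms by (auto simp: D0_def D_def rough_mult_iff rough_prime_iff)
  qed
  have "sum moebius_mu D = sum moebius_mu (D0 \<union> (*) p ` D0)"
  proof (intro sum.mono_neutral_right[OF fin sub] ballI)
    fix d assume "d \<in> D - (D0 \<union> (*) p ` D0)"
    then have d: "d \<in> D" "d \<notin> (*) p ` D0" "d \<notin> D0" by auto
    then have "p dvd d" by (auto simp: D_def D0_def)
    then obtain e where e: "d = p * e" by blast
    have "p dvd e"
    proof (rule ccontr)
      assume "\<not> p dvd e"
      with d(1) e have "e \<in> D0"
        by (auto simp: D_def D0_def rough_mult_iff intro: dvd_trans dvd_triv_right)
      with d(2) e show False by blast
    qed
    then show "moebius_mu d = 0" using e assms by (simp add: moebius_prime_mult)
  qed
  also have "\<dots> = sum moebius_mu D0 + sum moebius_mu ((*) p ` D0)"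
    using fin sub by (intro sum.union_disjoint) (auto simp: D0_def intro: finite_subset)
  also have "sum moebius_mu ((*) p ` D0) = sum (\<lambda>d. moebius_mu (p * d)) D0"
    using assms by (subst sum.reindex) (auto simp: inj_on_def prime_gt_0_nat)
  also have "\<dots> = - sum moebius_mu D0"
    unfolding sum_negf[symmetric] using assms
    by (intro sum.cong) (auto simp: D0_def moebius_prime_mult)
  finally show ?thesis by (simp add: D_def)
qed

lemma sum_moebius_divisors:
  assumes "n > 0"
  shows "(\<Sum>d | d dvd n. moebius_mu d) = (if n = 1 then 1 else 0)"
proof (cases "n = 1")
  case True
  then show ?thesis by simp
next
  case False
  then obtain p where "prime p" "p dvd n" using prime_factor_nat by metis
  then have "(\<Sum>d | d dvd n \<and> rough 0 d. moebius_mu d) = 0"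
    using assms by (intro sum_moebius_rough_eq_0[of n p]) (auto simp: prime_gt_0_nat)
  moreover have "{d. d dvd n \<and> rough 0 d} = {d. d dvd n}"
    using assms by auto
  ultimately show ?thesis using False by simp
qed

section \<open>Rearranging sums over divisors and multiples\<close>

lemma bij_betw_mult_atLeastAtMost:
  fixes p y :: nat
  assumes p: "p > 0"
  shows "bij_betw ((*) p) {n. n \<in> {1..y div p} \<and> P (p * n)} {n. n \<in> {1..y} \<and> p dvd n \<and> P n}"
proof (rule bij_betw_imageI)
  show "inj_on ((*) p) {n. n \<in> {1..y div p} \<and> P (p * n)}" using p by (auto simp: inj_on_def)
  show "(*) p ` {n \<in> {1..y div p}. P (p * n)} = {n \<in> {1..y}. p dvd n \<and> P n}"
  proof (intro equalityI subsetI)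
    fix n assume "n \<in> {n \<in> {1..y}. p dvd n \<and> P n}"
    then obtain e where "n = p * e" "1 \<le> n" "n \<le> y" "P n" by auto
    then have "e \<in> {1..y div p}" using p
      by (auto simp: less_eq_div_iff_mult_less_eq mult.commute intro: Suc_leI gr0I)
    then show "n \<in> (*) p ` {n \<in> {1..y div p}. P (p * n)}" using \<open>n = p * e\<close> \<open>P n\<close> by blast
  next
    fix n assume "n \<in> (*) p ` {n \<in> {1..y div p}. P (p * n)}"
    then show "n \<in> {n \<in> {1..y}. p dvd n \<and> P n}" using p
      by (auto simp: less_eq_div_iff_mult_less_eq mult.commute)
  qed
qed

text \<open>Both sides run over the pairs \<open>(d, m)\<close> with \<open>d * m <= y\<close>.
  Chebyshev's identity, the convolutions with \<open>L_one\<close>, the Lambert series and the final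
  split over common divisors with \<open>m\<close> all pass through this form.\<close>

lemma sum_divisors_swap:
  "(\<Sum>n\<in>{1..y}. \<Sum>d | d dvd n. F d (n div d)) = (\<Sum>d\<in>{1..y}. \<Sum>m\<in>{1..y div d}. F d (m::nat))"
proof -
  have "(\<Sum>n\<in>{1..y}. \<Sum>d | d dvd n. F d (n div d)) = (\<Sum>n\<in>{1..y}. \<Sum>d | d \<in> {1..y} \<and> d dvd n. F d (n div d))"
    by (intro sum.cong refl) (auto dest: dvd_imp_le dvd_pos_nat simp: Suc_le_eq)
  also have "\<dots> = (\<Sum>d\<in>{1..y}. \<Sum>n | n \<in> {1..y} \<and> d dvd n. F d (n div d))"
    by (rule sum.swap_restrict) auto
  also have "\<dots> = (\<Sum>d\<in>{1..y}. \<Sum>m\<in>{1..y div d}. F d m)"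
  proof (rule sum.cong[OF refl])
    fix d assume d: "d \<in> {1..y}"
    have "(\<Sum>m\<in>{1..y div d}. F d m) = (\<Sum>m\<in>{1..y div d}. F d ((d * m) div d))"
      using d by (intro sum.cong) auto
    also have "\<dots> = (\<Sum>n | n \<in> {1..y} \<and> d dvd n. F d (n div d))"
      using sum.reindex_bij_betw[OF bij_betw_mult_atLeastAtMost[of d y "\<lambda>_. True"], of "\<lambda>n. F d (n div d)"] d
      by (simp add: atLeastAtMost_def atLeast_def atMost_def Int_def)
    finally show "(\<Sum>n | n \<in> {1..y} \<and> d dvd n. F d (n div d)) = (\<Sum>m\<in>{1..y div d}. F d m)" ..
  qed
  finally show ?thesis .
qed

lemma sum_div_eq_sum_divisors:
  fixes f :: "nat \<Rightarrow> 'a :: comm_semiring_1"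
  shows "(\<Sum>d\<in>{1..y}. f d * of_nat (y div d)) = (\<Sum>n\<in>{1..y}. \<Sum>d | d dvd n. f d)"
  unfolding sum_divisors_swap[of "\<lambda>d _. f d"] by (simp add: mult.commute)

lemma moebius_mean_alt: "moebius_mean q y = (\<Sum>n\<in>{1..y}. (if rough q n then moebius_mu n else 0) / n)"
  unfolding moebius_mean_def by (subst sum.inter_filter) (auto intro!: sum.cong)

text \<open>Replacing \<open>y / n\<close> by its floor turns the sum into a count of the numbers
  whose prime factors are all at most \<open>q\<close>. No \<open>n > 1\<close> is both of that kind
  and \<open>q\<close>-rough, so each \<open>n\<close> pays either for the count or for a fractional
  part, at most 1 in total.\<close>

lemma abs_moebius_mean_le: "\<bar>moebius_mean q y\<bar> \<le> 1"
proof (cases "y = 0")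
  case True
  then show ?thesis by (simp add: moebius_mean_def)
next
  case False
  define f where "f n = (if rough q n then moebius_mu n else 0)" for n
  have f: "\<bar>f n\<bar> \<le> (if rough q n then 1 else 0)" for n
    by (auto simp: f_def abs_moebius_le)
  let ?smooth = "\<lambda>n. \<forall>p. prime p \<longrightarrow> p dvd n \<longrightarrow> p \<le> q"
  have div: "(\<Sum>d | d dvd n. f d) = (if ?smooth n then 1 else 0)" if "n \<in> {1..y}" for n
  proof -
    have eq: "(\<Sum>d | d dvd n. f d) = (\<Sum>d | d dvd n \<and> rough q d. moebius_mu d)"
      unfolding f_def using that by (subst sum.inter_filter[symmetric]) auto
    show ?thesis
    proof (cases "?smooth n")
      case True
      have "d = 1" if "d dvd n" "rough q d" for d
      proof (rule ccontr)
        assume "d \<noteq> 1"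
        then obtain p where "prime p" "p dvd d" using prime_factor_nat by metis
        with that True show False by (meson dvd_trans not_le rough_def)
      qed
      then have "{d. d dvd n \<and> rough q d} = {1}" by auto
      then show ?thesis using eq True by simp
    next
      case False
      then obtain p where "prime p" "p dvd n" "q < p" by (auto simp: not_le)
      then show ?thesis using eq False sum_moebius_rough_eq_0[of n p q] that by auto
    qed
  qed
  have "real y * moebius_mean q y - (\<Sum>d\<in>{1..y}. f d * real (y div d)) =
      (\<Sum>d\<in>{1..y}. f d * (y / d - real (y div d)))"
    unfolding moebius_mean_alt f_def[symmetric]
    by (simp add: sum_distrib_left sum_subtractf[symmetric] algebra_simps)
  also have "(\<Sum>d\<in>{1..y}. f d * real (y div d)) = (\<Sum>n\<in>{1..y}. if ?smooth n then 1 else 0)"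
    unfolding sum_div_eq_sum_divisors by (intro sum.cong div refl)
  finally have "y * moebius_mean q y = (\<Sum>n\<in>{1..y}. (if ?smooth n then 1 else 0) + f n * (y / n - real (y div n)))"
    by (simp add: sum.distrib)
  also have "\<bar>\<dots>\<bar> \<le> (\<Sum>n\<in>{1..y}. 1)"
  proof (rule order.trans[OF sum_abs sum_mono])
    fix n assume n: "n \<in> {1..y}"
    have fr: "0 \<le> y / n - real (y div n)" "y / n - real (y div n) \<le> 1"
      using floor_divide_of_nat_eq[of y n, where ?'a = real] of_int_floor_le[of "real y / real n"]
        real_of_int_floor_add_one_ge[of "real y / real n"] by auto
    show "\<bar>(if ?smooth n then 1 else 0) + f n * (y / n - real (y div n))\<bar> \<le> 1"
    proof (cases "n = 1")
      \<comment> \<open>The number 1 is both smooth and rough, but \<open>y / 1\<close> has no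
        fractional part.\<close>
      case True
      then show ?thesis by auto
    next
      case False
      have *: "\<bar>f n * (y / n - real (y div n))\<bar> \<le> (if rough q n then 1 else 0)"
        unfolding abs_mult using f[of n] fr
        by (smt (verit, ccfv_threshold) mult_left_le mult_nonneg_nonneg abs_ge_zero)
      have disj: "\<not> (?smooth n \<and> rough q n)"
        by (metis False prime_factor_nat rough_def not_le)
      have "\<bar>a\<bar> \<le> (if t then 1 else 0) \<Longrightarrow> \<not> (s \<and> t) \<Longrightarrow> \<bar>(if s then 1 else 0) + a\<bar> \<le> 1"
        for a :: real and s t by (auto split: if_splits)
      from this[OF * disj] show ?thesis .
    qed
  qed
  finally have "\<bar>real y * moebius_mean q y\<bar> \<le> y" by simp
  then show ?thesis using False by (simp add: abs_mult)
qed

lemma rough_Suc_iff: "rough (Suc t) n \<longleftrightarrow> rough t n \<and> \<not> (prime (Suc t) \<and> Suc t dvd n)"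
  by (auto simp: rough_def intro: Suc_lessI)

text \<open>Factor out the least prime \<open>p = Suc t\<close>. If \<open>p\<close> divides the
  cofactor again the Moebius value vanishes, so only \<open>p\<close>-rough cofactors survive, with
  the sign flipped.\<close>

lemma sum_moebius_least_prime:
  assumes "prime (Suc t)"
  shows "(\<Sum>n | n \<in> {1..y} \<and> Suc t dvd n \<and> rough t n. moebius_mu n / n)
    = - moebius_mean (Suc t) (y div Suc t) / Suc t"
proof -
  have "(\<Sum>n | n \<in> {1..y} \<and> Suc t dvd n \<and> rough t n. moebius_mu n / n)
      = (\<Sum>n | n \<in> {1..y div Suc t} \<and> rough t (Suc t * n). moebius_mu (Suc t * n) / real (Suc t * n))"
    by (rule sum.reindex_bij_betw[OF bij_betw_mult_atLeastAtMost[OF zero_less_Suc], symmetric])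
  also have "\<dots> = (\<Sum>n | n \<in> {1..y div Suc t} \<and> rough (Suc t) n. - (moebius_mu n / n) / Suc t)"
  proof (rule sum.mono_neutral_cong_right)
    show "{n \<in> {1..y div Suc t}. rough (Suc t) n} \<subseteq> {n \<in> {1..y div Suc t}. rough t (Suc t * n)}"
      using assms by (auto simp del: mult_Suc simp: rough_mult_iff rough_prime_iff intro: rough_mono)
    show "\<forall>n\<in>{n \<in> {1..y div Suc t}. rough t (Suc t * n)} - {n \<in> {1..y div Suc t}. rough (Suc t) n}.
        moebius_mu (Suc t * n) / real (Suc t * n) = 0"
      using assms by (auto simp del: mult_Suc simp: rough_mult_iff rough_Suc_iff moebius_prime_mult)
  next
    fix n assume "n \<in> {n \<in> {1..y div Suc t}. rough (Suc t) n}"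
    then have "\<not> Suc t dvd n" using assms by (auto simp: rough_def)
    then show "moebius_mu (Suc t * n) / real (Suc t * n) = - (moebius_mu n / n) / Suc t"
      using assms by (simp only: moebius_prime_mult of_nat_mult) (simp add: field_simps)
  qed auto
  also have "\<dots> = - moebius_mean (Suc t) (y div Suc t) / Suc t"
    by (simp add: moebius_mean_def sum_negf sum_divide_distrib)
  finally show ?thesis .
qed

text \<open>Buchstab's identity: the \<open>t\<close>-rough numbers lost at level
  \<open>Suc t\<close> are those with least prime factor \<open>Suc t\<close>.\<close>

lemma moebius_mean_Suc:
  "moebius_mean t y = moebius_mean (Suc t) y -
     (if prime (Suc t) then moebius_mean (Suc t) (y div Suc t) / Suc t else 0)"
proof (cases "prime (Suc t)")
  case True
  have "{n \<in> {1..y}. rough t n} = {n \<in> {1..y}. rough (Suc t) n} \<union> {n \<in> {1..y}. Suc t dvd n \<and> rough t n}"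
    using True by (auto simp: rough_Suc_iff)
  then have "moebius_mean t y = moebius_mean (Suc t) y +
      (\<Sum>n | n \<in> {1..y} \<and> Suc t dvd n \<and> rough t n. moebius_mu n / n)"
    unfolding moebius_mean_def using True
    by (subst sum.union_disjoint[symmetric]) (auto simp: rough_Suc_iff)
  then show ?thesis using True by (simp only: sum_moebius_least_prime) simp
next
  case False
  then show ?thesis by (simp add: moebius_mean_def rough_Suc_iff)
qed

section \<open>Harmonic sums and a logarithmic sieve\<close>

lemma sum_inverse_le_ln:
  assumes "A > 0" "A \<le> B"
  shows "(\<Sum>n\<in>{A<..B}. 1 / real n) \<le> ln B - ln A"
  using assms(2)
proof (induction B rule: dec_induct)
  case base
  then show ?case by simp
next
  case (step B)
  have "{A<..Suc B} = insert (Suc B) {A<..B}" using step by auto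
  moreover have "1 / real (Suc B) \<le> ln (Suc B) - ln B"
    using step assms ln_diff_le[of "real B" "real (Suc B)"]
    by (simp add: field_simps)
  ultimately show ?case using step by simp
qed

lemma ln_le_sum_inverse:
  assumes "z > 0"
  shows "ln z \<le> (\<Sum>n\<in>{1..z}. 1 / real n)"
proof -
  have "ln (Suc n) \<le> (\<Sum>n\<in>{1..n}. 1 / real n)" for n
  proof (induction n)
    case (Suc n)
    have "ln (Suc (Suc n)) - ln (Suc n) \<le> 1 / Suc n"
      using ln_diff_le[of "Suc (Suc n)" "Suc n"] by (simp add: field_simps)
    with Suc show ?case by simp
  qed simp
  from this[of z] show ?thesis using assms by (smt (verit) ln_mono of_nat_0_less_iff of_nat_le_iff le_Suc_eq)
qed

text \<open>A \<open>z\<close>-rough number is coprime to every positive integer up to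
  \<open>z\<close>, so \<open>n\<close> divides \<open>n'\<close> and conversely.\<close>

lemma smooth_part_unique:
  assumes "rough z n" "rough z n'" "0 < m" "0 < m'" "m \<le> z" "m' \<le> z" "n * m = n' * m'"
  shows "n = n'"
proof -
  have cop: "coprime a b" if "rough z a" "0 < b" "b \<le> z" for a b
  proof (rule ccontr)
    assume "\<not> coprime a b"
    then obtain p where p: "prime p" "p dvd gcd a b"
      using prime_factor_nat[of "gcd a b"] by (metis coprime_iff_gcd_eq_1)
    then have "q < Suc z" if "q = p" for q
      using that \<open>0 < b\<close> \<open>b \<le> z\<close> by (auto dest!: dvd_imp_le)
    then show False using that p by (auto simp: rough_def)
  qed
  have "n dvd n'" using cop[of n m'] assms by (metis coprime_dvd_mult_left_iff dvd_triv_left)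
  moreover have "n' dvd n" using cop[of n' m] assms by (metis coprime_dvd_mult_left_iff dvd_triv_left)
  ultimately show ?thesis by (simp add: dvd_antisym)
qed

text \<open>A logarithmic upper bound sieve: multiplying the rough numbers by the integers up to the
  sifting limit is injective.\<close>

lemma sum_inverse_rough_le:
  assumes "z > 0" "a \<le> b"
  shows "ln z * (\<Sum>n | n \<in> {a<..b} \<and> rough z n. 1 / real n) \<le> (\<Sum>n\<in>{a<..b*z}. 1 / real n)"
proof -
  let ?R = "{n \<in> {a<..b}. rough z n}"
  have "ln z * (\<Sum>n\<in>?R. 1 / real n) \<le> (\<Sum>m\<in>{1..z}. 1 / real m) * (\<Sum>n\<in>?R. 1 / real n)"
    using assms by (intro mult_right_mono ln_le_sum_inverse sum_nonneg) auto
  also have "\<dots> = (\<Sum>n\<in>?R. \<Sum>m\<in>{1..z}. 1 / real (n * m))"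
    by (subst mult.commute) (simp add: sum_product)
  also have "\<dots> = (\<Sum>(n,m)\<in>?R \<times> {1..z}. 1 / real (n * m))"
    by (simp add: sum.cartesian_product)
  also have "\<dots> = (\<Sum>N\<in>(\<lambda>(n,m). n * m) ` (?R \<times> {1..z}). 1 / real N)"
  proof (subst sum.reindex)
    show "inj_on (\<lambda>(n, m). n * m) (?R \<times> {1..z})"
    proof (rule inj_onI, clarify)
      fix n m n' m' assume *: "n \<in> {a<..b}" "rough z n" "m \<in> {1..z}" "n' \<in> {a<..b}" "rough z n'"
        "m' \<in> {1..z}" "n * m = n' * m'"
      then have "n = n'" by (intro smooth_part_unique[of z n n' m m']) auto
      with * show "n = n' \<and> m = m'" by (auto simp: rough_def)
    qed
  qed (simp add: case_prod_unfold)
  also have "\<dots> \<le> (\<Sum>n\<in>{a<..b*z}. 1 / real n)"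
  proof (rule sum_mono2)
    show "(\<lambda>(n, m). n * m) ` (?R \<times> {1..z}) \<subseteq> {a<..b * z}"
      by (auto intro!: mult_le_mono) (metis One_nat_def Suc_le_lessD less_le_trans mult.right_neutral mult_le_mono2 Suc_leI)
  qed auto
  finally show ?thesis .
qed

section \<open>The zeta function on the line Re s = 1\<close>

lemma summable_powr_minus:
  assumes "1 < (r::real)"
  shows "summable (\<lambda>n. real n powr - r)"
  using assms summable_real_powr_iff[of "- r"] by simp

text \<open>Restricting to \<open>t\<close>-rough \<open>n\<close> replaces Euler products: a step
  from \<open>t\<close> to \<open>Suc t\<close> removes at most one Euler factor, and as
  \<open>t\<close> grows only the term \<open>n = 1\<close> is left. At \<open>t = 0\<close> this is
  the full Dirichlet series.\<close>

definition dseries :: "(nat \<Rightarrow> real) \<Rightarrow> nat \<Rightarrow> complex \<Rightarrow> complex" where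
  "dseries a t s = (\<Sum>\<^sub>\<infinity>n | rough t n. of_real (a n) * of_nat n powr - s)"

lemma norm_nat_powr: "norm (of_nat n powr (s::complex)) = real n powr Re s"
  by (subst norm_powr_real_powr) auto

lemma nat_powr_mult: "(of_nat (m * n) :: complex) powr s = of_nat m powr s * of_nat n powr s"
  by (simp add: powr_times_real)

lemma dseries_summable:
  assumes "\<And>n. \<bar>a n\<bar> \<le> 1" "1 < Re s"
  shows "(\<lambda>n. of_real (a n) * of_nat n powr - s :: complex) summable_on A"
proof -
  have "summable (\<lambda>n. norm (of_real (a n) * of_nat n powr - s :: complex))"
  proof (rule summable_comparison_test')
    show "summable (\<lambda>n. real n powr - Re s)" using assms by (intro summable_powr_minus)
    show "norm (norm (of_real (a n) * of_nat n powr - s :: complex)) \<le> real n powr - Re s" for n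
      using assms(1)[of n] by (simp add: norm_mult norm_nat_powr mult_left_le_one_le)
  qed
  then have "(\<lambda>n. of_real (a n) * of_nat n powr - s :: complex) summable_on UNIV"
    by (rule norm_summable_imp_summable_on)
  then show ?thesis by (rule summable_on_subset_banach) simp
qed

lemma dseries_0_sums:
  assumes "\<And>n. \<bar>a n\<bar> \<le> 1" "1 < Re s"
  shows "(\<lambda>n. of_real (a (Suc n)) * of_nat (Suc n) powr - s) sums dseries a 0 s"
proof -
  have "(\<lambda>n. of_real (a n) * of_nat n powr - s :: complex) summable_on {n. rough 0 n}"
    using assms by (rule dseries_summable)
  then have "((\<lambda>n. of_real (a n) * of_nat n powr - s) has_sum dseries a 0 s) {n. rough 0 n}"
    unfolding dseries_def by (rule has_sum_infsum)
  moreover have "{n. rough 0 n} = range Suc" by (auto simp: image_iff gr0_conv_Suc)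
  ultimately have "((\<lambda>n. of_real (a (Suc n)) * of_nat (Suc n) powr - s) has_sum dseries a 0 s) UNIV"
    by (simp add: has_sum_reindex o_def)
  then show ?thesis by (rule has_sum_imp_sums)
qed

text \<open>A \<open>t\<close>-rough number is either not divisible by \<open>Suc t\<close>, hence
  \<open>Suc t\<close>-rough, or \<open>Suc t\<close> times a \<open>t\<close>-rough number.\<close>

lemma dseries_Suc:
  assumes "\<And>n. \<bar>a n\<bar> \<le> 1" "1 < Re s" "prime (Suc t)"
  shows "dseries a t s = dseries a (Suc t) s
    + of_nat (Suc t) powr - s * dseries (\<lambda>n. a (Suc t * n)) t s"
proof -
  let ?f = "\<lambda>n. of_real (a n) * of_nat n powr - s :: complex"
  let ?p = "Suc t"
  have un: "{n. rough t n} = {n. rough ?p n} \<union> (*) ?p ` {n. rough t n}"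
  proof -
    have "n \<in> (*) ?p ` {n. rough t n}" if "rough t n" "?p dvd n" for n
    proof -
      obtain e where "n = ?p * e" using \<open>?p dvd n\<close> by (rule dvdE)
      with that(1) have "rough t e" by (simp only: rough_mult_iff)
      with \<open>n = ?p * e\<close> show ?thesis by (intro image_eqI[of _ _ e]) auto
    qed
    moreover have "rough t (?p * n)" if "rough t n" for n
      using that assms(3) by (simp only: rough_mult_iff rough_prime_iff) simp
    ultimately show ?thesis using assms(3) by (auto simp del: mult_Suc simp: rough_Suc_iff)
  qed
  have dis: "{n. rough ?p n} \<inter> (*) ?p ` {n. rough t n} = {}"
    using assms(3) by (auto simp del: mult_Suc simp: rough_Suc_iff)
  have "dseries a t s = dseries a ?p s + infsum ?f ((*) ?p ` {n. rough t n})"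
    unfolding dseries_def using dis
    by (subst un, intro infsum_Un_disjoint dseries_summable assms) auto
  also have "infsum ?f ((*) ?p ` {n. rough t n}) = infsum (?f \<circ> (*) ?p) {n. rough t n}"
    by (intro infsum_reindex) (auto simp del: mult_Suc simp: inj_on_def)
  also have "\<dots> = of_nat ?p powr - s * dseries (\<lambda>n. a (?p * n)) t s"
    unfolding dseries_def o_def nat_powr_mult
    by (subst infsum_cmult_right'[symmetric]) (simp add: mult_ac)
  finally show ?thesis .
qed

lemma dseries_not_prime:
  assumes "\<not> prime (Suc t)"
  shows "dseries a (Suc t) s = dseries a t s"
  using assms by (simp add: dseries_def rough_Suc_iff)

text \<open>A \<open>t\<close>-rough \<open>n\<close> other than 1 exceeds \<open>t\<close>, so the
  terms after the first are dominated by a tail of the convergent series of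
  \<open>n powr - Re s\<close>.\<close>

lemma dseries_tendsto:
  assumes "\<And>n. \<bar>a n\<bar> \<le> 1" "1 < Re s" "a 1 = 1"
  shows "(\<lambda>t. dseries a t s) \<longlonglongrightarrow> 1"
proof -
  define g where "g n = real n powr - Re s" for n
  have sg: "summable g" unfolding g_def using assms by (intro summable_powr_minus)
  have g_nonneg: "\<bar>g n\<bar> = g n" for n by (simp add: g_def)
  have gon: "g summable_on A" for A
    by (rule summable_on_subset_banach[OF norm_summable_imp_summable_on])
      (use sg in \<open>auto simp: g_def[abs_def]\<close>)
  have bd: "norm (dseries a t s - 1) \<le> (\<Sum>n. g (n + t))" for t
  proof -
    let ?f = "\<lambda>n. of_real (a n) * of_nat n powr - s :: complex"
    have "{n. rough t n} = {1} \<union> {n. rough t n \<and> n \<noteq> 1}" by auto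
    then have "dseries a t s = infsum ?f ({1} \<union> {n. rough t n \<and> n \<noteq> 1})"
      unfolding dseries_def by metis
    also have "\<dots> = infsum ?f {1} + infsum ?f {n. rough t n \<and> n \<noteq> 1}"
      using assms by (intro infsum_Un_disjoint dseries_summable) auto
    finally have "dseries a t s - 1 = infsum ?f {n. rough t n \<and> n \<noteq> 1}"
      using assms by simp
    also have "norm \<dots> \<le> infsum (\<lambda>n. norm (?f n)) {n. rough t n \<and> n \<noteq> 1}"
      using dseries_summable[OF assms(1,2)]
      by (intro norm_infsum_bound) (simp add: summable_on_iff_abs_summable_on_complex[symmetric])
    also have "\<dots> \<le> infsum g {t..}"
    proof (rule infsum_mono_neutral)
      show "(\<lambda>n. norm (?f n)) summable_on {n. rough t n \<and> n \<noteq> 1}"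
        using dseries_summable[OF assms(1,2)]
        by (simp add: summable_on_iff_abs_summable_on_complex[symmetric])
      show "g summable_on {t..}" by (rule gon)
      show "norm (?f x) \<le> g x" for x
        using assms(1)[of x] by (simp add: norm_mult norm_nat_powr mult_left_le_one_le g_def)
      show "norm (?f x) \<le> 0" if "x \<in> {n. rough t n \<and> n \<noteq> 1} - {t..}" for x
        using that by (auto dest: rough_gt)
      show "0 \<le> g x" for x by (simp add: g_def)
    qed
    also have "{t..} = (\<lambda>n. n + t) ` UNIV" by (auto simp: image_iff le_iff_add add.commute)
    also have "infsum g ((\<lambda>n. n + t) ` UNIV) = infsum (g \<circ> (\<lambda>n. n + t)) UNIV"
      by (rule infsum_reindex) auto
    also have "\<dots> = (\<Sum>n. g (n + t))"
    proof (rule infsumI)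
      show "(g \<circ> (\<lambda>n. n + t) has_sum (\<Sum>n. g (n + t))) UNIV"
        unfolding o_def using sg
        by (intro norm_summable_imp_has_sum summable_sums)
          (simp_all add: summable_iff_shift[of g] abs_of_nonneg[OF powr_ge_zero] g_nonneg)
    qed
    finally show ?thesis .
  qed
  have "(\<lambda>t. \<Sum>n. g (n + t)) \<longlonglongrightarrow> 0" using suminf_exist_split2[OF sg] .
  then have "(\<lambda>t. dseries a t s - 1) \<longlonglongrightarrow> 0"
    by (rule Lim_null_comparison[OF always_eventually[OF allI[OF bd]]])
  then show ?thesis by (simp add: LIM_zero_iff)
qed

section \<open>Euler factors and the 3-4-1 inequality\<close>

lemma dseries_one_Suc:
  assumes "1 < Re s" "prime (Suc t)"
  shows "dseries (\<lambda>_. 1) (Suc t) s = (1 - of_nat (Suc t) powr - s) * dseries (\<lambda>_. 1) t s"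
  using dseries_Suc[of "\<lambda>_. 1" s t] assms by (simp add: algebra_simps)

lemma dseries_moebius_Suc:
  assumes "1 < Re s" "prime (Suc t)"
  shows "dseries moebius_mu t s = (1 - of_nat (Suc t) powr - s) * dseries moebius_mu (Suc t) s"
proof -
  have "dseries (\<lambda>n. moebius_mu (Suc t * n)) t s = - dseries moebius_mu (Suc t) s"
    unfolding dseries_def infsum_uminus[symmetric] using assms(2)
    by (intro infsum_cong_neutral)
      (auto simp del: mult_Suc simp: rough_Suc_iff moebius_prime_mult)
  then show ?thesis
    using dseries_Suc[of moebius_mu s t] assms abs_moebius_le by (simp add: algebra_simps)
qed

text \<open>The factor \<open>1 - p powr - s\<close> gained by one series is lost by the other, so
  the product does not depend on \<open>t\<close>; its limit in \<open>t\<close> is 1.\<close>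

lemma dseries_moebius_mult_one:
  assumes "1 < Re s"
  shows "dseries moebius_mu 0 s * dseries (\<lambda>_. 1) 0 s = 1"
proof -
  have "dseries moebius_mu t s * dseries (\<lambda>_. 1) t s = dseries moebius_mu 0 s * dseries (\<lambda>_. 1) 0 s" for t
  proof (induction t)
    case (Suc t)
    show ?case
    proof (cases "prime (Suc t)")
      case True
      then show ?thesis using Suc assms by (simp add: dseries_one_Suc dseries_moebius_Suc mult_ac)
    qed (use Suc in \<open>simp add: dseries_not_prime\<close>)
  qed simp
  then have "(\<lambda>t. dseries moebius_mu t s * dseries (\<lambda>_. 1) t s) =
      (\<lambda>t. dseries moebius_mu 0 s * dseries (\<lambda>_. 1) 0 s)" by blast
  moreover have "(\<lambda>t. dseries moebius_mu t s * dseries (\<lambda>_. 1) t s) \<longlonglongrightarrow> 1 * 1"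
    using assms abs_moebius_le by (intro tendsto_mult dseries_tendsto) auto
  ultimately have "(\<lambda>t::nat. dseries moebius_mu 0 s * dseries (\<lambda>_. 1) 0 s) \<longlonglongrightarrow> 1 * 1"
    by (simp only:)
  then show ?thesis by (simp only: LIMSEQ_const_iff mult_1)
qed

text \<open>The logarithm of the left side is minus the sum of \<open>r ^ n / n\<close> times
  \<open>3 + 4 * Re w + Re (w\<^sup>2)\<close> with \<open>w = z ^ n\<close>. On the unit circle the
  second factor is \<open>2 * (1 + Re w)\<^sup>2\<close>, hence nonnegative.\<close>

lemma mertens_341_local:
  fixes r :: real and z :: complex
  assumes "0 \<le> r" "r < 1" "norm z = 1"
  shows "norm (1 - of_real r :: complex) ^ 3 * norm (1 - r * z) ^ 4 * norm (1 - r * z\<^sup>2) \<le> 1"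
proof -
  have lnS: "(\<lambda>n. - (r ^ n * Re (w ^ n)) / n) sums ln (norm (1 - r * w))" if "norm w = 1" for w :: complex
  proof -
    have n1: "norm (r * w) < 1" using that assms by (simp add: norm_mult)
    then have nz: "1 - r * w \<noteq> 0" by auto
    have "(\<lambda>n. - ((r * w) ^ n) / of_nat n) sums Ln (1 - r * w)"
      using Ln_series'[of "- (of_real r * w)"] n1 by simp
    then have "(\<lambda>n. Re (- ((r * w) ^ n) / of_nat n)) sums Re (Ln (1 - r * w))"
      by (rule sums_Re)
    moreover have "Re (- ((r * w) ^ n) / of_nat n) = - (r ^ n * Re (w ^ n)) / n" for n
    proof -
      have "- ((r * w) ^ n) / of_nat n = of_real (- (r ^ n) / n) * w ^ n"
        by (simp add: power_mult_distrib)
      then show ?thesis by (simp only: Re_complex_of_real times_complex.sel Im_complex_of_real) simp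
    qed
    ultimately have "(\<lambda>n. - (r ^ n * Re (w ^ n)) / n) sums Re (Ln (1 - r * w))"
      by (simp only:)
    then show ?thesis using nz by simp
  qed
  have nz: "norm (1 - r * w) > 0" if "norm w = 1" for w :: complex
  proof -
    have "norm (r * w) < 1" using that assms by (simp add: norm_mult)
    then show ?thesis by auto
  qed
  have z2: "norm (z\<^sup>2) = 1" using assms by (simp add: norm_power)
  have 1: "norm (1::complex) = 1" by simp
  define L where "L = 3 * ln (norm (1 - r * (1::complex))) + 4 * ln (norm (1 - r * z)) + ln (norm (1 - r * z\<^sup>2))"
  have "(\<lambda>n. 3 * (- (r ^ n * Re (1 ^ n)) / n) + 4 * (- (r ^ n * Re (z ^ n)) / n)
      + (- (r ^ n * Re ((z\<^sup>2) ^ n)) / n)) sums L"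
    unfolding L_def using lnS[OF 1] lnS[OF assms(3)] lnS[OF z2] by (intro sums_add sums_mult)
  moreover have "3 * (- (r ^ n * Re (1 ^ n)) / n) + 4 * (- (r ^ n * Re (z ^ n)) / n)
      + (- (r ^ n * Re ((z\<^sup>2) ^ n)) / n) \<le> 0" for n
  proof -
    define w where "w = z ^ n"
    have "norm w = 1" using assms by (simp add: w_def norm_power)
    then have "(Re w)\<^sup>2 + (Im w)\<^sup>2 = 1" by (simp add: cmod_def)
    moreover have "(z\<^sup>2) ^ n = w\<^sup>2" by (simp add: w_def power_mult[symmetric] mult.commute)
    ultimately have "Re ((z\<^sup>2) ^ n) = 2 * (Re w)\<^sup>2 - 1" by (simp add: power2_eq_square)
    then have "3 + 4 * Re (z ^ n) + Re ((z\<^sup>2) ^ n) = 2 * (1 + Re w)\<^sup>2"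
      by (simp add: w_def power2_eq_square algebra_simps)
    then have "0 \<le> r ^ n / n * (3 + 4 * Re (z ^ n) + Re ((z\<^sup>2) ^ n))"
      using assms by simp
    then show ?thesis by (simp add: algebra_simps add_divide_distrib)
  qed
  ultimately have "L \<le> 0" by (rule sums_le[OF _ _ sums_zero, rotated])
  then have "exp L \<le> 1" by simp
  also have "exp L = norm (1 - of_real r :: complex) ^ 3 * norm (1 - r * z) ^ 4 * norm (1 - r * z\<^sup>2)"
    using nz[OF 1] nz[OF assms(3)] nz[OF z2]
    by (simp add: L_def exp_add exp_of_nat_mult[of 3, simplified] exp_of_nat_mult[of 4, simplified])
  finally show ?thesis .
qed

text \<open>Removing the Euler factor of a prime multiplies the product by the local expression,
  which is at most 1. The product thus decreases in \<open>t\<close> to its limit 1 and starts at 1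
  or above.\<close>

lemma mertens_341:
  fixes x y :: real
  assumes "1 < x"
  shows "1 \<le> norm (dseries (\<lambda>_. 1) 0 x) ^ 3 * norm (dseries (\<lambda>_. 1) 0 (Complex x y)) ^ 4
    * norm (dseries (\<lambda>_. 1) 0 (Complex x (2 * y)))"
proof -
  define F where "F t = norm (dseries (\<lambda>_. 1) t x) ^ 3 * norm (dseries (\<lambda>_. 1) t (Complex x y)) ^ 4
    * norm (dseries (\<lambda>_. 1) t (Complex x (2 * y)))" for t
  have "F (Suc t) \<le> F t" for t
  proof (cases "prime (Suc t)")
    case True
    define r where "r = real (Suc t) powr - x"
    define z where "z = exp (- (\<i> * y * ln (Suc t)))"
    have "Suc t > 1" using True prime_gt_1_nat by blast
    then have r: "0 \<le> r" "r < 1"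
      using assms by (auto simp: r_def powr_less_one simp del: of_nat_Suc)
    have pw: "of_nat (Suc t) powr - Complex x v = r * exp (- (\<i> * v * ln (Suc t)))" for v
      unfolding Complex_eq r_def powr_def
      by (simp add: exp_add[symmetric] algebra_simps Ln_of_nat exp_of_real[symmetric] del: of_nat_Suc)
    have pz: "of_nat (Suc t) powr - Complex x y = r * z"
      "of_nat (Suc t) powr - Complex x (2 * y) = r * z\<^sup>2"
      "of_nat (Suc t) powr - complex_of_real x = r"
      using pw[of y] pw[of "2 * y"] pw[of 0] unfolding z_def exp_double[symmetric]
      by (simp_all add: mult.assoc mult.left_commute complex_of_real_def[symmetric] del: of_nat_Suc)
    have "F (Suc t) = (norm (1 - of_real r :: complex) ^ 3 * norm (1 - r * z) ^ 4 * norm (1 - r * z\<^sup>2)) * F t"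
      using assms True
      by (simp add: F_def dseries_one_Suc pz norm_mult power_mult_distrib del: of_nat_Suc)
    also have "\<dots> \<le> 1 * F t"
      using r by (intro mult_right_mono mertens_341_local) (auto simp: z_def F_def norm_exp_eq_Re)
    finally show ?thesis by simp
  next
    case False
    then show ?thesis by (simp add: F_def dseries_not_prime)
  qed
  then have "decseq F" by (rule decseq_SucI)
  moreover have "F \<longlonglongrightarrow> 1 ^ 3 * 1 ^ 4 * 1"
    unfolding F_def norm_one[where 'a = complex, symmetric] using assms
    by (intro tendsto_mult tendsto_power tendsto_norm dseries_tendsto) auto
  ultimately show ?thesis using decseq_ge[of F 1 0] by (simp add: F_def)
qed


section \<open>Continuation of zeta past the line \<open>Re s = 1\<close>\<close>

lemma norm_powr_diff_le:
  fixes a :: complex and n :: nat and x :: complex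
  assumes "n > 0" "Re a \<le> 1" "x \<in> closed_segment (of_nat n) (of_nat n + 1)"
  shows "norm (x powr a - of_nat n powr a) \<le> norm a * real n powr (Re a - 1)"
proof -
  let ?S = "closed_segment (of_nat n) (of_nat n + 1) :: complex set"
  have seg: "z \<in> \<real>" "real n \<le> Re z" "z \<noteq> 0" "z \<notin> \<real>\<^sub>\<le>\<^sub>0" if z: "z \<in> ?S" for z
  proof -
    have "z \<in> closed_segment (of_real n) (of_real (n + 1))" using z by (simp add: add.commute)
    then show *: "z \<in> \<real>" "real n \<le> Re z"
      by (auto simp only: closed_segment_of_real closed_segment_eq_real_ivl) auto
    then show "z \<noteq> 0" "z \<notin> \<real>\<^sub>\<le>\<^sub>0"
      using assms(1) by (auto simp: complex_nonpos_Reals_iff)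
  qed
  have "norm (x powr a - of_nat n powr a) \<le> (norm a * real n powr (Re a - 1)) * norm (x - of_nat n)"
  proof (rule field_differentiable_bound[of ?S "\<lambda>z. z powr a" "\<lambda>z. a * z powr (a - 1)"])
    fix z assume z: "z \<in> ?S"
    show "((\<lambda>z. z powr a) has_field_derivative a * z powr (a - 1)) (at z within ?S)"
      using seg[OF z] by (auto intro!: has_field_derivative_at_within has_field_derivative_powr)
    have "norm (z powr (a - 1)) = Re z powr (Re a - 1)"
      using seg[OF z] by (subst norm_powr_real_powr) auto
    also have "\<dots> \<le> real n powr (Re a - 1)"
      using seg[OF z] assms by (intro powr_mono2') auto
    finally show "norm (a * z powr (a - 1)) \<le> norm a * real n powr (Re a - 1)"
      by (simp add: norm_mult mult_left_mono)
  qed (use assms in auto)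
  also have "\<dots> \<le> (norm a * real n powr (Re a - 1)) * 1"
  proof (rule mult_left_mono)
    have "norm (x - of_nat n) \<le> norm (of_nat n + 1 - of_nat n :: complex)"
      by (rule segment_bound1[OF assms(3)])
    then show "norm (x - of_nat n) \<le> 1" by simp
  qed auto
  finally show ?thesis by simp
qed

text \<open>Multiplying the usual continuation of \<open>\<zeta>(s) - 1/(s-1)\<close> by \<open>s - 1\<close> makes every summand entire;
  the extra differences telescope to \<open>-1\<close>.\<close>

definition zeta_term :: "nat \<Rightarrow> complex \<Rightarrow> complex" where
  "zeta_term n s = (s - 1) * of_nat n powr - s + (of_nat (Suc n) powr (1 - s) - of_nat n powr (1 - s))"

text \<open>The term is the increment over \<open>[n, n + 1]\<close> of
  \<open>z powr (1 - s) + (s - 1) * n powr - s * z\<close>. Its derivative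
  \<open>(1 - s) * (z powr - s - n powr - s)\<close> vanishes at \<open>n\<close>, and the mean
  value bound for it gains the extra power of \<open>n\<close> that makes the series converge for
  \<open>Re s > 0\<close>.\<close>

lemma norm_zeta_term_le:
  assumes "n > 0" "0 \<le> Re s"
  shows "norm (zeta_term n s) \<le> norm (s - 1) * norm s * real n powr - (1 + Re s)"
proof -
  let ?S = "closed_segment (of_nat n) (of_nat n + 1) :: complex set"
  let ?f = "\<lambda>z. z powr (1 - s) + (s - 1) * of_nat n powr - s * z"
  let ?f' = "\<lambda>z. (1 - s) * z powr (1 - s - 1) + (s - 1) * of_nat n powr - s"
  have seg: "z \<notin> \<real>\<^sub>\<le>\<^sub>0" if z: "z \<in> ?S" for z
  proof -
    have "z \<in> closed_segment (of_real n) (of_real (n + 1))" using z by (simp add: add.commute)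
    then have *: "z \<in> \<real>" "real n \<le> Re z"
      by (auto simp only: closed_segment_of_real closed_segment_eq_real_ivl) auto
    then show "z \<notin> \<real>\<^sub>\<le>\<^sub>0"
      using assms(1) by (auto simp: complex_nonpos_Reals_iff)
  qed
  have "norm (?f (of_nat n + 1) - ?f (of_nat n)) \<le>
      (norm (s - 1) * (norm s * real n powr (- Re s - 1))) * norm (of_nat n + 1 - of_nat n :: complex)"
  proof (rule field_differentiable_bound[of ?S ?f ?f'])
    fix z assume z: "z \<in> ?S"
    show "(?f has_field_derivative ?f' z) (at z within ?S)"
      by (rule has_field_derivative_at_within,
          rule DERIV_add[OF has_field_derivative_powr[OF seg[OF z]] DERIV_cmult_Id])
    have "?f' z = (1 - s) * (z powr - s - of_nat n powr - s)" by (simp add: algebra_simps)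
    also have "norm \<dots> \<le> norm (s - 1) * (norm s * real n powr (- Re s - 1))"
      unfolding norm_mult norm_minus_commute[of 1 s]
      using norm_powr_diff_le[of n "- s" z] assms z by (intro mult_left_mono) auto
    finally show "norm (?f' z) \<le> norm (s - 1) * (norm s * real n powr (- Re s - 1))" .
  qed auto
  moreover have "?f (of_nat n + 1) - ?f (of_nat n) = zeta_term n s"
    by (simp add: zeta_term_def algebra_simps)
  moreover have "- Re s - 1 = - (1 + Re s)" by simp
  ultimately show ?thesis by (simp only:) simp
qed

text \<open>\<open>H\<close> is \<open>(s - 1) * zeta(s)\<close>: the factor removes the pole and
  \<open>H 1\<close> is the residue. Continuity serves for the boundary values, differentiability
  for the order of a hypothetical zero.\<close>

lemma zeta_extension:
  obtains H where "\<And>s. 0 < Re s \<Longrightarrow> H field_differentiable at s"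
    and "\<And>s. 1 < Re s \<Longrightarrow> H s = (s - 1) * dseries (\<lambda>_. 1) 0 s" and "H 1 = 1"
proof -
  let ?S = "{s. 0 < Re s}"
  obtain g where g: "\<forall>s\<in>?S. (\<lambda>n. zeta_term (Suc n) s) sums g s \<and> g field_differentiable at s"
  proof (rule series_differentiable_comparison_complex[of ?S "\<lambda>n. zeta_term (Suc n)"])
    show "open ?S" by (rule open_halfspace_Re_gt)
    show "zeta_term (Suc n) field_differentiable at s" for n s
    proof -
      have "of_nat (Suc m) powr w = exp (w * Ln (of_nat (Suc m)))" for m and w :: complex
        by (simp add: powr_def del: of_nat_Suc)
      then have "zeta_term (Suc n) holomorphic_on UNIV"
        unfolding zeta_term_def[abs_def] by (simp only:) (intro holomorphic_intros)
      then show ?thesis by (rule holomorphic_on_imp_differentiable_at) auto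
    qed
    fix s assume "s \<in> ?S"
    then have s: "Re s > 0" by simp
    \<comment> \<open>Half of \<open>Re s\<close>, so that the ball of radius \<open>d\<close> stays
      in \<open>Re y >= d\<close>, where one summable majorant serves all points; \<open>C\<close>
      bounds the product of \<open>norm (y - 1)\<close> and \<open>norm y\<close> on that
      ball.\<close>
    define d where "d = Re s / 2"
    define C where "C = (norm s + d + 1) * (norm s + d)"
    define h where "h n = complex_of_real (C * real (Suc n) powr - (1 + d))" for n
    have d: "d > 0" using s by (simp add: d_def)
    have "summable (\<lambda>n. real (Suc n) powr - (1 + d))"
      using summable_powr_minus[of "1 + d"] d by (subst summable_Suc_iff) auto
    then have "summable h" unfolding h_def by (intro summable_of_real summable_mult)
    moreover have "range h \<subseteq> \<real>\<^sub>\<ge>\<^sub>0" using d by (auto simp: h_def C_def)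
    moreover have "norm (zeta_term (Suc n) y) \<le> norm (h n)" if "y \<in> ball s d \<inter> ?S" for n y
    proof -
      have "norm (y - s) < d" using that by (simp add: dist_norm norm_minus_commute)
      then have y: "norm y \<le> norm s + d" "Re y \<ge> d"
        using norm_triangle_sub[of y s] abs_Re_le_cmod[of "y - s"] by (auto simp: d_def)
      then have y1: "norm (y - 1) \<le> norm s + d + 1"
        using norm_triangle_ineq4[of y 1] by simp
      have "norm (zeta_term (Suc n) y) \<le> norm (y - 1) * norm y * real (Suc n) powr - (1 + Re y)"
        using y d by (intro norm_zeta_term_le) auto
      also have "\<dots> \<le> C * real (Suc n) powr - (1 + d)"
        unfolding C_def using y y1 d by (intro mult_mono powr_mono) auto
      also have "\<dots> \<le> norm (h n)" unfolding h_def norm_of_real by (rule abs_ge_self)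
      finally show ?thesis .
    qed
    ultimately show "\<exists>d h. 0 < d \<and> summable h \<and> range h \<subseteq> \<real>\<^sub>\<ge>\<^sub>0 \<and>
        (\<forall>\<^sub>F n in sequentially. \<forall>y\<in>ball s d \<inter> ?S. cmod (zeta_term (Suc n) y) \<le> cmod (h n))"
      using d by (intro exI[of _ d] exI[of _ h]) auto
  qed auto
  show ?thesis
  proof
    show "(\<lambda>s. 1 + g s) field_differentiable at s" if "0 < Re s" for s
      using g that by (auto intro!: derivative_intros)
    have "(\<lambda>n. zeta_term (Suc n) 1) sums g 1" using g by simp
    moreover have "zeta_term (Suc n) 1 = 0" for n
      by (simp add: zeta_term_def del: of_nat_Suc)
    ultimately have "g 1 = 0" by (simp add: sums_unique2[OF _ sums_zero])
    then show "1 + g 1 = 1" by simp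
    fix s :: complex assume s: "1 < Re s"
    have "(\<lambda>n. of_nat (Suc n) powr - s) sums dseries (\<lambda>_. 1) 0 s"
      using dseries_0_sums[of "\<lambda>_. 1" s] s by simp
    then have 1: "(\<lambda>n. (s - 1) * of_nat (Suc n) powr - s) sums ((s - 1) * dseries (\<lambda>_. 1) 0 s)"
      by (rule sums_mult)
    have "(\<lambda>n. of_nat (Suc n) powr (1 - s) :: complex) \<longlonglongrightarrow> 0"
    proof (rule tendsto_norm_zero_cancel)
      have "(\<lambda>n. real (Suc n) powr Re (1 - s)) \<longlonglongrightarrow> 0"
        using s by (intro tendsto_neg_powr filterlim_compose[OF filterlim_real_sequentially filterlim_Suc]) auto
      then show "(\<lambda>n. norm (of_nat (Suc n) powr (1 - s) :: complex)) \<longlonglongrightarrow> 0"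
        by (simp only: norm_nat_powr)
    qed
    from telescope_sums[OF this]
    have 2: "(\<lambda>n. of_nat (Suc (Suc n)) powr (1 - s) - of_nat (Suc n) powr (1 - s) :: complex) sums - 1"
      by simp
    have "(\<lambda>n. zeta_term (Suc n) s) sums ((s - 1) * dseries (\<lambda>_. 1) 0 s + - 1)"
      unfolding zeta_term_def by (rule sums_add[OF 1 2])
    moreover have "(\<lambda>n. zeta_term (Suc n) s) sums g s" using g s by simp
    ultimately have "(s - 1) * dseries (\<lambda>_. 1) 0 s + - 1 = g s" by (rule sums_unique2)
    then show "1 + g s = (s - 1) * dseries (\<lambda>_. 1) 0 s" by (simp add: algebra_simps)
  qed
qed

text \<open>To the right of the line the series has an inverse. On the line, a zero at
  \<open>1 + iy\<close> would give the 3-4-1 product at abscissa \<open>1 + d\<close> a factor of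
  order \<open>d ^ 4\<close> against a growth of order \<open>1 / d ^ 3\<close> from the pole; the
  product would tend to 0, yet it is at least 1.\<close>

lemma zeta_extension_nonzero:
  assumes H: "\<And>s. 0 < Re s \<Longrightarrow> H field_differentiable at s"
    "\<And>s. 1 < Re s \<Longrightarrow> H s = (s - 1) * dseries (\<lambda>_. 1) 0 s" "H 1 = 1"
    and s: "1 \<le> Re s"
  shows "H s \<noteq> 0"
proof
  assume Hs: "H s = 0"
  show False
  proof (cases "Re s = 1")
    case False
    then have "1 < Re s" using s by simp
    then show False
      using dseries_moebius_mult_one[of s] H(2)[of s] Hs by auto
  next
    case True
    define y where "y = Im s"
    have sy: "s = Complex 1 y" using True by (simp add: y_def complex_eq_iff)
    have y: "y \<noteq> 0" using Hs H(3) sy by (metis complex_eq_iff one_complex.sel(1,2) complex.sel zero_neq_one)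
    define Z where "Z = dseries (\<lambda>_. 1) 0"
    have cont: "isCont H z" if "0 < Re z" for z
      using H(1)[OF that] by (rule field_differentiable_imp_continuous_at)
    have lim: "((\<lambda>d. H (Complex (1 + d) v)) \<longlongrightarrow> H (Complex 1 v)) (at_right 0)" for v
    proof (rule isCont_tendsto_compose[OF cont])
      show "((\<lambda>d. Complex (1 + d) v) \<longlongrightarrow> Complex 1 v) (at_right 0)"
        unfolding Complex_eq by (auto intro!: tendsto_eq_intros)
    qed simp
    have der: "((\<lambda>d::real. H (Complex (1 + d) y) / d) \<longlongrightarrow> deriv H s) (at_right 0)"
    proof -
      have "(H has_field_derivative deriv H s) (at s)"
        using H(1)[of s] True by (simp add: field_differentiable_derivI)
      then have "((\<lambda>h. (H (s + h) - H s) / h) \<longlongrightarrow> deriv H s) (at 0)"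
        by (simp add: DERIV_def)
      moreover have "filterlim (\<lambda>d::real. complex_of_real d) (at 0) (at_right 0)"
      proof -
        have "((\<lambda>d::real. complex_of_real d) \<longlongrightarrow> 0) (at_right 0)"
          by (auto intro!: tendsto_eq_intros)
        then show ?thesis
          by (auto simp: filterlim_at eventually_at_filter)
      qed
      ultimately have "((\<lambda>d::real. (H (s + of_real d) - H s) / of_real d) \<longlongrightarrow> deriv H s) (at_right 0)"
        by (rule filterlim_compose)
      moreover have "s + of_real d = Complex (1 + d) y" for d
        by (simp add: sy complex_eq_iff)
      ultimately show ?thesis using Hs by simp
    qed
    \<comment> \<open>The 3-4-1 product in terms of \<open>H\<close>: the pole gives
      \<open>1 / d ^ 3\<close>, the four difference quotients take up \<open>d ^ 4\<close>, and one
      factor \<open>d\<close> is left over. The denominators stay away from 0 because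
      \<open>y \<noteq> 0\<close>.\<close>
    define \<phi> where "\<phi> d = norm (H (Complex (1 + d) 0)) ^ 3 * norm (H (Complex (1 + d) y) / of_real d) ^ 4
        * norm (H (Complex (1 + d) (2 * y))) * d / (norm (Complex d y) ^ 4 * norm (Complex d (2 * y)))" for d
    have "(\<phi> \<longlongrightarrow> norm (H (Complex 1 0)) ^ 3 * norm (deriv H s) ^ 4
        * norm (H (Complex 1 (2 * y))) * 0 / (norm (Complex 0 y) ^ 4 * norm (Complex 0 (2 * y)))) (at_right 0)"
      unfolding \<phi>_def[abs_def] using y
      by (intro tendsto_intros lim der)
         (auto simp: Complex_eq intro!: tendsto_eq_intros)
    then have "(\<phi> \<longlongrightarrow> 0) (at_right 0)" by simp
    then have "eventually (\<lambda>d. \<phi> d < 1) (at_right 0)" by (rule order_tendstoD) simp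
    moreover have "\<phi> d \<ge> 1" if d: "d > 0" for d
    proof -
      have nz: "norm (Complex d v) > 0" for v using d by (simp add: complex_eq_iff)
      have HZ: "norm (H (Complex (1 + d) v)) = norm (Complex d v) * norm (Z (Complex (1 + d) v))" for v
      proof -
        have "Complex (1 + d) v - 1 = Complex d v" by (simp add: complex_eq_iff)
        then show ?thesis using H(2)[of "Complex (1 + d) v"] d by (simp add: norm_mult Z_def)
      qed
      have "1 \<le> norm (Z (complex_of_real (1 + d))) ^ 3 * norm (Z (Complex (1 + d) y)) ^ 4 * norm (Z (Complex (1 + d) (2 * y)))"
        unfolding Z_def using d by (intro mertens_341) auto
      also have "complex_of_real (1 + d) = Complex (1 + d) 0" by (simp add: complex_eq_iff)
      also have "norm (Z (Complex (1 + d) 0)) ^ 3 * norm (Z (Complex (1 + d) y)) ^ 4 * norm (Z (Complex (1 + d) (2 * y))) = \<phi> d"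
        unfolding \<phi>_def norm_divide HZ using nz[of y] nz[of "2 * y"] d
        by (simp add: field_simps power_mult_distrib cmod_def[of "Complex d 0"] eval_nat_numeral)
      finally show ?thesis .
    qed
    then have "eventually (\<lambda>d. \<phi> d \<ge> 1) (at_right 0)"
      by (auto simp: eventually_at_filter)
    ultimately have "eventually (\<lambda>d::real. False) (at_right 0)"
      by eventually_elim simp
    then show False by simp
  qed
qed

section \<open>A Tauberian theorem with the Fejer kernel\<close>

definition tent :: "real \<Rightarrow> real" where
  "tent t = max 0 (1 - \<bar>t\<bar>)"

text \<open>The Fourier transform of \<open>tent\<close>, equal to the square of
  \<open>sin (x / 2) / (x / 2)\<close>; the value at 0 is the limit.\<close>

definition fejer :: "real \<Rightarrow> real" where
  "fejer x = (if x = 0 then 1 else 2 * (1 - cos x) / x\<^sup>2)"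

lemma tent_nonneg: "0 \<le> tent t" and tent_le_1: "tent t \<le> 1"
  by (auto simp: tent_def)

lemma continuous_on_tent [continuous_intros]: "continuous_on A tent"
  unfolding tent_def[abs_def] by (intro continuous_intros)

lemma tent_measurable [measurable]: "tent \<in> borel_measurable borel"
  by (intro borel_measurable_continuous_onI continuous_on_tent)

lemma tent_eq_0: "1 \<le> \<bar>t\<bar> \<Longrightarrow> tent t = 0"
  by (auto simp: tent_def)

lemma integrable_tent_mult:
  fixes g :: "real \<Rightarrow> complex"
  assumes [measurable]: "g \<in> borel_measurable borel" and "\<And>t. norm (g t) \<le> B"
  shows "integrable lborel (\<lambda>t. of_real (tent t) * g t)"
proof (rule Bochner_Integration.integrable_bound)
  show "integrable lborel (\<lambda>t::real. B * indicator {-1..1} t)"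
    by (intro integrable_mult_right integrable_real_indicator) auto
  show "AE t in lborel. norm (of_real (tent t) * g t) \<le> norm (B * indicator {-1..1} t)"
  proof (rule AE_I2)
    fix t :: real
    have "0 \<le> B" using assms(2)[of 0] norm_ge_zero order_trans by blast
    then show "norm (of_real (tent t) * g t) \<le> norm (B * indicator {-1..1} t)"
      using assms(2)[of t] tent_nonneg[of t] tent_le_1[of t] tent_eq_0[of t]
      by (cases "1 \<le> \<bar>t\<bar>") (auto simp: norm_mult indicator_def intro: order_trans[OF mult_left_le_one_le])
  qed
qed measurable

lemma integral_tent_exp:
  assumes "x \<noteq> 0"
  shows "(LINT t|lborel. of_real (tent t) * exp (\<i> * of_real (x * t))) = of_real (fejer x)"
proof -
  define E where "E z = exp (\<i> * of_real x * z)" for z :: complex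
  have E': "(E has_field_derivative \<i> * of_real x * E z) (at z)" for z
    unfolding E_def[abs_def] by (auto intro!: derivative_eq_intros)
  \<comment> \<open>Antiderivatives of \<open>(1 - z) * E z\<close> and
    \<open>(1 + z) * E z\<close>, found by one integration by parts; they serve the two halves of
    the tent.\<close>
  define Fp where "Fp z = (1 - z) * E z / (\<i> * of_real x) - E z / (of_real x)\<^sup>2" for z
  define Fm where "Fm z = (1 + z) * E z / (\<i> * of_real x) + E z / (of_real x)\<^sup>2" for z
  have x2: "(of_real x)\<^sup>2 = - ((\<i> * of_real x) * (\<i> * of_real x))"
    by (simp add: complex_eq_iff power2_eq_square)
  have "(Fp has_field_derivative (1 - z) * E z) (at z)" for z
    unfolding Fp_def[abs_def] x2 using assms
    by (auto intro!: derivative_eq_intros E' simp: field_simps)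
  then have Fp: "((\<lambda>t. Fp (of_real t)) has_vector_derivative (1 - of_real t) * E (of_real t)) (at t within A)" for t A
    by (rule has_vector_derivative_real_field)
  have "(Fm has_field_derivative (1 + z) * E z) (at z)" for z
    unfolding Fm_def[abs_def] x2 using assms
    by (auto intro!: derivative_eq_intros E' simp: field_simps)
  then have Fm: "((\<lambda>t. Fm (of_real t)) has_vector_derivative (1 + of_real t) * E (of_real t)) (at t within A)" for t A
    by (rule has_vector_derivative_real_field)
  have Ec: "continuous_on A (\<lambda>t::real. E (of_real t))" for A
    unfolding E_def by (intro continuous_intros)
  have "has_bochner_integral lborel (\<lambda>t. indicator {0..1} t *\<^sub>R ((1 - of_real t) * E (of_real t))) (Fp (of_real 1) - Fp (of_real 0))"
    by (intro has_bochner_integral_FTC_Icc Fp continuous_intros Ec) simp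
  moreover have "has_bochner_integral lborel (\<lambda>t. indicator {-1..0} t *\<^sub>R ((1 + of_real t) * E (of_real t))) (Fm (of_real 0) - Fm (of_real (-1)))"
    by (intro has_bochner_integral_FTC_Icc Fm continuous_intros Ec) simp
  ultimately have "has_bochner_integral lborel (\<lambda>t. indicator {0..1} t *\<^sub>R ((1 - of_real t) * E (of_real t))
      + indicator {-1..0} t *\<^sub>R ((1 + of_real t) * E (of_real t)))
      ((Fp (of_real 1) - Fp (of_real 0)) + (Fm (of_real 0) - Fm (of_real (-1))))"
    by (rule has_bochner_integral_add)
  moreover have "(Fp (of_real 1) - Fp (of_real 0)) + (Fm (of_real 0) - Fm (of_real (-1))) = of_real (fejer x)"
  proof -
    have E1: "E 0 = 1" "E 1 + E (-1) = 2 * of_real (cos x)"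
      unfolding E_def by (simp_all add: cos_exp_eq flip: cos_of_real)
    have "(Fp (of_real 1) - Fp (of_real 0)) + (Fm (of_real 0) - Fm (of_real (-1)))
        = (2 - (E 1 + E (-1))) / (of_real x)\<^sup>2"
      unfolding Fp_def Fm_def using E1(1) assms by (simp add: field_simps)
    also have "\<dots> = of_real (fejer x)"
      unfolding E1 using assms by (simp add: fejer_def)
    finally show ?thesis .
  qed
  ultimately have *: "has_bochner_integral lborel (\<lambda>t. indicator {0..1} t *\<^sub>R ((1 - of_real t) * E (of_real t))
      + indicator {-1..0} t *\<^sub>R ((1 + of_real t) * E (of_real t))) (of_real (fejer x))"
    by simp
  have "has_bochner_integral lborel (\<lambda>t. of_real (tent t) * exp (\<i> * of_real (x * t))) (of_real (fejer x))"
  proof (rule has_bochner_integralI_AE[OF *])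
    \<comment> \<open>The two closed halves overlap at 0, so the sum equals the tent only almost
      everywhere.\<close>
    have "AE t in lborel. t \<noteq> (0::real)" by (rule AE_lborel_singleton)
    then show "AE t in lborel. indicator {0..1} t *\<^sub>R ((1 - of_real t) * E (of_real t))
      + indicator {-1..0} t *\<^sub>R ((1 + of_real t) * E (of_real t)) = of_real (tent t) * exp (\<i> * of_real (x * t))"
      by eventually_elim (auto simp: E_def tent_def indicator_def mult.assoc)
  qed measurable
  then show ?thesis by (rule has_bochner_integral_integral_eq)
qed

lemma fejer_nonneg: "0 \<le> fejer x"
  by (auto simp: fejer_def)

lemma fejer_measurable [measurable]: "fejer \<in> borel_measurable borel"
  unfolding fejer_def[abs_def] by measurable

text \<open>With \<open>1 - cos x = 2 * (sin (x / 2))\<^sup>2\<close>, the bound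
  \<open>(x / 2)\<^sup>2\<close> handles small \<open>x\<close> and the bound 1 large
  \<open>x\<close>; together they give one integrable majorant.\<close>

lemma fejer_le: "fejer x \<le> 8 / (1 + x\<^sup>2)"
proof (cases "x = 0")
  case False
  have c: "1 - cos x = 2 * (sin (x / 2))\<^sup>2" by (simp add: sin_squared_eq cos_double_cos[of "x/2", simplified])
  have "(sin (x / 2))\<^sup>2 \<le> (x / 2)\<^sup>2"
    using abs_sin_x_le_abs_x[of "x / 2"] by (simp only: abs_le_square_iff)
  moreover have "(sin (x / 2))\<^sup>2 \<le> 1" by (simp add: abs_square_le_1)
  moreover have "(x / 2)\<^sup>2 = x\<^sup>2 / 4" "0 \<le> x\<^sup>2" by (simp_all add: power_divide)
  moreover have "2 * (1 - cos x) * (1 + x\<^sup>2) = 4 * (sin (x / 2))\<^sup>2 + 4 * ((sin (x / 2))\<^sup>2 * x\<^sup>2)"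
    unfolding c by (simp add: algebra_simps)
  ultimately have "2 * (1 - cos x) * (1 + x\<^sup>2) \<le> 8 * x\<^sup>2"
    using mult_right_mono[of "(sin (x / 2))\<^sup>2" 1 "x\<^sup>2"] by linarith
  moreover have "0 < x\<^sup>2" "0 < 1 + x\<^sup>2" using False by (simp_all add: add_pos_nonneg)
  ultimately show ?thesis using False by (simp add: fejer_def frac_le_eq pos_divide_le_eq pos_le_divide_eq)
qed (simp add: fejer_def)

lemma fejer_integrable: "integrable lborel fejer"
proof (rule Bochner_Integration.integrable_bound)
  have "set_integrable lborel (einterval (-\<infinity>) \<infinity>) (\<lambda>x. inverse (1 + x\<^sup>2))"
    by (rule integrable_inverse_1_plus_square)
  then show "integrable lborel (\<lambda>x::real. 8 * inverse (1 + x\<^sup>2))"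
    by (simp add: set_integrable_def)
  show "AE x in lborel. norm (fejer x) \<le> norm (8 * inverse (1 + x\<^sup>2))"
    using fejer_le fejer_nonneg by (auto simp: divide_inverse intro!: AE_I2 order_trans[OF fejer_le])
qed measurable

text \<open>The value is \<open>2 * pi\<close>; positivity allows dividing by it in
  \<open>tauberian\<close>. It holds because the kernel is nonnegative and nonzero on a whole
  interval.\<close>

lemma fejer_integral_pos: "0 < (LINT x|lborel. fejer x)"
proof -
  have "(LINT x|lborel. fejer x) \<noteq> 0"
  proof
    assume "(LINT x|lborel. fejer x) = 0"
    then have "AE x in lborel. fejer x = 0"
      using integral_nonneg_eq_0_iff_AE[OF fejer_integrable] fejer_nonneg by auto
    moreover have "fejer x \<noteq> 0" if "x \<in> {1<..<2}" for x
    proof -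
      have "cos x < cos 0" using that pi_gt3 by (intro cos_monotone_0_pi) auto
      then show ?thesis using that by (simp add: fejer_def)
    qed
    ultimately have "AE x in lborel. x \<notin> {1<..<2::real}"
      by (auto elim: eventually_mono)
    then have "emeasure lborel {1<..<2::real} = 0"
      by (simp add: AE_iff_null_sets null_setsD1)
    then show False by simp
  qed
  moreover have "0 \<le> (LINT x|lborel. fejer x)"
    using fejer_nonneg by (rule Bochner_Integration.integral_nonneg)
  ultimately show ?thesis by simp
qed

text \<open>Shifting \<open>t\<close> by half a period \<open>pi / w\<close> reverses the sign of
  the exponential, so the integral is half of the integral against
  \<open>f t - f (t + pi / w)\<close>. This difference tends to 0 by continuity, with compact
  support for domination.\<close>

lemma riemann_lebesgue_compact_support:
  fixes f :: "real \<Rightarrow> complex"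
  assumes cont: "continuous_on UNIV f" and supp: "\<And>t. 1 \<le> \<bar>t\<bar> \<Longrightarrow> f t = 0"
  shows "((\<lambda>w. LINT t|lborel. f t * exp (\<i> * of_real (w * t))) \<longlongrightarrow> 0) at_top"
proof -
  have [measurable]: "f \<in> borel_measurable borel"
    using cont by (rule borel_measurable_continuous_onI)
  obtain B where B: "\<And>t. norm (f t) \<le> B"
  proof -
    have "bounded (f ` {-1..1})"
      using cont by (intro compact_imp_bounded compact_continuous_image) (auto intro: continuous_on_subset)
    then obtain B where "\<forall>z\<in>f ` {-1..1}. norm z \<le> B" unfolding bounded_iff by blast
    then have "norm (f t) \<le> max B 0" for t
      using supp[of t] by (cases "t \<in> {-1..1}") (force simp: le_max_iff_disj)+
    then show ?thesis using that by blast
  qed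
  have int: "integrable lborel (\<lambda>t. f (t + c) * exp (\<i> * of_real (w * t)))" if "0 \<le> c" "c \<le> 1" for w c
  proof (rule Bochner_Integration.integrable_bound)
    show "integrable lborel (\<lambda>t::real. B * indicator {-2..2} t)"
      by (intro integrable_mult_right integrable_real_indicator) auto
    show "AE t in lborel. norm (f (t + c) * exp (\<i> * of_real (w * t))) \<le> norm (B * indicator {-2..2} t)"
    proof (rule AE_I2)
      fix t :: real
      have "0 \<le> B" using B[of 0] norm_ge_zero order_trans by blast
      then show "norm (f (t + c) * exp (\<i> * of_real (w * t))) \<le> norm (B * indicator {-2..2} t)"
        using B[of "t + c"] supp[of "t + c"] that by (auto simp: norm_mult norm_exp_eq_Re indicator_def)
    qed
  qed measurable
  \<comment> \<open>For \<open>w >= pi\<close> the shift is at most 1, which keeps the supports of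
    both functions inside \<open>{-2..2}\<close>.\<close>
  have "norm (LINT t|lborel. f t * exp (\<i> * of_real (w * t))) \<le>
      (LINT t|lborel. norm (f t - f (t + pi / w))) / 2" if w: "pi \<le> w" for w
  proof -
    have w0: "w > 0" "pi / w \<le> 1" "0 \<le> pi / w" using w less_le_trans[OF pi_gt_zero w] by auto
    define I where "I = (LINT t|lborel. f t * exp (\<i> * of_real (w * t)))"
    have "I = (LINT t|lborel. f (pi / w + 1 * t) * exp (\<i> * of_real (w * (pi / w + 1 * t))))"
      unfolding I_def by (subst lborel_integral_real_affine[of 1 _ "pi / w"]) auto
    also have "\<dots> = (LINT t|lborel. - (f (t + pi / w) * exp (\<i> * of_real (w * t))))"
      using w0 by (intro Bochner_Integration.integral_cong)
        (auto simp: algebra_simps exp_add exp_pi_i')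
    also have "\<dots> = - (LINT t|lborel. f (t + pi / w) * exp (\<i> * of_real (w * t)))" by simp
    finally have "2 * I = (LINT t|lborel. f t * exp (\<i> * of_real (w * t))) - (LINT t|lborel. f (t + pi / w) * exp (\<i> * of_real (w * t)))"
      by (simp add: I_def)
    also have "\<dots> = (LINT t|lborel. f t * exp (\<i> * of_real (w * t)) - f (t + pi / w) * exp (\<i> * of_real (w * t)))"
      using int[of 0 w] int[of "pi / w" w] w0 by (intro Bochner_Integration.integral_diff[symmetric]) auto
    also have "norm \<dots> \<le> (LINT t|lborel. norm (f t * exp (\<i> * of_real (w * t)) - f (t + pi / w) * exp (\<i> * of_real (w * t))))"
      by (rule integral_norm_bound)
    also have "\<dots> = (LINT t|lborel. norm (f t - f (t + pi / w)))"
      by (simp add: left_diff_distrib[symmetric] norm_mult norm_exp_eq_Re)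
    finally show ?thesis by (simp add: I_def norm_mult)
  qed
  then have ev: "\<forall>\<^sub>F w in at_top. norm (LINT t|lborel. f t * exp (\<i> * of_real (w * t))) \<le>
      (LINT t|lborel. norm (f t - f (t + pi / w))) / 2"
    by (rule eventually_at_top_linorderI)
  have "((\<lambda>w. LINT t|lborel. norm (f t - f (t + pi / w))) \<longlongrightarrow> (LINT t::real|lborel. (0::real))) at_top"
  proof (rule integral_dominated_convergence_at_top)
    show "integrable lborel (\<lambda>t::real. 2 * B * indicator {-2..2} t)"
      by (intro integrable_mult_right integrable_real_indicator) auto
    show "\<forall>\<^sub>F w in at_top. AE t in lborel. norm (norm (f t - f (t + pi / w))) \<le> 2 * B * indicator {-2..2} t"
    proof (intro eventually_at_top_linorderI[of pi] AE_I2)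
      fix w t :: real assume "pi \<le> w"
      moreover from this have "0 < w" using less_le_trans[OF pi_gt_zero] by blast
      ultimately have w0: "pi / w \<le> 1" "0 \<le> pi / w" by auto
      have "norm (f t - f (t + pi / w)) \<le> 2 * B"
        using norm_triangle_ineq4[of "f t" "f (t + pi / w)"] B[of t] B[of "t + pi / w"] by linarith
      moreover have "f t - f (t + pi / w) = 0" if "t \<notin> {-2..2}"
        using supp[of t] supp[of "t + pi / w"] w0 that by auto
      ultimately show "norm (norm (f t - f (t + pi / w))) \<le> 2 * B * indicator {-2..2} t"
        by (auto simp: indicator_def)
    qed
    show "AE t in lborel. ((\<lambda>w. norm (f t - f (t + pi / w))) \<longlongrightarrow> 0) at_top"
    proof (rule AE_I2)
      fix t :: real
      have "isCont f t" using cont by (simp add: continuous_on_eq_continuous_at)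
      moreover have "((\<lambda>w. t + pi / w) \<longlongrightarrow> t) at_top" by real_asymp
      ultimately have "((\<lambda>w. f (t + pi / w)) \<longlongrightarrow> f t) at_top" by (rule isCont_tendsto_compose)
      then have "((\<lambda>w. norm (f t - f (t + pi / w))) \<longlongrightarrow> norm (f t - f t)) at_top"
        by (intro tendsto_intros)
      then show "((\<lambda>w. norm (f t - f (t + pi / w))) \<longlongrightarrow> 0) at_top" by simp
    qed
  qed measurable
  then have "((\<lambda>w. (LINT t|lborel. norm (f t - f (t + pi / w))) / 2) \<longlongrightarrow> 0) at_top"
    by (auto intro: tendsto_divide_zero)
  then show ?thesis using ev by (rule Lim_null_comparison[rotated])
qed


lemma integrable_exp_minus:
  fixes \<sigma> :: real
  assumes "0 < \<sigma>"
  shows "integrable lborel (\<lambda>u. indicator {0..} u * exp (- (\<sigma> * u)))"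
proof -
  have "set_integrable lborel {0<..} (\<lambda>u. exp (- (u * \<sigma>)))"
    using integrable_I0i_exp_mscale[OF assms] by (simp add: interval_lebesgue_integrable_def)
  then have 1: "integrable lborel (\<lambda>u. indicator {0<..} u * exp (- (u * \<sigma>)))"
    by (simp add: set_integrable_def)
  have "AE u in lborel. u \<noteq> (0::real)" by (rule AE_lborel_singleton)
  then have 2: "AE u in lborel. indicator {0<..} u * exp (- (u * \<sigma>)) = indicator {0..} u * exp (- (\<sigma> * u))"
    by eventually_elim (auto simp: indicator_def mult.commute)
  show ?thesis by (rule integrable_cong_AE_imp[OF 1 _ 2]) measurable
qed

text \<open>Slow oscillation is kept out of the locale: it enters only in \<open>tauberian\<close>,
  to recover \<open>m\<close> from its Fejer averages, which tend to 0 for every bounded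
  \<open>m\<close> with such a \<open>G\<close>.\<close>

locale bounded_laplace =
  fixes m :: "real \<Rightarrow> real" and G :: "complex \<Rightarrow> complex"
  assumes m_measurable [measurable]: "m \<in> borel_measurable borel"
    and m_bound: "\<bar>m u\<bar> \<le> 1"
    and m_neg: "u < 0 \<Longrightarrow> m u = 0"
    and G_cont: "continuous_on {s. 0 \<le> Re s} G"
    and laplace: "0 < Re s \<Longrightarrow> (LINT u|lborel. of_real (m u) * exp (- s * of_real u)) = G s"
begin

text \<open>Write \<open>fejer\<close> as the Fourier integral of \<open>tent\<close> and exchange
  the integrals; the damping \<open>exp (- (\<sigma> * u))\<close> provides the absolute convergence
  that Fubini asks for. The inner integral is the Laplace transform on the line
  \<open>Re s = \<sigma>\<close>.\<close>

lemma smoothed_laplace: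
  assumes \<sigma>: "0 < \<sigma>" and a: "0 < a"
  shows "(LINT u|lborel. of_real (m u * exp (- (\<sigma> * u)) * fejer (a * (v - u)))) =
    (LINT t|lborel. of_real (tent t) * (exp (\<i> * of_real (a * t * v)) * G (Complex \<sigma> (a * t))))"
proof -
  define f where "f u t = of_real (m u * exp (- (\<sigma> * u))) * (of_real (tent t) * exp (\<i> * of_real (a * (v - u) * t)))"
    for u t :: real
  have nf: "norm (f u t) = \<bar>m u\<bar> * exp (- (\<sigma> * u)) * tent t" for u t
    unfolding f_def norm_mult norm_of_real norm_exp_eq_Re by (simp add: abs_mult tent_nonneg)
  have int_m: "integrable lborel (\<lambda>u. \<bar>m u\<bar> * exp (- (\<sigma> * u)))"
  proof (rule Bochner_Integration.integrable_bound[OF integrable_exp_minus[OF \<sigma>]])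
    show "AE u in lborel. norm (\<bar>m u\<bar> * exp (- (\<sigma> * u))) \<le> norm (indicator {0..} u * exp (- (\<sigma> * u)))"
      using m_bound m_neg by (auto intro!: AE_I2 simp: indicator_def abs_mult)
  qed measurable
  have int: "integrable (lborel \<Otimes>\<^sub>M lborel) (case_prod f)"
  proof (rule lborel_pair.Fubini_integrable)
    show "case_prod f \<in> borel_measurable (lborel \<Otimes>\<^sub>M lborel)"
      unfolding f_def[abs_def] by measurable
    show "integrable lborel (\<lambda>u. LINT t|lborel. norm (case_prod f (u, t)))"
      using int_m by (simp add: nf)
    show "AE u in lborel. integrable lborel (\<lambda>t. case_prod f (u, t))"
      unfolding f_def[abs_def]
      by (intro AE_I2, simp, intro integrable_mult_right impI integrable_tent_mult[of _ 1])
        (auto simp: norm_exp_eq_Re)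
  qed
  have "(LINT u|lborel. of_real (m u * exp (- (\<sigma> * u)) * fejer (a * (v - u)))) = (LINT u|lborel. LINT t|lborel. f u t)"
  proof (rule integral_cong_AE)
    \<comment> \<open>The Fourier formula was computed for nonzero arguments, so the point
      \<open>u = v\<close> is discarded as a null set.\<close>
    have "AE u in lborel. u \<noteq> v" by (rule AE_lborel_singleton)
    then show "AE u in lborel. of_real (m u * exp (- (\<sigma> * u)) * fejer (a * (v - u))) = (LINT t|lborel. f u t)"
    proof eventually_elim
      case (elim u)
      then show ?case unfolding f_def using integral_tent_exp[of "a * (v - u)"] a by simp
    qed
    show "(\<lambda>u. LINT t|lborel. f u t) \<in> borel_measurable lborel"
      unfolding f_def[abs_def] by measurable
  qed measurable
  also have "\<dots> = (LINT t|lborel. LINT u|lborel. f u t)"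
    by (rule lborel_pair.Fubini_integral[OF int, symmetric])
  also have "\<dots> = (LINT t|lborel. of_real (tent t) * (exp (\<i> * of_real (a * t * v)) * G (Complex \<sigma> (a * t))))"
  proof (rule Bochner_Integration.integral_cong[OF refl])
    fix t :: real
    let ?s = "Complex \<sigma> (a * t)"
    have "f u t = (of_real (tent t) * exp (\<i> * of_real (a * t * v))) * (of_real (m u) * exp (- ?s * of_real u))" for u
      unfolding f_def of_real_mult exp_of_real[symmetric]
      by (simp add: Complex_eq algebra_simps exp_add[symmetric] exp_diff exp_minus field_simps)
    then show "(LINT u|lborel. f u t) = of_real (tent t) * (exp (\<i> * of_real (a * t * v)) * G ?s)"
      using laplace[of ?s] \<sigma> by simp
  qed
  finally show ?thesis .
qed

lemma fejer_affine_integrable: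
  assumes "0 < a"
  shows "integrable lborel (\<lambda>u. fejer (a * (v - u)))"
proof -
  have "integrable lborel (\<lambda>u. fejer (a * v + (- a) * u))"
    using fejer_integrable assms by (intro lborel_integrable_real_affine) auto
  then show ?thesis by (simp add: algebra_simps)
qed

text \<open>Let \<open>\<sigma>\<close> tend to 0. The left side is dominated by
  \<open>fejer\<close>. On the right \<open>tent\<close> confines the argument of \<open>G\<close>
  to the compact rectangle \<open>S\<close>, and continuity of \<open>G\<close> there supplies the
  dominating constant.\<close>

lemma smoothed_boundary:
  assumes a: "0 < a"
  shows "of_real (LINT u|lborel. m u * fejer (a * (v - u))) =
    (LINT t|lborel. of_real (tent t) * (exp (\<i> * of_real (a * t * v)) * G (Complex 0 (a * t))))"
proof -
  define S where "S = cbox (Complex 0 (- a)) (Complex 1 a)"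
  have S: "S \<subseteq> {s. 0 \<le> Re s}" by (auto simp: S_def in_cbox_complex_iff)
  obtain B where B: "\<And>s. s \<in> S \<Longrightarrow> norm (G s) \<le> B"
  proof -
    have "bounded (G ` S)"
      using continuous_on_subset[OF G_cont S]
      by (intro compact_imp_bounded compact_continuous_image) (auto simp: S_def)
    then show ?thesis using that unfolding bounded_iff by blast
  qed
  have GS: "norm (G (Complex \<sigma> (a * t))) \<le> B" if "0 \<le> \<sigma>" "\<sigma> \<le> 1" "\<bar>t\<bar> < 1" for \<sigma> t
  proof (rule B)
    have "- 1 < t" "t < 1" using that by auto
    then have "a * (- 1) \<le> a * t" "a * t \<le> a * 1" using a mult_left_mono[of "- 1" t a] mult_left_mono[of t 1 a] by auto
    then show "Complex \<sigma> (a * t) \<in> S" using that by (simp add: S_def in_cbox_complex_iff)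
  qed
  have B0: "0 \<le> B" using order_trans[OF norm_ge_zero GS[of 0 0]] by simp
  define \<sigma> where "\<sigma> n = inverse (real (Suc n))" for n
  have \<sigma>: "0 < \<sigma> n" "\<sigma> n \<le> 1" for n by (auto simp: \<sigma>_def field_simps)
  have \<sigma>0: "\<sigma> \<longlonglongrightarrow> 0" unfolding \<sigma>_def[abs_def] by (rule LIMSEQ_inverse_real_of_nat)
  have Gc: "continuous_on UNIV (\<lambda>t. G (Complex s (a * t)))" if "0 \<le> s" for s
    using that unfolding Complex_eq
    by (intro continuous_on_compose2[OF G_cont] continuous_intros) auto
  have Gm: "(\<lambda>t. G (Complex s (a * t))) \<in> borel_measurable borel" if "0 \<le> s" for s
    using Gc[OF that] by (rule borel_measurable_continuous_onI)
  have [measurable]: "(\<lambda>t. G (Complex 0 (a * t))) \<in> borel_measurable borel"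
    "\<And>n. (\<lambda>t. G (Complex (\<sigma> n) (a * t))) \<in> borel_measurable borel"
    using \<sigma> by (auto intro!: Gm simp: less_imp_le)
  have L: "(\<lambda>n. LINT u|lborel. complex_of_real (m u * exp (- (\<sigma> n * u)) * fejer (a * (v - u))))
      \<longlonglongrightarrow> (LINT u|lborel. complex_of_real (m u * fejer (a * (v - u))))"
  proof (rule integral_dominated_convergence)
    show "integrable lborel (\<lambda>u. fejer (a * (v - u)))" by (rule fejer_affine_integrable[OF a])
    show "AE u in lborel. norm (complex_of_real (m u * exp (- (\<sigma> n * u)) * fejer (a * (v - u)))) \<le> fejer (a * (v - u))" for n
    proof (rule AE_I2)
      fix u :: real
      have "\<bar>m u\<bar> * exp (- (\<sigma> n * u)) \<le> 1"
      proof (cases "u < 0")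
        case False
        then have "exp (- (\<sigma> n * u)) \<le> 1" using \<sigma>(1)[of n] by (simp add: less_imp_le)
        then show ?thesis using m_bound[of u] by (intro mult_le_one) auto
      qed (simp add: m_neg)
      then show "norm (complex_of_real (m u * exp (- (\<sigma> n * u)) * fejer (a * (v - u)))) \<le> fejer (a * (v - u))"
        using mult_right_mono[of "\<bar>m u\<bar> * exp (- (\<sigma> n * u))" 1 "fejer (a * (v - u))"] fejer_nonneg
        by (simp only: norm_of_real abs_mult) (simp add: fejer_nonneg)
    qed
    show "AE u in lborel. (\<lambda>n. complex_of_real (m u * exp (- (\<sigma> n * u)) * fejer (a * (v - u))))
        \<longlonglongrightarrow> complex_of_real (m u * fejer (a * (v - u)))"
      by (intro AE_I2 tendsto_of_real) (auto intro!: tendsto_eq_intros \<sigma>0)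
  qed measurable
  have R: "(\<lambda>n. LINT t|lborel. of_real (tent t) * (exp (\<i> * of_real (a * t * v)) * G (Complex (\<sigma> n) (a * t))))
      \<longlonglongrightarrow> (LINT t|lborel. of_real (tent t) * (exp (\<i> * of_real (a * t * v)) * G (Complex 0 (a * t))))"
  proof (rule integral_dominated_convergence)
    show "integrable lborel (\<lambda>t::real. B * indicator {-1..1} t)"
      by (intro integrable_mult_right integrable_real_indicator) auto
    show "AE t in lborel. norm (of_real (tent t) * (exp (\<i> * of_real (a * t * v)) * G (Complex (\<sigma> n) (a * t)))) \<le> B * indicator {-1..1} t" for n
    proof (rule AE_I2)
      fix t :: real
      show "norm (of_real (tent t) * (exp (\<i> * of_real (a * t * v)) * G (Complex (\<sigma> n) (a * t)))) \<le> B * indicator {-1..1} t"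
      proof (cases "\<bar>t\<bar> < 1")
        case True
        have "tent t * norm (G (Complex (\<sigma> n) (a * t))) \<le> 1 * B"
          using GS[of "\<sigma> n" t] \<sigma>[of n] True tent_le_1[of t] tent_nonneg[of t]
          by (intro mult_mono) (auto simp: less_imp_le)
        then show ?thesis using True by (auto simp: norm_mult norm_exp_eq_Re tent_nonneg indicator_def)
      qed (auto simp: tent_eq_0 indicator_def B0)
    qed
    show "AE t in lborel. (\<lambda>n. of_real (tent t) * (exp (\<i> * of_real (a * t * v)) * G (Complex (\<sigma> n) (a * t))))
        \<longlonglongrightarrow> of_real (tent t) * (exp (\<i> * of_real (a * t * v)) * G (Complex 0 (a * t)))"
    proof (intro AE_I2 tendsto_intros)
      fix t :: real
      show "(\<lambda>n. G (Complex (\<sigma> n) (a * t))) \<longlonglongrightarrow> G (Complex 0 (a * t))"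
      proof (rule continuous_on_tendsto_compose[OF G_cont])
        show "(\<lambda>n. Complex (\<sigma> n) (a * t)) \<longlonglongrightarrow> Complex 0 (a * t)"
          unfolding Complex_eq by (auto intro!: tendsto_eq_intros \<sigma>0)
        show "\<forall>\<^sub>F n in sequentially. Complex (\<sigma> n) (a * t) \<in> {s. 0 \<le> Re s}"
          using \<sigma> by (auto intro!: always_eventually simp: less_imp_le)
      qed simp
    qed
  qed measurable
  have "(LINT u|lborel. complex_of_real (m u * fejer (a * (v - u)))) =
      (LINT t|lborel. of_real (tent t) * (exp (\<i> * of_real (a * t * v)) * G (Complex 0 (a * t))))"
    using L R unfolding smoothed_laplace[OF \<sigma>(1) a] by (rule LIMSEQ_unique)
  then show ?thesis by (simp only: integral_complex_of_real)
qed

text \<open>After the substitution \<open>u = v - y / a\<close>, the parameter \<open>v\<close>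
  survives on the boundary side only as the frequency \<open>a * v\<close> of a Fourier integral, so
  Riemann-Lebesgue applies.\<close>

lemma smoothed_tendsto:
  assumes a: "0 < a"
  shows "((\<lambda>v. LINT y|lborel. m (v - y / a) * fejer y) \<longlongrightarrow> 0) at_top"
proof -
  define f where "f t = of_real (tent t) * G (Complex 0 (a * t))" for t
  have "((\<lambda>w. LINT t|lborel. f t * exp (\<i> * of_real (w * t))) \<longlongrightarrow> 0) at_top"
  proof (rule riemann_lebesgue_compact_support)
    show "continuous_on UNIV f"
      unfolding f_def Complex_eq
      by (intro continuous_intros continuous_on_compose2[OF G_cont]) auto
  qed (simp add: f_def tent_eq_0)
  moreover have "filterlim (\<lambda>v. a * v) at_top at_top"
    using a by (intro filterlim_tendsto_pos_mult_at_top[OF tendsto_const] filterlim_ident) auto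
  ultimately have "((\<lambda>v. LINT t|lborel. f t * exp (\<i> * of_real (a * v * t))) \<longlongrightarrow> 0) at_top"
    by (rule filterlim_compose)
  moreover have "(LINT t|lborel. f t * exp (\<i> * of_real (a * v * t))) =
      of_real (\<bar>- (1 / a)\<bar> * (LINT y|lborel. m (v - y / a) * fejer y))" for v
  proof -
    have "(LINT t|lborel. f t * exp (\<i> * of_real (a * v * t))) = of_real (LINT u|lborel. m u * fejer (a * (v - u)))"
      unfolding smoothed_boundary[OF a] f_def by (simp add: mult_ac)
    also have "(LINT u|lborel. m u * fejer (a * (v - u))) = \<bar>- (1 / a)\<bar> *\<^sub>R
        (LINT y|lborel. m (v + (- (1 / a)) * y) * fejer (a * (v - (v + (- (1 / a)) * y))))"
      using a by (intro lborel_integral_real_affine) auto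
    also have "\<dots> = \<bar>- (1 / a)\<bar> * (LINT y|lborel. m (v - y / a) * fejer y)"
      using a by simp
    finally show ?thesis .
  qed
  ultimately have "((\<lambda>v. complex_of_real (\<bar>- (1 / a)\<bar> * (LINT y|lborel. m (v - y / a) * fejer y))) \<longlongrightarrow> of_real 0) at_top"
    by simp
  then have "((\<lambda>v. a * (\<bar>- (1 / a)\<bar> * (LINT y|lborel. m (v - y / a) * fejer y))) \<longlongrightarrow> a * 0) at_top"
    unfolding tendsto_of_real_iff by (intro tendsto_mult tendsto_const)
  then show ?thesis using a by simp
qed

text \<open>The average of \<open>m\<close> around \<open>v\<close> tends to 0, and slow oscillation
  bounds its distance from \<open>m v\<close> by two integrals. The kernel is first made narrow by
  fixing a large \<open>a\<close>, which controls the Lipschitz part; then \<open>v\<close> grows,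
  which removes the exponential part.\<close>

theorem tauberian:
  assumes slow: "\<And>v w. v \<le> w \<Longrightarrow> \<bar>m w - m v\<bar> \<le> (w - v) + exp (- v)"
  shows "(m \<longlongrightarrow> 0) at_top"
proof (rule tendstoI)
  define c where "c = (LINT x|lborel. fejer x)"
  have c: "0 < c" unfolding c_def by (rule fejer_integral_pos)
  fix \<epsilon> :: real assume "0 < \<epsilon>"
  then have \<epsilon>: "0 < \<epsilon> * c / 3" using c by simp
  have int: "integrable lborel (\<lambda>y. g y * fejer y)"
    if [measurable]: "g \<in> borel_measurable borel" and "\<And>y. \<bar>g y\<bar> \<le> 2" for g
  proof (rule Bochner_Integration.integrable_bound)
    show "integrable lborel (\<lambda>y. 2 * fejer y)" using fejer_integrable by simp
    show "AE y in lborel. norm (g y * fejer y) \<le> norm (2 * fejer y)"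
      using that(2) fejer_nonneg by (auto intro!: AE_I2 mult_right_mono simp: abs_mult)
  qed measurable
  have dom: "((\<lambda>r. LINT y|lborel. g r y * fejer y) \<longlongrightarrow> 0) at_top"
    if [measurable]: "\<And>r. g r \<in> borel_measurable borel" and "\<And>r y. \<bar>g r y\<bar> \<le> 2"
      and lim: "\<And>y. ((\<lambda>r. g r y) \<longlongrightarrow> 0) at_top" for g :: "real \<Rightarrow> real \<Rightarrow> real"
  proof -
    have "((\<lambda>r. LINT y|lborel. g r y * fejer y) \<longlongrightarrow> (LINT y::real|lborel. (0::real))) at_top"
    proof (rule integral_dominated_convergence_at_top)
      show "integrable lborel (\<lambda>y. 2 * fejer y)" using fejer_integrable by simp
      show "\<forall>\<^sub>F r in at_top. AE y in lborel. norm (g r y * fejer y) \<le> 2 * fejer y"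
        using that(2) fejer_nonneg by (auto intro!: always_eventually AE_I2 mult_right_mono simp: abs_mult)
      show "AE y in lborel. ((\<lambda>r. g r y * fejer y) \<longlongrightarrow> 0) at_top"
        by (intro AE_I2 tendsto_mult_left_zero lim)
    qed measurable
    then show ?thesis by simp
  qed
  \<comment> \<open>The function \<open>\<bar>y\<bar> * fejer y\<close> is not integrable, hence the
    cap at 2, the trivial bound for a difference of two values of \<open>m\<close>. The absolute
    value of \<open>r\<close> keeps the integrand bounded for negative \<open>r\<close> too.\<close>
  have "((\<lambda>r. LINT y|lborel. min 2 (\<bar>y\<bar> / \<bar>r\<bar>) * fejer y) \<longlongrightarrow> 0) at_top"
  proof (rule dom)
    fix y :: real
    have "((\<lambda>r. \<bar>y\<bar> / \<bar>r\<bar>) \<longlongrightarrow> 0) at_top" by real_asymp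
    from tendsto_min[OF tendsto_const this, of 2] show "((\<lambda>r. min 2 (\<bar>y\<bar> / \<bar>r\<bar>)) \<longlongrightarrow> 0) at_top" by simp
  qed (auto simp: min_def)
  then have "\<forall>\<^sub>F r in at_top. (LINT y|lborel. min 2 (\<bar>y\<bar> / \<bar>r\<bar>) * fejer y) < \<epsilon> * c / 3"
    using \<epsilon> by (rule order_tendstoD)
  with eventually_gt_at_top[of 0] have "\<forall>\<^sub>F r in at_top. 0 < r \<and> (LINT y|lborel. min 2 (\<bar>y\<bar> / \<bar>r\<bar>) * fejer y) < \<epsilon> * c / 3"
    by (rule eventually_conj)
  from eventually_happens'[OF trivial_limit_at_top_linorder this]
  obtain a where a: "0 < a" "(LINT y|lborel. min 2 (\<bar>y\<bar> / \<bar>a\<bar>) * fejer y) < \<epsilon> * c / 3"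
    by blast
  have "((\<lambda>v. LINT y|lborel. min 2 (exp (\<bar>y\<bar> / a - v)) * fejer y) \<longlongrightarrow> 0) at_top"
  proof (rule dom)
    fix y :: real
    have "((\<lambda>v. exp (\<bar>y\<bar> / a - v)) \<longlongrightarrow> 0) at_top" by real_asymp
    from tendsto_min[OF tendsto_const this, of 2] show "((\<lambda>v. min 2 (exp (\<bar>y\<bar> / a - v))) \<longlongrightarrow> 0) at_top" by simp
  qed (auto simp: min_def)
  then have "\<forall>\<^sub>F v in at_top. (LINT y|lborel. min 2 (exp (\<bar>y\<bar> / a - v)) * fejer y) < \<epsilon> * c / 3"
    using \<epsilon> by (rule order_tendstoD)
  moreover have "\<forall>\<^sub>F v in at_top. \<bar>LINT y|lborel. m (v - y / a) * fejer y\<bar> < \<epsilon> * c / 3"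
    using tendstoD[OF smoothed_tendsto[OF a(1)] \<epsilon>] by simp
  ultimately show "\<forall>\<^sub>F v in at_top. dist (m v) 0 < \<epsilon>"
  proof eventually_elim
    case (elim v)
    have bd: "\<bar>m v - m (v - y / a)\<bar> \<le> min 2 (\<bar>y\<bar> / \<bar>a\<bar>) + min 2 (exp (\<bar>y\<bar> / a - v))" for y
    proof -
      have 2: "\<bar>m v - m (v - y / a)\<bar> \<le> 2" using m_bound[of v] m_bound[of "v - y / a"] by linarith
      have "\<bar>m v - m (v - y / a)\<bar> \<le> \<bar>y\<bar> / a + exp (\<bar>y\<bar> / a - v)"
      proof (cases "0 \<le> y")
        case True
        then show ?thesis using slow[of "v - y / a" v] a(1) by simp
      next
        case False
        then have "\<bar>m (v - y / a) - m v\<bar> \<le> - y / a + exp (- v)"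
          using slow[of v "v - y / a"] a(1) by (simp add: divide_nonpos_pos)
        moreover have "exp (- v) \<le> exp (\<bar>y\<bar> / a - v)" using a(1) by simp
        moreover have "- y / a = \<bar>y\<bar> / a" using False by simp
        ultimately show ?thesis by linarith
      qed
      moreover have "0 \<le> \<bar>y\<bar> / a" using a(1) by simp
      moreover have "p \<le> min 2 q + min 2 r" if "p \<le> q + r" "p \<le> 2" "0 \<le> q" "0 \<le> r" for p q r :: real
        using that by (auto simp: min_def)
      ultimately show ?thesis using 2 a(1) by simp
    qed
    have i1: "integrable lborel (\<lambda>y. m (v - y / a) * fejer y)"
      using m_bound by (intro int) (auto intro: order_trans[of _ 1])
    have i0: "integrable lborel (\<lambda>y. m v * fejer y)" using fejer_integrable by simp
    have i2: "integrable lborel (\<lambda>y. min 2 (\<bar>y\<bar> / \<bar>a\<bar>) * fejer y)" by (intro int) (auto simp: min_def)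
    have i3: "integrable lborel (\<lambda>y. min 2 (exp (\<bar>y\<bar> / a - v)) * fejer y)" by (intro int) (auto simp: min_def)
    have "m v * c - (LINT y|lborel. m (v - y / a) * fejer y) = (LINT y|lborel. m v * fejer y - m (v - y / a) * fejer y)"
      unfolding c_def using i0 i1 by simp
    also have "\<bar>\<dots>\<bar> \<le> (LINT y|lborel. min 2 (\<bar>y\<bar> / \<bar>a\<bar>) * fejer y + min 2 (exp (\<bar>y\<bar> / a - v)) * fejer y)"
    proof (rule integral_abs_bound[THEN order_trans], rule integral_mono)
      show "integrable lborel (\<lambda>y. \<bar>m v * fejer y - m (v - y / a) * fejer y\<bar>)" using i0 i1 by simp
      show "integrable lborel (\<lambda>y. min 2 (\<bar>y\<bar> / \<bar>a\<bar>) * fejer y + min 2 (exp (\<bar>y\<bar> / a - v)) * fejer y)"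
        using i2 i3 by simp
      show "\<bar>m v * fejer y - m (v - y / a) * fejer y\<bar> \<le> min 2 (\<bar>y\<bar> / \<bar>a\<bar>) * fejer y + min 2 (exp (\<bar>y\<bar> / a - v)) * fejer y" for y
        unfolding left_diff_distrib[symmetric] distrib_right[symmetric] abs_mult
        using bd[of y] fejer_nonneg[of y] by (simp add: mult_right_mono)
    qed
    also have "\<dots> = (LINT y|lborel. min 2 (\<bar>y\<bar> / \<bar>a\<bar>) * fejer y) + (LINT y|lborel. min 2 (exp (\<bar>y\<bar> / a - v)) * fejer y)"
      using i2 i3 by (rule Bochner_Integration.integral_add)
    finally have "\<bar>m v * c\<bar> < \<epsilon> * c" using elim a(2) by linarith
    then show ?case using c by (simp add: abs_mult)
  qed
qed

end

section \<open>The prime number theorem for the Moebius function\<close>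

lemma
  assumes s: "0 < Re s" and b: "0 \<le> b"
  shows set_integrable_exp_minus: "set_integrable lborel {b..} (\<lambda>u. exp (- s * of_real u))"
    and set_integral_exp_minus: "(LINT u:{b..}|lborel. exp (- s * of_real u)) = exp (- s * of_real b) / s"
proof -
  let ?e = "\<lambda>u::real. exp (- s * of_real u)"
  have ne: "norm (?e u) = exp (- (Re s * u))" for u by (simp add: norm_exp_eq_Re)
  have dom: "norm (indicator A u *\<^sub>R ?e u) \<le> indicator {0..} u * exp (- (Re s * u))"
    if "A \<subseteq> {b..}" for A and u :: real
    using that b by (auto simp: ne indicator_def norm_mult)
  show "set_integrable lborel {b..} ?e"
    unfolding set_integrable_def
  proof (rule Bochner_Integration.integrable_bound[OF integrable_exp_minus[OF s]])
    show "AE u in lborel. norm (indicator {b..} u *\<^sub>R ?e u) \<le> norm (indicator {0..} u * exp (- (Re s * u)))"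
      by (rule AE_I2) (rule order_trans[OF dom[OF subset_refl]], simp)
  qed measurable
  have F: "((\<lambda>u. - exp (- s * of_real u) / s) has_vector_derivative ?e u) (at u within A)" for u :: real and A
  proof (rule has_vector_derivative_real_field)
    show "((\<lambda>z. - exp (- s * z) / s) has_field_derivative exp (- s * of_real u)) (at (of_real u))"
      using s by (auto intro!: derivative_eq_intros)
  qed
  have "(\<lambda>n. LINT u|lborel. indicator {b..b + real n} u *\<^sub>R ?e u) \<longlonglongrightarrow> (LINT u|lborel. indicator {b..} u *\<^sub>R ?e u)"
  proof (rule integral_dominated_convergence[OF _ _ integrable_exp_minus[OF s]])
    show "AE u in lborel. norm (indicator {b..b + real n} u *\<^sub>R ?e u) \<le> indicator {0..} u * exp (- (Re s * u))" for n
      by (intro AE_I2 dom) auto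
    show "AE u in lborel. (\<lambda>n. indicator {b..b + real n} u *\<^sub>R ?e u) \<longlonglongrightarrow> indicator {b..} u *\<^sub>R ?e u"
    proof (intro AE_I2 tendsto_scaleR tendsto_const)
      fix u :: real
      obtain N where "u - b \<le> real N" using real_arch_simple by blast
      then have "\<forall>\<^sub>F n in sequentially. indicat_real {b..b + real n} u = indicator {b..} u"
        by (intro eventually_sequentiallyI[of N]) (auto simp: indicator_def)
      then show "(\<lambda>n. indicat_real {b..b + real n} u) \<longlonglongrightarrow> indicator {b..} u" by (rule tendsto_eventually)
    qed
  qed measurable
  moreover have "(LINT u|lborel. indicator {b..b + real n} u *\<^sub>R ?e u) = - ?e (b + real n) / s - (- ?e b / s)" for n
    by (intro integral_FTC_Icc F continuous_intros) auto
  moreover have "(\<lambda>n. - ?e (b + real n) / s - (- ?e b / s)) \<longlonglongrightarrow> - 0 / s - (- ?e b / s)"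
  proof (intro tendsto_intros)
    have "(\<lambda>n. exp (- (Re s * (b + real n)))) \<longlonglongrightarrow> 0" using s by real_asymp
    then have "(\<lambda>n. norm (?e (b + real n))) \<longlonglongrightarrow> 0" by (simp only: ne)
    then show "(\<lambda>n. ?e (b + real n)) \<longlonglongrightarrow> 0" by (rule tendsto_norm_zero_cancel)
  qed (use s in auto)
  ultimately have "(LINT u|lborel. indicator {b..} u *\<^sub>R ?e u) = - 0 / s - (- ?e b / s)"
    using LIMSEQ_unique by simp
  then show "(LINT u:{b..}|lborel. ?e u) = ?e b / s"
    by (simp add: set_lebesgue_integral_def)
qed

text \<open>As a function of \<open>u\<close> the mean is a sum of steps: the integer
  \<open>N\<close> contributes \<open>moebius_mu N / N\<close> from \<open>u = ln N\<close> on, and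
  a step at \<open>b\<close> has transform \<open>exp (- s * b) / s\<close>. Absolute convergence
  for \<open>Re s > 0\<close> permits integrating term by term.\<close>

lemma laplace_moebius_mean:
  assumes s: "0 < Re s"
  shows "(LINT u|lborel. of_real (moebius_mean 0 (nat \<lfloor>exp u\<rfloor>)) * exp (- s * of_real u))
    = dseries moebius_mu 0 (1 + s) / s"
proof -
  let ?e = "\<lambda>s (u::real). exp (- s * of_real u)"
  \<comment> \<open>Index \<open>n\<close> stands for the integer \<open>Suc n\<close>, which enters
    the mean at \<open>u = b n\<close>.\<close>
  define b where "b n = ln (real (Suc n))" for n
  have b0: "0 \<le> b n" for n by (simp add: b_def)
  define c where "c n = moebius_mu (Suc n) / Suc n" for n
  define f where "f n u = c n *\<^sub>R (indicator {b n..} u *\<^sub>R ?e s u)" for n u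
  have int: "integrable lborel (f n)" for n
    using set_integrable_exp_minus[OF s b0[of n]] unfolding f_def[abs_def] set_integrable_def
    by (intro integrable_scaleR_right)
  have nz: "f n u = 0" if "n \<notin> {..<nat \<lfloor>exp u\<rfloor>}" for n u
  proof -
    have "exp u < real (Suc n)" using that by (simp add: not_less) linarith
    then have "u < b n" unfolding b_def by (metis exp_gt_zero ln_exp ln_less_cancel_iff of_nat_0_less_iff zero_less_Suc)
    then show ?thesis by (simp add: f_def)
  qed
  have nn: "norm (f n u) = \<bar>c n\<bar> * (indicator {b n..} u * exp (- (Re s * u)))" for n u
    by (simp add: f_def norm_exp_eq_Re abs_mult)
  have real_int: "(LINT u|lborel. indicator {b n..} u * exp (- (Re s * u))) = exp (- (Re s * b n)) / Re s" for n
  proof -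
    have "complex_of_real (LINT u|lborel. indicator {b n..} u * exp (- (Re s * u))) =
        (LINT u|lborel. indicator {b n..} u *\<^sub>R ?e (of_real (Re s)) u)"
      unfolding integral_complex_of_real[symmetric]
      by (intro Bochner_Integration.integral_cong) (auto simp: indicator_def exp_of_real[symmetric])
    also have "\<dots> = ?e (of_real (Re s)) (b n) / of_real (Re s)"
      using set_integral_exp_minus[of "of_real (Re s)" "b n"] s b0
      by (simp add: set_lebesgue_integral_def)
    also have "\<dots> = of_real (exp (- (Re s * b n)) / Re s)" by (simp add: exp_of_real[symmetric])
    finally show ?thesis by (simp only: of_real_eq_iff)
  qed
  have "(\<lambda>n. LINT u|lborel. f n u) sums (LINT u|lborel. (\<Sum>n. f n u))"
  proof (rule sums_integral)
    show "AE u in lborel. summable (\<lambda>n. norm (f n u))"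
      using nz by (intro AE_I2 summable_finite[of "{..<nat \<lfloor>exp _\<rfloor>}"]) auto
    show "summable (\<lambda>n. LINT u|lborel. norm (f n u))"
    proof (rule summable_comparison_test')
      show "summable (\<lambda>n. real (Suc n) powr - (1 + Re s) / Re s)"
        using summable_powr_minus[of "1 + Re s"] s by (intro summable_divide) (subst summable_Suc_iff, auto)
      fix n
      have "exp (- (Re s * b n)) = real (Suc n) powr - Re s" by (simp add: powr_def b_def)
      moreover have "\<bar>c n\<bar> \<le> real (Suc n) powr - 1"
        using abs_moebius_le[of "Suc n"] by (simp add: c_def powr_minus_divide divide_right_mono del: of_nat_Suc)
      ultimately have "\<bar>c n\<bar> * exp (- (Re s * b n)) \<le> real (Suc n) powr - 1 * real (Suc n) powr - Re s"
        by (simp only:) (rule mult_right_mono, auto)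
      also have "\<dots> = real (Suc n) powr - (1 + Re s)"
        by (simp only: powr_add[symmetric] minus_add_distrib)
      finally show "norm (LINT u|lborel. norm (f n u)) \<le> real (Suc n) powr - (1 + Re s) / Re s"
        using s unfolding nn by (simp add: real_int abs_mult divide_right_mono del: of_nat_Suc)
    qed
  qed (rule int)
  moreover have "(LINT u|lborel. f n u) = of_real (moebius_mu (Suc n)) * of_nat (Suc n) powr - (1 + s) / s" for n
  proof -
    have "(LINT u|lborel. f n u) = c n *\<^sub>R (?e s (b n) / s)"
      using set_integral_exp_minus[OF s b0[of n]]
      unfolding f_def set_lebesgue_integral_def by (simp only: integral_scaleR_right)
    also have "?e s (b n) = of_nat (Suc n) powr - s"
      by (simp add: powr_def b_def del: of_nat_Suc)
    also have "c n *\<^sub>R (of_nat (Suc n) powr - s / s) = of_real (moebius_mu (Suc n)) * of_nat (Suc n) powr - (1 + s) / s"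
      by (simp add: c_def scaleR_conv_of_real powr_diff powr_minus field_simps del: of_nat_Suc)
    finally show ?thesis .
  qed
  moreover have "(\<lambda>n. of_real (moebius_mu (Suc n)) * of_nat (Suc n) powr - (1 + s) / s) sums (dseries moebius_mu 0 (1 + s) / s)"
    using s abs_moebius_le by (intro sums_divide dseries_0_sums) auto
  ultimately have "(LINT u|lborel. (\<Sum>n. f n u)) = dseries moebius_mu 0 (1 + s) / s"
    using sums_unique2 by simp
  moreover have "(\<Sum>n. f n u) = of_real (moebius_mean 0 (nat \<lfloor>exp u\<rfloor>)) * ?e s u" for u
  proof -
    have "(\<Sum>n. f n u) = (\<Sum>n<nat \<lfloor>exp u\<rfloor>. f n u)" using nz by (intro suminf_finite) auto
    also have "\<dots> = (\<Sum>n<nat \<lfloor>exp u\<rfloor>. c n *\<^sub>R ?e s u)"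
    proof (intro sum.cong refl)
      fix n assume "n \<in> {..<nat \<lfloor>exp u\<rfloor>}"
      then have "real (Suc n) \<le> exp u" by simp linarith
      then have "b n \<le> u" unfolding b_def by (metis ln_exp ln_mono of_nat_0_less_iff zero_less_Suc)
      then show "f n u = c n *\<^sub>R ?e s u" by (simp add: f_def)
    qed
    also have "\<dots> = (\<Sum>n<nat \<lfloor>exp u\<rfloor>. c n) *\<^sub>R ?e s u" by (simp add: scaleR_sum_left)
    also have "(\<Sum>n<nat \<lfloor>exp u\<rfloor>. c n) = moebius_mean 0 (nat \<lfloor>exp u\<rfloor>)"
      unfolding moebius_mean_alt c_def
      by (rule sum.reindex_bij_witness[of _ "\<lambda>n. n - 1" Suc]) auto
    finally show ?thesis by (simp add: scaleR_conv_of_real)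
  qed
  ultimately show ?thesis by simp
qed

text \<open>The terms between the two cut-offs are at most \<open>1 / n\<close>. The first is split
  off and gives \<open>exp (- v)\<close>, which accounts for a single jump; the others sum to at
  most \<open>w - v\<close>. For negative \<open>v\<close> the mean at \<open>v\<close> is 0 and
  \<open>exp (- v)\<close> already exceeds 1.\<close>

lemma moebius_mean_slow:
  assumes "v \<le> w"
  shows "\<bar>moebius_mean 0 (nat \<lfloor>exp w\<rfloor>) - moebius_mean 0 (nat \<lfloor>exp v\<rfloor>)\<bar>
    \<le> (w - v) + exp (- v)"
proof (cases "v < 0")
  case True
  then have "\<lfloor>exp v\<rfloor> \<le> 0" by (simp add: floor_le_iff)
  then have "moebius_mean 0 (nat \<lfloor>exp v\<rfloor>) = 0" by (simp add: moebius_mean_def)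
  moreover have "\<bar>moebius_mean 0 (nat \<lfloor>exp w\<rfloor>)\<bar> \<le> 1"
    by (rule abs_moebius_mean_le)
  moreover have "1 \<le> exp (- v)" using True by simp
  ultimately show ?thesis using assms by linarith
next
  case False
  define A where "A = nat \<lfloor>exp v\<rfloor>"
  define B where "B = nat \<lfloor>exp w\<rfloor>"
  have AB: "A \<le> B" unfolding A_def B_def using assms by (intro nat_mono floor_mono) simp
  have A1: "exp v < real (Suc A)" unfolding A_def by linarith
  have B1: "real B \<le> exp w" unfolding B_def by simp
  have ev: "exp v \<ge> 1" using False by simp
  have "\<bar>moebius_mean 0 B - moebius_mean 0 A\<bar> \<le> (w - v) + exp (- v)"
  proof (cases "A = B")
    case True
    then show ?thesis using assms by (simp add: add_nonneg_nonneg)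
  next
    case False
    have "{n \<in> {1..B}. rough 0 n} = {n \<in> {1..A}. rough 0 n} \<union> {A<..B}" using AB by auto
    moreover have "(\<Sum>n\<in>{n \<in> {1..A}. rough 0 n} \<union> {A<..B}. moebius_mu n / n) =
        moebius_mean 0 A + (\<Sum>n\<in>{A<..B}. moebius_mu n / n)"
      unfolding moebius_mean_def by (rule sum.union_disjoint) auto
    ultimately have "moebius_mean 0 B = moebius_mean 0 A + (\<Sum>n\<in>{A<..B}. moebius_mu n / n)"
      unfolding moebius_mean_def by metis
    then have "moebius_mean 0 B - moebius_mean 0 A = (\<Sum>n\<in>{A<..B}. moebius_mu n / n)"
      by simp
    also have "\<bar>\<dots>\<bar> \<le> (\<Sum>n\<in>{A<..B}. 1 / real n)"
      using abs_moebius_le by (intro order.trans[OF sum_abs sum_mono]) (auto simp: divide_right_mono)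
    also have "{A<..B} = insert (Suc A) {Suc A<..B}" using AB False by auto
    also have "(\<Sum>n\<in>insert (Suc A) {Suc A<..B}. 1 / real n) = 1 / real (Suc A) + (\<Sum>n\<in>{Suc A<..B}. 1 / real n)"
      by (subst sum.insert) auto
    finally have 1: "\<bar>moebius_mean 0 B - moebius_mean 0 A\<bar> \<le> 1 / real (Suc A) + (\<Sum>n\<in>{Suc A<..B}. 1 / real n)" .
    have 2: "(\<Sum>n\<in>{Suc A<..B}. 1 / real n) \<le> ln B - ln (Suc A)"
      using AB False by (intro sum_inverse_le_ln) auto
    have "0 < real B" using AB False by simp
    then have 3: "ln B \<le> w" using B1 by (metis ln_exp ln_mono)
    have 4: "v \<le> ln (Suc A)" using A1 by (metis ln_exp ln_mono exp_gt_zero less_imp_le)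
    have 5: "1 / real (Suc A) \<le> exp (- v)"
      using A1 by (simp add: exp_minus inverse_eq_divide frac_le del: of_nat_Suc)
    show ?thesis using 1 2 3 4 5 by linarith
  qed
  then show ?thesis using False assms by (auto simp: A_def B_def)
qed

theorem moebius_mean_0_tendsto: "(\<lambda>y. moebius_mean 0 y) \<longlonglongrightarrow> 0"
proof -
  define m where "m u = moebius_mean 0 (nat \<lfloor>exp u\<rfloor>)" for u :: real
  obtain H where H: "\<And>s. 0 < Re s \<Longrightarrow> H field_differentiable at s"
    "\<And>s. 1 < Re s \<Longrightarrow> H s = (s - 1) * dseries (\<lambda>_. 1) 0 s" "H 1 = 1"
    using zeta_extension by metis
  interpret bounded_laplace m "\<lambda>s. inverse (H (1 + s))"
  proof
    show "m \<in> borel_measurable borel"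
      unfolding m_def[abs_def] by measurable
    show "\<bar>m u\<bar> \<le> 1" for u by (simp add: m_def abs_moebius_mean_le)
    show "m u = 0" if "u < 0" for u
    proof -
      have "\<lfloor>exp u\<rfloor> \<le> 0" using that by (simp add: floor_le_iff)
      then show ?thesis by (simp add: m_def moebius_mean_def)
    qed
    show "continuous_on {s. 0 \<le> Re s} (\<lambda>s. inverse (H (1 + s)))"
    proof (intro continuous_on_inverse ballI)
      have "continuous_on {s. 0 < Re s} H"
        using H(1) by (intro continuous_at_imp_continuous_on) (auto intro: field_differentiable_imp_continuous_at)
      then show "continuous_on {s. 0 \<le> Re s} (\<lambda>s. H (1 + s))"
        by (rule continuous_on_compose2) (auto intro!: continuous_intros)
      show "H (1 + s) \<noteq> 0" if "s \<in> {s. 0 \<le> Re s}" for s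
        using that by (intro zeta_extension_nonzero[OF H]) auto
    qed
    show "(LINT u|lborel. of_real (m u) * exp (- s * of_real u)) = inverse (H (1 + s))" if "0 < Re s" for s
    proof -
      have "dseries moebius_mu 0 (1 + s) = inverse (dseries (\<lambda>_. 1) 0 (1 + s))"
        using dseries_moebius_mult_one[of "1 + s"] that
        by (intro inverse_unique[symmetric]) (simp add: mult.commute)
      then have "dseries moebius_mu 0 (1 + s) / s = inverse (H (1 + s))"
        using H(2)[of "1 + s"] that by (simp add: divide_inverse mult.commute)
      then show ?thesis unfolding m_def laplace_moebius_mean[OF that] .
    qed
  qed
  have "(m \<longlongrightarrow> 0) at_top"
    unfolding m_def[abs_def] by (rule tauberian[unfolded m_def[abs_def]]) (rule moebius_mean_slow)
  moreover have "filterlim (\<lambda>n. ln (real n)) at_top sequentially"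
    by (rule filterlim_compose[OF ln_at_top filterlim_real_sequentially])
  ultimately have "(\<lambda>n. m (ln (real n))) \<longlonglongrightarrow> 0" by (rule filterlim_compose)
  moreover have "\<forall>\<^sub>F n in sequentially. m (ln (real n)) = moebius_mean 0 n"
    using eventually_gt_at_top[of 0] by eventually_elim (simp add: m_def)
  ultimately show ?thesis by (rule Lim_transform_eventually)
qed

text \<open>Buchstab's identity expresses the mean at level \<open>Suc q\<close> through the one at
  level \<open>q\<close> and its own value at \<open>y div Suc q\<close>, divided by a prime.
  Starting from the uniform bound 1, each unrolling at least halves the unknown part;
  \<open>y >= N * Suc q ^ j\<close> leaves room for \<open>j\<close> of them.\<close>

theorem moebius_mean_tendsto: "(\<lambda>y. moebius_mean q y) \<longlonglongrightarrow> 0"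
proof (induction q)
  case 0
  show ?case by (rule moebius_mean_0_tendsto)
next
  case (Suc q)
  show ?case
  proof (cases "prime (Suc q)")
    case False
    then show ?thesis using Suc moebius_mean_Suc[of q] by simp
  next
    case True
    then have p: "2 \<le> Suc q" by (rule prime_ge_2_nat)
    show ?thesis
    proof (rule LIMSEQ_I)
      fix \<epsilon> :: real assume \<epsilon>: "0 < \<epsilon>"
      then obtain N where N: "\<And>y. y \<ge> N \<Longrightarrow> \<bar>moebius_mean q y\<bar> < \<epsilon> / 4"
        using Suc LIMSEQ_D[OF Suc, of "\<epsilon> / 4"] by auto
      have rec: "\<bar>moebius_mean (Suc q) y\<bar> \<le> \<epsilon> / 2 + (1 / 2) ^ j" if "y \<ge> N * Suc q ^ j" for j y
        using that
      proof (induction j arbitrary: y)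
        case 0
        then show ?case using abs_moebius_mean_le[of "Suc q" y] \<epsilon> by simp
      next
        case (Suc j)
        have "N * Suc q ^ j \<le> y div Suc q"
          using Suc.prems by (simp only: less_eq_div_iff_mult_less_eq) (simp add: mult_ac)
        from Suc.IH[OF this] have IH: "\<bar>moebius_mean (Suc q) (y div Suc q)\<bar> \<le> \<epsilon> / 2 + (1 / 2) ^ j" .
        have "N \<le> N * Suc q ^ Suc j" using mult_le_mono2[OF one_le_power[of "Suc q" "Suc j"], of N] by simp
        then have 1: "\<bar>moebius_mean q y\<bar> < \<epsilon> / 4" using Suc.prems by (intro N) linarith
        define r where "r = moebius_mean (Suc q) (y div Suc q) / real (Suc q)"
        have 2: "\<bar>r\<bar> \<le> (\<epsilon> / 2 + (1 / 2) ^ j) / 2"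
          unfolding r_def abs_divide using IH p \<epsilon> by (intro frac_le) auto
        have 3: "(1 / 2 :: real) ^ Suc j = (1 / 2) ^ j / 2" by simp
        have 4: "moebius_mean (Suc q) y = moebius_mean q y + r"
          using moebius_mean_Suc[of q y] True by (simp add: r_def)
        have "\<bar>a + r\<bar> \<le> e / 2 + x / 2" if "\<bar>a\<bar> < e / 4" "\<bar>r\<bar> \<le> (e / 2 + x) / 2" for a r e x :: real
          using that abs_triangle_ineq[of a r] by (simp add: field_simps)
        from this[OF 1 2] show ?case unfolding 3 4 .
      qed
      obtain j where j: "(1 / 2 :: real) ^ j < \<epsilon> / 2"
        using real_arch_pow_inv[of "\<epsilon> / 2" "1 / 2"] \<epsilon> by auto
      show "\<exists>no. \<forall>n\<ge>no. norm (moebius_mean (Suc q) n - 0) < \<epsilon>"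
      proof (intro exI[of _ "N * Suc q ^ j"] allI impI)
        fix n assume "N * Suc q ^ j \<le> n"
        from rec[OF this] show "norm (moebius_mean (Suc q) n - 0) < \<epsilon>" using j by simp
      qed
    qed
  qed
qed

section \<open>Dirichlet characters\<close>

definition dirichlet_chars :: "nat \<Rightarrow> (nat \<Rightarrow> complex) set" where
  "dirichlet_chars k = {chi. chi 1 = 1 \<and> (\<forall>m n. chi (m * n) = chi m * chi n) \<and>
     (\<forall>m n. [m = n] (mod k) \<longrightarrow> chi m = chi n) \<and> (\<forall>n. \<not> coprime n k \<longrightarrow> chi n = 0)}"

definition principal_char :: "nat \<Rightarrow> nat \<Rightarrow> complex" where
  "principal_char k n = (if coprime n k then 1 else 0)"

lemma coprime_cong_iff: "[m = n] (mod k) \<Longrightarrow> coprime m k \<longleftrightarrow> coprime n (k::nat)"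
  using cong_imp_coprime cong_sym by blast

lemma principal_char_in: "principal_char k \<in> dirichlet_chars k"
  unfolding dirichlet_chars_def principal_char_def
  by (simp, metis coprime_cong_iff)

context
  fixes k :: nat
  assumes k: "k \<ge> 1"
begin

lemma
  assumes "chi \<in> dirichlet_chars k"
  shows char_1: "chi (Suc 0) = 1"
    and char_mult: "chi (m * n) = chi m * chi n"
    and char_cong: "[m = n] (mod k) \<Longrightarrow> chi m = chi n"
    and char_0: "\<not> coprime n k \<Longrightarrow> chi n = 0"
proof -
  have "chi 1 = 1 \<and> (\<forall>m n. chi (m * n) = chi m * chi n) \<and>
      (\<forall>m n. [m = n] (mod k) \<longrightarrow> chi m = chi n) \<and> (\<forall>n. \<not> coprime n k \<longrightarrow> chi n = 0)"
    using assms unfolding dirichlet_chars_def by (rule CollectD)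
  then show "chi (Suc 0) = 1" "chi (m * n) = chi m * chi n" "[m = n] (mod k) \<Longrightarrow> chi m = chi n"
      "\<not> coprime n k \<Longrightarrow> chi n = 0"
    by (simp, blast+)
qed

lemma char_power:
  assumes "chi \<in> dirichlet_chars k"
  shows "chi (n ^ j) = chi n ^ j"
  by (induction j) (simp_all add: char_1[OF assms] char_mult[OF assms])

lemma char_power_totient:
  assumes "chi \<in> dirichlet_chars k" "coprime n k"
  shows "chi n ^ totient k = 1"
  using char_cong[OF assms(1) euler_theorem[OF assms(2)]]
  by (simp add: char_power[OF assms(1)] char_1[OF assms(1)])

lemma norm_char:
  assumes "chi \<in> dirichlet_chars k" "coprime n k"
  shows "norm (chi n) = 1"
proof -
  have "norm (chi n) ^ totient k = 1"
    using char_power_totient[OF assms] by (metis norm_one norm_power)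
  moreover have "totient k > 0" using k by simp
  ultimately show ?thesis using power_eq_imp_eq_base[of "norm (chi n)" "totient k" 1] by simp
qed

lemma norm_char_le:
  assumes "chi \<in> dirichlet_chars k"
  shows "norm (chi n) \<le> 1"
  using norm_char[OF assms, of n] char_0[OF assms, of n] by (cases "coprime n k") auto

lemma finite_dirichlet_chars: "finite (dirichlet_chars k)"
proof (rule finite_imageD)
  let ?r = "\<lambda>chi::nat \<Rightarrow> complex. restrict chi {..<k}"
  have "?r ` dirichlet_chars k \<subseteq> PiE {..<k} (\<lambda>_. insert 0 {z. z ^ totient k = 1})"
    using char_power_totient char_0 by (auto simp: PiE_def extensional_def) blast
  moreover have "finite (PiE {..<k} (\<lambda>_. insert 0 {z::complex. z ^ totient k = 1}))"
    using k by (intro finite_PiE) (auto intro: finite_roots_unity)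
  ultimately show "finite (?r ` dirichlet_chars k)" by (rule finite_subset)
  show "inj_on ?r (dirichlet_chars k)"
  proof (rule inj_onI, rule ext)
    fix chi chi' n assume *: "chi \<in> dirichlet_chars k" "chi' \<in> dirichlet_chars k" "?r chi = ?r chi'"
    have "chi (n mod k) = chi' (n mod k)"
      using fun_cong[OF *(3), of "n mod k"] k by simp
    moreover have "[n mod k = n] (mod k)" by simp
    ultimately show "chi n = chi' n" using *(1,2) char_cong by metis
  qed
qed

lemma char_mult_in:
  assumes "chi \<in> dirichlet_chars k" "\<psi> \<in> dirichlet_chars k"
  shows "(\<lambda>n. chi n * \<psi> n) \<in> dirichlet_chars k"
  using assms by (auto simp: dirichlet_chars_def)

lemma char_cnj_in:
  assumes "chi \<in> dirichlet_chars k"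
  shows "(\<lambda>n. cnj (chi n)) \<in> dirichlet_chars k"
  using assms by (auto simp: dirichlet_chars_def)

lemma char_cnj_mult:
  assumes "chi \<in> dirichlet_chars k"
  shows "cnj (chi n) * chi n = principal_char k n"
proof (cases "coprime n k")
  case True
  then show ?thesis using norm_char[OF assms True]
    by (simp add: principal_char_def mult.commute complex_norm_square[symmetric])
qed (use char_0[OF assms] in \<open>simp add: principal_char_def\<close>)

text \<open>Characters of a subgroup \<open>H\<close> of the units modulo \<open>k\<close>, represented by
  a union of residue classes.\<close>

definition partial_char :: "nat set \<Rightarrow> (nat \<Rightarrow> complex) \<Rightarrow> bool" where
  "partial_char H chi \<longleftrightarrow> 1 \<in> H \<and> chi 1 = 1 \<and> (\<forall>m\<in>H. coprime m k) \<and>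
     (\<forall>m\<in>H. \<forall>n\<in>H. m * n \<in> H \<and> chi (m * n) = chi m * chi n) \<and>
     (\<forall>m\<in>H. \<forall>n. [m = n] (mod k) \<longrightarrow> n \<in> H \<and> chi m = chi n)"

lemma partial_char_power:
  assumes "partial_char H chi" "h \<in> H"
  shows "h ^ j \<in> H \<and> chi (h ^ j) = chi h ^ j"
  using assms by (induction j) (auto simp: partial_char_def)

lemma partial_char_inverse:
  assumes "partial_char H chi" "h \<in> H"
  obtains h' where "h' \<in> H" "[h' * h = 1] (mod k)"
proof
  show "h ^ (totient k - 1) \<in> H" using partial_char_power[OF assms] by blast
  have eq: "h ^ (totient k - 1) * h = h ^ totient k"
    using k by (metis power_minus_mult totient_gt_0_iff less_eq_Suc_le One_nat_def)
  have "coprime h k" using assms unfolding partial_char_def by blast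
  then show "[h ^ (totient k - 1) * h = 1] (mod k)"
    unfolding eq by (rule euler_theorem)
qed

lemma partial_char_cancel:
  assumes "partial_char H chi" "h \<in> H" "n * h \<in> H"
  shows "n \<in> H"
proof -
  obtain h' where h': "h' \<in> H" "[h' * h = 1] (mod k)"
    using partial_char_inverse[OF assms(1,2)] .
  have "h' * (n * h) \<in> H" using assms h' by (auto simp: partial_char_def)
  moreover have "[h' * (n * h) = n] (mod k)"
    using cong_scalar_left[OF h'(2), of n] by (simp add: mult_ac)
  ultimately show ?thesis using assms(1) unfolding partial_char_def by blast
qed

text \<open>Adjoins \<open>a\<close> to \<open>H\<close>. Here \<open>n\<close> is the order of
  \<open>a\<close> modulo \<open>H\<close>, and every \<open>n\<close>-th root \<open>z\<close> of
  \<open>chi (a ^ n)\<close> is admissible as the new value. The choice of \<open>z\<close> stays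
  open so that \<open>char_separates\<close> can take a nontrivial root.\<close>

lemma partial_char_extend:
  assumes H: "partial_char H chi" and a: "coprime a k"
  obtains n where "n > 0" "a ^ n \<in> H" "\<And>j. 0 < j \<Longrightarrow> j < n \<Longrightarrow> a ^ j \<notin> H"
    "\<And>z. z ^ n = chi (a ^ n) \<Longrightarrow> \<exists>H' chi'. partial_char H' chi' \<and> H \<subseteq> H' \<and> (\<forall>h\<in>H. chi' h = chi h) \<and> a \<in> H' \<and> chi' a = z"
proof -
  define n where "n = (LEAST n. n > 0 \<and> a ^ n \<in> H)"
  have "a ^ totient k \<in> H"
    using H euler_theorem[OF a] unfolding partial_char_def by (metis cong_sym)
  then have ex: "totient k > 0 \<and> a ^ totient k \<in> H" using k by simp
  have n: "n > 0" "a ^ n \<in> H" using LeastI[of "\<lambda>n. n > 0 \<and> a ^ n \<in> H", OF ex] by (simp_all add: n_def)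
  have min: "a ^ j \<notin> H" if "0 < j" "j < n" for j
    using not_less_Least[of j "\<lambda>n. n > 0 \<and> a ^ n \<in> H"] that by (auto simp: n_def)
  have cop: "coprime (a ^ i) k" for i using a by simp
  have dvd: "n dvd j" if "a ^ j \<in> H" for j
  proof (rule ccontr)
    assume "\<not> n dvd j"
    then have "0 < j mod n" "j mod n < n" using n(1) by (auto simp: dvd_eq_mod_eq_0)
    moreover have "a ^ (j mod n) \<in> H"
    proof (rule partial_char_cancel[OF H])
      show "(a ^ n) ^ (j div n) \<in> H" using partial_char_power[OF H n(2)] by blast
      have "a ^ (j mod n) * (a ^ n) ^ (j div n) = a ^ j"
        by (simp add: power_mult[symmetric] power_add[symmetric])
      then show "a ^ (j mod n) * (a ^ n) ^ (j div n) \<in> H" using that by simp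
    qed
    ultimately show False using min by blast
  qed
  have ext: "\<exists>H' chi'. partial_char H' chi' \<and> H \<subseteq> H' \<and> (\<forall>h\<in>H. chi' h = chi h) \<and> a \<in> H' \<and> chi' a = z"
    if z: "z ^ n = chi (a ^ n)" for z
  proof -
    \<comment> \<open>Well-definedness: two representations of one class differ by a power of
      \<open>a\<close> lying in \<open>H\<close>; its exponent is a multiple of \<open>n\<close>,
      where \<open>z\<close> and \<open>chi\<close> agree.\<close>
    have key: "chi h * z ^ i = chi h' * z ^ j" if "h \<in> H" "h' \<in> H" "[h * a ^ i = h' * a ^ j] (mod k)" "i \<le> j" for h h' i j
    proof -
      define d where "d = j - i"
      have "[h * a ^ i = (h' * a ^ d) * a ^ i] (mod k)"
        using that by (simp add: d_def mult.assoc power_add[symmetric])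
      then have c: "[h = h' * a ^ d] (mod k)" using cong_mult_rcancel_nat[OF cop[of i]] by blast
      then have "h' * a ^ d \<in> H" "chi h = chi (h' * a ^ d)" using H that(1) by (auto simp: partial_char_def)
      then have dH: "a ^ d \<in> H" using partial_char_cancel[OF H that(2), of "a ^ d"] by (simp add: mult.commute)
      then obtain q where q: "d = n * q" using dvd by blast
      have "chi h = chi h' * chi (a ^ d)" using \<open>chi h = _\<close> H that(2) dH by (simp add: partial_char_def)
      also have "chi (a ^ d) = z ^ d"
        unfolding q power_mult using partial_char_power[OF H n(2)] z by simp
      finally show ?thesis using that(4) by (simp add: d_def mult.assoc power_add[symmetric])
    qed
    define rep where "rep x hi \<longleftrightarrow> fst hi \<in> H \<and> [x = fst hi * a ^ snd hi] (mod k)" for x and hi :: "nat \<times> nat"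
    define H' where "H' = {x. \<exists>hi. rep x hi}"
    \<comment> \<open>The value is read off an arbitrary representation \<open>h * a ^ i\<close> of
      \<open>x\<close>; \<open>val\<close> then shows that every other one gives the same.\<close>
    define chi' where "chi' x = (case SOME hi. rep x hi of (h, i) \<Rightarrow> chi h * z ^ i)" for x
    have val: "chi' x = chi h * z ^ i" if "h \<in> H" "[x = h * a ^ i] (mod k)" for x h i
    proof -
      obtain h' i' where hi: "(SOME hi. rep x hi) = (h', i')" by (cases "SOME hi. rep x hi")
      have "rep x (SOME hi. rep x hi)"
        by (rule someI[of "rep x" "(h, i)"]) (use that in \<open>simp add: rep_def\<close>)
      then have "rep x (h', i')" unfolding hi .
      then have r: "h' \<in> H" "[x = h' * a ^ i'] (mod k)" by (simp_all add: rep_def)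
      have c: "[h' * a ^ i' = h * a ^ i] (mod k)" using r(2) that(2) by (metis cong_sym cong_trans)
      have "chi h' * z ^ i' = chi h * z ^ i"
      proof (cases "i' \<le> i")
        case True
        then show ?thesis using key[OF r(1) that(1) c] by simp
      next
        case False
        then show ?thesis using key[OF that(1) r(1) cong_sym[OF c]] by simp
      qed
      then show ?thesis by (simp add: chi'_def hi)
    qed
    have H'I: "x \<in> H'" if "h \<in> H" "[x = h * a ^ i] (mod k)" for x h i
      unfolding H'_def using that by (auto simp: rep_def intro!: exI[of _ "(h, i)"])
    have H'E: "\<exists>h i. h \<in> H \<and> [x = h * a ^ i] (mod k)" if "x \<in> H'" for x
      using that by (auto simp: H'_def rep_def)
    have one: "1 \<in> H" "chi 1 = 1" using H by (auto simp: partial_char_def)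
    have sub: "h \<in> H' \<and> chi' h = chi h" if "h \<in> H" for h
      using H'I[OF that, of h 0] val[OF that, of h 0] by simp
    have "partial_char H' chi'"
      unfolding partial_char_def
    proof (intro conjI ballI allI impI)
      show "1 \<in> H'" "chi' 1 = 1" using sub[OF one(1)] one(2) by auto
      fix x assume "x \<in> H'"
      then obtain h i where hi: "h \<in> H" "[x = h * a ^ i] (mod k)" using H'E by blast
      have "coprime (h * a ^ i) k" using H hi(1) cop[of i] by (auto simp: partial_char_def)
      then show "coprime x k" using coprime_cong_iff[OF hi(2)] by blast
      {
        fix y assume "y \<in> H'"
        then obtain h' i' where hi': "h' \<in> H" "[y = h' * a ^ i'] (mod k)" using H'E by blast
        have hh: "h * h' \<in> H" "chi (h * h') = chi h * chi h'" using H hi hi' by (auto simp: partial_char_def)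
        have c: "[x * y = (h * h') * a ^ (i + i')] (mod k)"
          using cong_mult[OF hi(2) hi'(2)] by (simp add: power_add mult_ac)
        show "x * y \<in> H'" by (rule H'I[OF hh(1) c])
        show "chi' (x * y) = chi' x * chi' y"
          unfolding val[OF hh(1) c] val[OF hi] val[OF hi'] hh(2) by (simp add: power_add mult_ac)
      }
      {
        fix y assume "[x = y] (mod k)"
        then have c: "[y = h * a ^ i] (mod k)" using hi(2) by (metis cong_sym cong_trans)
        show "y \<in> H'" by (rule H'I[OF hi(1) c])
        show "chi' x = chi' y" unfolding val[OF hi] val[OF hi(1) c] ..
      }
    qed
    moreover have "a \<in> H'" "chi' a = z"
      using H'I[OF one(1), of a 1] val[OF one(1), of a 1] one(2) by auto
    ultimately show ?thesis using sub by blast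
  qed
  show ?thesis using that n min ext by blast
qed

text \<open>Each adjunction lowers the number of reduced classes missing from \<open>H\<close>; the
  required root exists because the complex numbers are algebraically closed.\<close>

lemma partial_char_extend_full:
  assumes "partial_char H chi"
  shows "\<exists>\<psi>\<in>dirichlet_chars k. \<forall>h\<in>H. \<psi> h = chi h"
  using assms
proof (induction "card {x\<in>{..<k}. coprime x k \<and> x \<notin> H}" arbitrary: H chi rule: less_induct)
  case less
  show ?case
  proof (cases "\<exists>a. coprime a k \<and> a \<notin> H")
    case False
    then have H: "x \<in> H \<longleftrightarrow> coprime x k" for x
      using less.prems unfolding partial_char_def by blast
    define \<psi> where "\<psi> x = (if coprime x k then chi x else 0)" for x
    have "\<psi> \<in> dirichlet_chars k"
      using less.prems H unfolding dirichlet_chars_def partial_char_def \<psi>_def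
      by (auto simp: coprime_cong_iff)
    then show ?thesis by (intro bexI[of _ \<psi>]) (auto simp: \<psi>_def H)
  next
    case True
    then obtain a where a: "coprime a k" "a \<notin> H" by blast
    obtain n where n: "n > 0"
      "\<And>z. z ^ n = chi (a ^ n) \<Longrightarrow> \<exists>H' chi'. partial_char H' chi' \<and> H \<subseteq> H' \<and> (\<forall>h\<in>H. chi' h = chi h) \<and> a \<in> H' \<and> chi' a = z"
      using partial_char_extend[OF less.prems a(1)] by metis
    obtain z where "z ^ n = chi (a ^ n)" using exists_complex_root[OF n(1)[THEN less_imp_neq, symmetric]] by metis
    then obtain H' chi' where H': "partial_char H' chi'" "H \<subseteq> H'" "\<forall>h\<in>H. chi' h = chi h" "a \<in> H'"
      using n(2) by blast
    have am: "[a = a mod k] (mod k)" by (simp add: cong_def)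
    have "a mod k \<notin> H" using a(2) less.prems am unfolding partial_char_def by (metis cong_sym)
    moreover have "a mod k \<in> H'" using H'(1,4) am unfolding partial_char_def by blast
    moreover have "coprime (a mod k) k" using a(1) coprime_cong_iff[OF am] by simp
    ultimately have "{x\<in>{..<k}. coprime x k \<and> x \<notin> H'} \<subset> {x\<in>{..<k}. coprime x k \<and> x \<notin> H}"
      using H'(2) k by (intro psubsetI) auto
    then have "card {x\<in>{..<k}. coprime x k \<and> x \<notin> H'} < card {x\<in>{..<k}. coprime x k \<and> x \<notin> H}"
      by (intro psubset_card_mono) auto
    from less.hyps[OF this H'(1)] obtain \<psi> where "\<psi> \<in> dirichlet_chars k" "\<forall>h\<in>H'. \<psi> h = chi' h"
      by blast
    then show ?thesis using H'(2,3) by (intro bexI[of _ \<psi>]) auto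
  qed
qed

text \<open>Start from the trivial character on the class of 1. As \<open>a\<close> lies outside,
  its order \<open>n\<close> modulo that class exceeds 1, and a primitive \<open>n\<close>-th root
  of unity can be prescribed at \<open>a\<close>.\<close>

lemma char_separates:
  assumes a: "coprime a k" "[a \<noteq> 1] (mod k)"
  obtains \<psi> where "\<psi> \<in> dirichlet_chars k" "\<psi> a \<noteq> 1"
proof -
  define H where "H = {x. [x = 1] (mod k)}"
  have H: "partial_char H (\<lambda>_. 1)"
    unfolding partial_char_def
  proof (intro conjI ballI allI impI refl)
    show "1 \<in> H" by (simp add: H_def)
    show "coprime m k" if "m \<in> H" for m
      using coprime_cong_iff[of m 1 k] that by (simp add: H_def)
    show "m * n \<in> H" if "m \<in> H" "n \<in> H" for m n
      using cong_mult[of m 1 k n 1] that by (simp add: H_def)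
    show "n \<in> H" if "m \<in> H" "[m = n] (mod k)" for m n
      using that by (metis H_def mem_Collect_eq cong_sym cong_trans)
  qed (simp_all)
  obtain n where n: "n > 0" "a ^ n \<in> H"
      "\<And>z. z ^ n = 1 \<Longrightarrow> \<exists>H' chi'. partial_char H' chi' \<and> H \<subseteq> H' \<and> (\<forall>h\<in>H. chi' h = 1) \<and> a \<in> H' \<and> chi' a = z"
    using partial_char_extend[OF H a(1)] by metis
  have "n \<noteq> 1" using n(2) a(2) by (auto simp: H_def)
  define z where "z = cis (2 * pi / n)"
  have zn: "z ^ n = 1" unfolding z_def Complex.DeMoivre using n(1) by (simp add: complex_eq_iff)
  have z1: "z \<noteq> 1"
  proof
    assume "z = 1"
    then have "cos (2 * (pi / n)) = 1" by (simp add: z_def complex_eq_iff)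
    then have "sin (pi / n) = 0" using cos_double_sin[of "pi / n"] by simp
    moreover have "0 < pi / n" "pi / n < pi" using n(1) \<open>n \<noteq> 1\<close> by (auto simp: field_simps)
    ultimately show False using sin_gt_zero by fastforce
  qed
  obtain H' chi' where H': "partial_char H' chi'" "a \<in> H'" "chi' a = z" using n(3)[OF zn] by blast
  obtain \<psi> where "\<psi> \<in> dirichlet_chars k" "\<forall>h\<in>H'. \<psi> h = chi' h"
    using partial_char_extend_full[OF H'(1)] by blast
  then show ?thesis using that H' z1 by metis
qed

text \<open>Multiplication by a character \<open>\<psi>\<close> with
  \<open>\<psi> n \<noteq> 1\<close> permutes the characters, with inverse multiplication by the
  conjugate, and multiplies the sum by \<open>\<psi> n\<close>.\<close>

lemma sum_chars:
  "(\<Sum>chi\<in>dirichlet_chars k. chi n) = (if [n = 1] (mod k) then of_nat (card (dirichlet_chars k)) else 0)"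
proof (cases "[n = 1] (mod k)")
  case True
  then have "chi n = 1" if "chi \<in> dirichlet_chars k" for chi
    using char_cong[OF that True] char_1[OF that] by simp
  then have "(\<Sum>chi\<in>dirichlet_chars k. chi n) = (\<Sum>chi\<in>dirichlet_chars k. 1)"
    by (intro sum.cong refl)
  then show ?thesis using True by simp
next
  case False
  have "(\<Sum>chi\<in>dirichlet_chars k. chi n) = 0"
  proof (cases "coprime n k")
    case False
    then show ?thesis using char_0 by (intro sum.neutral) blast
  next
    case True
    obtain \<psi> where \<psi>: "\<psi> \<in> dirichlet_chars k" "\<psi> n \<noteq> 1" using char_separates[OF True False] .
    have "(\<Sum>chi\<in>dirichlet_chars k. chi n) = (\<Sum>chi\<in>dirichlet_chars k. \<psi> n * chi n)"
    proof (rule sum.reindex_bij_witness[where i = "\<lambda>chi n. \<psi> n * chi n" and j = "\<lambda>chi n. cnj (\<psi> n) * chi n"])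
      fix chi assume chi: "chi \<in> dirichlet_chars k"
      have p: "principal_char k n * chi n = chi n" for n
        using char_0[OF chi, of n] by (auto simp: principal_char_def)
      show "(\<lambda>n. \<psi> n * (cnj (\<psi> n) * chi n)) = chi" "(\<lambda>n. cnj (\<psi> n) * (\<psi> n * chi n)) = chi"
        using char_cnj_mult[OF \<psi>(1)] p by (auto simp: mult.assoc[symmetric] mult.commute)
      show "(\<lambda>n. cnj (\<psi> n) * chi n) \<in> dirichlet_chars k" "(\<lambda>n. \<psi> n * chi n) \<in> dirichlet_chars k"
        using char_mult_in[OF char_cnj_in[OF \<psi>(1)] chi] char_mult_in[OF \<psi>(1) chi] by auto
      show "\<psi> n * (cnj (\<psi> n) * chi n) = chi n"
        using char_cnj_mult[OF \<psi>(1), of n] p[of n] by (simp add: mult.assoc[symmetric] mult.commute)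
    qed
    also have "\<dots> = \<psi> n * (\<Sum>chi\<in>dirichlet_chars k. chi n)" by (simp add: sum_distrib_left)
    finally show ?thesis using \<psi>(2) by simp
  qed
  then show ?thesis using False by simp
qed

lemma char_eq_principalI:
  assumes "chi \<in> dirichlet_chars k" "\<And>n. coprime n k \<Longrightarrow> chi n = 1"
  shows "chi = principal_char k"
  using assms char_0[OF assms(1)] by (auto simp: principal_char_def fun_eq_iff)

text \<open>The dual argument: multiplication by a unit \<open>a\<close> with
  \<open>chi a \<noteq> 1\<close> permutes the residues.\<close>

lemma sum_char_period:
  assumes chi: "chi \<in> dirichlet_chars k" "chi \<noteq> principal_char k"
  shows "(\<Sum>n<k. chi n) = 0"
proof -
  obtain a where a: "coprime a k" "chi a \<noteq> 1" using char_eq_principalI[OF chi(1)] chi(2) by blast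
  have inj: "inj_on (\<lambda>n. (a * n) mod k) {..<k}"
  proof (rule inj_onI)
    fix x y assume xy: "x \<in> {..<k}" "y \<in> {..<k}" "(a * x) mod k = (a * y) mod k"
    then have "[a * x = a * y] (mod k)" by (simp add: cong_def)
    then have "[x = y] (mod k)" using cong_mult_lcancel_nat[OF a(1)] by blast
    then show "x = y" using xy by (simp add: cong_def)
  qed
  moreover have "(\<lambda>n. (a * n) mod k) ` {..<k} \<subseteq> {..<k}" using k by auto
  ultimately have bij: "bij_betw (\<lambda>n. (a * n) mod k) {..<k} {..<k}"
    using endo_inj_surj[of "{..<k}"] by (auto simp: bij_betw_def)
  have "(\<Sum>n<k. chi n) = (\<Sum>n<k. chi ((a * n) mod k))"
    by (rule sum.reindex_bij_betw[OF bij, symmetric])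
  also have "\<dots> = (\<Sum>n<k. chi a * chi n)"
  proof (intro sum.cong refl)
    fix n
    have "chi ((a * n) mod k) = chi (a * n)" by (rule char_cong[OF chi(1)]) simp
    then show "chi ((a * n) mod k) = chi a * chi n" by (simp add: char_mult[OF chi(1)])
  qed
  also have "\<dots> = chi a * (\<Sum>n<k. chi n)" by (simp add: sum_distrib_left)
  finally show ?thesis using a(2) by simp
qed

text \<open>The double sum over residues and characters, evaluated in both orders: one leaves the
  class of 1, the other the principal character.\<close>

lemma card_dirichlet_chars: "card (dirichlet_chars k) = totient k"
proof -
  have "(\<Sum>n<k. \<Sum>chi\<in>dirichlet_chars k. chi n) = (\<Sum>chi\<in>dirichlet_chars k. \<Sum>n<k. chi n)"
    by (rule sum.swap)
  also have "\<dots> = (\<Sum>n<k. principal_char k n)"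
    using sum_char_period finite_dirichlet_chars principal_char_in
    by (subst sum.remove[of _ "principal_char k"]) auto
  also have "\<dots> = of_nat (card {n\<in>{..<k}. coprime n k})"
    by (simp add: principal_char_def sum.If_cases Int_def)
  also have "card {n\<in>{..<k}. coprime n k} = totient k"
  proof (cases "k = 1")
    \<comment> \<open>For \<open>k = 1\<close> the only class is represented by 0 below
      \<open>k\<close>, but by 1 among the totatives.\<close>
    case True
    then have "{n\<in>{..<k}. coprime n k} = {0}" by auto
    then show ?thesis using True by simp
  next
    case False
    then have "n \<in> totatives k \<longleftrightarrow> n < k \<and> coprime n k" for n
      using k totatives_less[of n k] by (cases "n = 0") (auto simp: in_totatives_iff)
    then have "{n\<in>{..<k}. coprime n k} = totatives k" by auto
    then show ?thesis by (simp add: totient_def)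
  qed
  also have "(\<Sum>n<k. \<Sum>chi\<in>dirichlet_chars k. chi n) = (\<Sum>n<k. if n = 1 mod k then of_nat (card (dirichlet_chars k)) else 0)"
    unfolding sum_chars by (intro sum.cong) (auto simp: cong_def)
  also have "\<dots> = of_nat (card (dirichlet_chars k))" using k by simp
  finally show ?thesis by (simp only: of_nat_eq_iff)
qed

end

section \<open>Chebyshev and Mertens estimates\<close>

text \<open>Partial summation: with decreasing weights the differences telescope, so the partial
  sums of \<open>f\<close> are charged only with the first weight.\<close>

lemma abel_bound:
  fixes f :: "nat \<Rightarrow> 'a::real_normed_vector" and g :: "nat \<Rightarrow> real"
  assumes T: "\<And>n. a \<le> n \<Longrightarrow> n \<le> b \<Longrightarrow> norm (\<Sum>i\<in>{a<..n}. f i) \<le> K"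
    and anti: "\<And>n. a < n \<Longrightarrow> n < b \<Longrightarrow> g (Suc n) \<le> g n"
    and nonneg: "0 \<le> g b" and ab: "a < b"
  shows "norm (\<Sum>i\<in>{a<..b}. g i *\<^sub>R f i) \<le> K * g (Suc a)"
proof -
  define S where "S n = (\<Sum>i\<in>{a<..n}. g i *\<^sub>R f i)" for n
  define T' where "T' n = (\<Sum>i\<in>{a<..n}. f i)" for n
  have ins: "{a<..Suc n} = insert (Suc n) {a<..n}" if "a \<le> n" for n using that by auto
  have "norm (S n - g n *\<^sub>R T' n) \<le> K * (g (Suc a) - g n)" if "Suc a \<le> n" "n \<le> b" for n
    using that
  proof (induction n rule: dec_induct)
    case base
    show ?case using ins[of a] by (simp add: S_def T'_def)
  next
    case (step n)
    have "S (Suc n) - g (Suc n) *\<^sub>R T' (Suc n) = (S n - g n *\<^sub>R T' n) + (g n - g (Suc n)) *\<^sub>R T' n"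
      using step ins[of n] by (simp add: S_def T'_def algebra_simps)
    also have "norm \<dots> \<le> K * (g (Suc a) - g n) + (g n - g (Suc n)) * K"
      using step T[of n] anti[of n]
      by (intro norm_triangle_le add_mono) (auto simp: T'_def intro: mult_left_mono)
    finally show ?case by (simp add: algebra_simps)
  qed
  from this[of b] have 1: "norm (S b - g b *\<^sub>R T' b) \<le> K * (g (Suc a) - g b)" using ab by simp
  have 2: "norm (g b *\<^sub>R T' b) \<le> g b * K"
    using nonneg T[of b] ab by (simp add: T'_def mult_left_mono)
  have "norm (S b) \<le> norm (S b - g b *\<^sub>R T' b) + norm (g b *\<^sub>R T' b)"
    by (metis diff_add_cancel norm_triangle_ineq)
  then show ?thesis using 1 2 by (simp add: S_def algebra_simps)
qed

lemma ln_Suc_div_le: "n > 0 \<Longrightarrow> real n * (ln (real (Suc n)) - ln (real n)) \<le> 1"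
  using ln_diff_le[of "real (Suc n)" "real n"] by (simp add: field_simps)

lemma sum_ln_le: "(\<Sum>n\<in>{1..N}. ln (real n)) \<le> N * ln N"
proof -
  have "(\<Sum>n\<in>{1..N}. ln (real n)) \<le> (\<Sum>n\<in>{1..N}. ln (real N))" by (intro sum_mono) auto
  then show ?thesis by simp
qed

lemma sum_ln_ge: "N * ln N - N \<le> (\<Sum>n\<in>{1..N}. ln (real n))"
proof (induction N)
  case (Suc N)
  show ?case
  proof (cases "N = 0")
    case False
    then have "real N * (ln (real (Suc N)) - ln (real N)) \<le> 1" by (intro ln_Suc_div_le) simp
    then show ?thesis using Suc by (simp add: algebra_simps)
  qed simp
qed simp

lemma sum_ln_eq_mangoldt: "(\<Sum>n\<in>{1..N}. ln (real n)) = (\<Sum>d\<in>{1..N}. mangoldt d * real (N div d))"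
  unfolding sum_div_eq_sum_divisors using mangoldt_sum[where 'a = real] by (intro sum.cong) auto

lemma sum_ln_eq_ln_fact: "(\<Sum>n\<in>{1..N}. ln (real n)) = ln (fact N)"
  by (induction N) (auto simp: ln_mult simp flip: of_nat_Suc)

text \<open>The central binomial coefficient: \<open>2 * n div d - 2 * (n div d)\<close> is never
  negative and equals 1 for \<open>n < d <= 2 * n\<close>, so the primes in that range are paid for
  by \<open>ln (2 * n choose n)\<close>, at most \<open>2 * n * ln 2\<close>.\<close>

lemma chebyshev_psi_le: "(\<Sum>d\<in>{1..N}. mangoldt d) \<le> 4 * real N"
proof -
  define psi where "psi N = (\<Sum>d\<in>{1..N}. mangoldt d :: real)" for N :: nat
  have double: "psi (2 * n) \<le> psi n + 2 * n * ln 2" for n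
  proof -
    have "psi (2 * n) - psi n = (\<Sum>d\<in>{n<..2*n}. mangoldt d)"
    proof -
      have "{1..2*n} = {1..n} \<union> {n<..2*n}" by auto
      then have "psi (2 * n) = psi n + (\<Sum>d\<in>{n<..2*n}. mangoldt d)"
        unfolding psi_def by (simp only:) (rule sum.union_disjoint, auto)
      then show ?thesis by simp
    qed
    also have "\<dots> \<le> (\<Sum>d\<in>{1..2*n}. mangoldt d * (real (2 * n div d) - 2 * real (n div d)))"
    proof -
      have nn: "2 * (n div d) \<le> 2 * n div d" for d
      proof (cases "d = 0")
        case False
        have "2 * (n div d) * d \<le> 2 * n" by (metis div_times_less_eq_dividend mult.assoc mult_le_mono2)
        then show ?thesis using False by (simp add: less_eq_div_iff_mult_less_eq)
      qed simp
      have "(\<Sum>d\<in>{n<..2*n}. mangoldt d) \<le> (\<Sum>d\<in>{n<..2*n}. mangoldt d * (real (2 * n div d) - 2 * real (n div d)))"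
      proof (rule sum_mono)
        fix d assume d: "d \<in> {n<..2*n}"
        then have "n div d = 0" "1 \<le> 2 * n div d" by (auto simp: less_eq_div_iff_mult_less_eq)
        then show "mangoldt d \<le> mangoldt d * (real (2 * n div d) - 2 * real (n div d))"
          using mangoldt_nonneg[of d] mult_left_mono[of 1 "real (2 * n div d)" "mangoldt d"] by simp
      qed
      also have "\<dots> \<le> (\<Sum>d\<in>{1..2*n}. mangoldt d * (real (2 * n div d) - 2 * real (n div d)))"
      proof (rule sum_mono2)
        fix d
        have "2 * real (n div d) \<le> real (2 * n div d)" using nn[of d] by (metis of_nat_le_iff of_nat_mult of_nat_numeral)
        then show "0 \<le> mangoldt d * (real (2 * n div d) - 2 * real (n div d))"
          using mangoldt_nonneg[of d] by simp
      qed auto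
      finally show ?thesis .
    qed
    also have "\<dots> = (\<Sum>d\<in>{1..2*n}. mangoldt d * real (2 * n div d)) - 2 * (\<Sum>d\<in>{1..2*n}. mangoldt d * real (n div d))"
      by (simp add: algebra_simps sum_subtractf sum_distrib_left)
    also have "(\<Sum>d\<in>{1..2*n}. mangoldt d * real (n div d)) = (\<Sum>d\<in>{1..n}. mangoldt d * real (n div d))"
      by (rule sum.mono_neutral_right) auto
    also have "(\<Sum>d\<in>{1..2*n}. mangoldt d * real (2 * n div d)) - 2 * (\<Sum>d\<in>{1..n}. mangoldt d * real (n div d))
        = ln (fact (2 * n)) - 2 * ln (fact n)"
      unfolding sum_ln_eq_mangoldt[symmetric] sum_ln_eq_ln_fact ..
    also have "\<dots> = ln (real (2 * n choose n))"
    proof -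
      have "real (2 * n choose n) = fact (2 * n) / (fact n * fact n)"
        using binomial_fact[of n "2 * n", where 'a = real] by simp
      then show ?thesis by (simp add: ln_div ln_mult)
    qed
    also have "\<dots> \<le> ln (2 ^ (2 * n))"
      using binomial_le_pow2[of "2 * n" n]
      by (intro ln_mono) (auto simp: zero_less_binomial_iff simp flip: of_nat_le_iff)
    also have "\<dots> = 2 * n * ln 2" by (simp add: ln_realpow)
    finally show ?thesis by simp
  qed
  have ln2: "0 < ln (2::real)" "ln (2::real) \<le> 1" using ln_le_minus_one[of "2::real"] by auto
  \<comment> \<open>Halving gives \<open>6 * ln 2 * n\<close> at \<open>2 * n\<close>, where
    \<open>8 * ln 2 * n\<close> is allowed; the slack pays for the extra term
    \<open>mangoldt N\<close> when \<open>N\<close> is odd.\<close>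
  have "psi N \<le> 4 * ln 2 * N"
  proof (induction N rule: less_induct)
    case (less N)
    show ?case
    proof (cases "N = 0")
      case True
      then show ?thesis by (simp add: psi_def)
    next
      case False
      define n where "n = N div 2"
      have n: "n < N" using False by (simp add: n_def)
      have IH: "psi (2 * n) \<le> 6 * (ln 2 * n)" using less[OF n] double[of n] by (simp add: algebra_simps)
      show ?thesis
      proof (cases "even N")
        case True
        then have "N = 2 * n" by (simp add: n_def)
        then have "4 * ln 2 * real N = 8 * (ln 2 * real n)" by simp
        moreover have "0 \<le> ln 2 * real n" using ln2 by simp
        ultimately have "psi (2 * n) \<le> 4 * ln 2 * real N" using IH by linarith
        then show ?thesis using \<open>N = 2 * n\<close> by simp
      next
        case False
        then have N: "N = Suc (2 * n)" by (simp add: n_def)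
        have "psi N = psi (2 * n) + mangoldt N" unfolding N psi_def by simp
        also have "mangoldt N \<le> ln N" using N by (intro mangoldt_le) simp
        also have "ln (real N) \<le> ln (2 ^ (n + 1))"
        proof (intro ln_mono)
          have "2 * n + 1 \<le> 2 ^ (n + 1)" using mult_le_mono2[OF Suc_leI[OF less_exp[of n]], of 2] by simp
          then show "real N \<le> 2 ^ (n + 1)" unfolding N by (metis Suc_eq_plus1 of_nat_le_iff of_nat_numeral of_nat_power)
        qed (use N in auto)
        also have "\<dots> = (n + 1) * ln 2" by (simp add: ln_realpow del: power_Suc)
        finally have "psi N \<le> psi (2 * n) + (n + 1) * ln 2" by simp
        moreover have "real (n + 1) * ln 2 = ln 2 * n + ln 2" "4 * ln 2 * real N = 8 * (ln 2 * n) + 4 * ln 2"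
          by (simp_all add: N algebra_simps)
        moreover have "0 \<le> ln 2 * real n" using ln2 by simp
        ultimately show ?thesis using IH ln2 by linarith
      qed
    qed
  qed
  also have "\<dots> \<le> 4 * 1 * real N" using ln2 by (intro mult_right_mono mult_left_mono) auto
  finally show ?thesis by (simp add: psi_def)
qed

text \<open>Compare \<open>N / d\<close> with \<open>N div d + 1\<close>: the floors sum to the
  logarithm of a factorial, and the ones are covered by Chebyshev's bound.\<close>

lemma sum_mangoldt_div_le:
  assumes "N > 0"
  shows "(\<Sum>d\<in>{1..N}. mangoldt d / d) \<le> ln N + 4"
proof -
  have "N * (\<Sum>d\<in>{1..N}. mangoldt d / d) \<le> (\<Sum>d\<in>{1..N}. mangoldt d * real (N div d) + mangoldt d)"
    unfolding sum_distrib_left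
  proof (rule sum_mono)
    fix d assume "d \<in> {1..N}"
    have "real N / real d \<le> real (N div d) + 1"
      using floor_divide_of_nat_eq[of N d, where ?'a = real] real_of_int_floor_add_one_ge[of "real N / real d"] by simp
    then have "mangoldt d * (real N / real d) \<le> mangoldt d * (real (N div d) + 1)"
      by (intro mult_left_mono mangoldt_nonneg)
    then show "real N * (mangoldt d / d) \<le> mangoldt d * real (N div d) + mangoldt d"
      by (simp add: algebra_simps)
  qed
  also have "\<dots> = (\<Sum>n\<in>{1..N}. ln (real n)) + (\<Sum>d\<in>{1..N}. mangoldt d)"
    unfolding sum.distrib sum_ln_eq_mangoldt ..
  also have "\<dots> \<le> N * ln N + 4 * real N"
    by (intro add_mono sum_ln_le chebyshev_psi_le)
  finally have "N * (\<Sum>d\<in>{1..N}. mangoldt d / d) \<le> N * (ln N + 4)" by (simp add: algebra_simps)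
  then show ?thesis using assms by simp
qed

text \<open>Moebius inversion of \<open>mangoldt_sum\<close>. Writing \<open>x / d\<close> for
  \<open>n / d\<close> adds a constant times the divisor sum of the Moebius function, which is seen
  at \<open>n = 1\<close> only. Taking \<open>x = N\<close> later makes the weights
  \<open>ln (N / d)\<close> nonnegative.\<close>

lemma sum_moebius_ln:
  assumes "n > 0" "x > 0"
  shows "(\<Sum>d | d dvd n. moebius_mu d * ln (x / d)) = (if n = 1 then ln x else 0) + mangoldt n"
proof -
  have dp: "d > 0" if "d dvd n" for d using that assms by (auto intro: dvd_pos_nat)
  have "mangoldt n = (\<Sum>e | e dvd n. mangoldt e * (\<Sum>d | d dvd n div e. moebius_mu d))"
  proof -
    have "(\<Sum>e | e dvd n. mangoldt e * (\<Sum>d | d dvd n div e. moebius_mu d)) = (\<Sum>e | e dvd n. if e = n then mangoldt e else 0)"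
    proof (intro sum.cong refl)
      fix e assume e: "e \<in> {e. e dvd n}"
      then have "n div e > 0" using assms dvd_imp_le[of e n] dp by (auto simp: div_greater_zero_iff)
      moreover have "n div e = 1 \<longleftrightarrow> e = n" using e assms by (auto elim!: dvdE)
      ultimately show "mangoldt e * (\<Sum>d | d dvd n div e. moebius_mu d) = (if e = n then mangoldt e else 0)"
        using sum_moebius_divisors[of "n div e"] by simp
    qed
    then show ?thesis using assms by simp
  qed
  also have "\<dots> = (\<Sum>e | e dvd n. \<Sum>d | d dvd n div e. mangoldt e * moebius_mu d)"
    by (simp add: sum_distrib_left)
  also have "\<dots> = (\<Sum>(e,d)\<in>(SIGMA e:{e. e dvd n}. {d. d dvd n div e}). mangoldt e * moebius_mu d)"
    using assms dp by (intro sum.Sigma) (auto intro!: finite_divisors_nat simp: div_greater_zero_iff dvd_imp_le)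
  also have "\<dots> = (\<Sum>(d,e)\<in>(SIGMA d:{d. d dvd n}. {e. e dvd n div d}). moebius_mu d * mangoldt e)"
  proof (rule sum.reindex_bij_witness[of _ prod.swap prod.swap])
    have *: "d dvd n \<and> e dvd n div d" if "e dvd n" "d dvd n div e" for d e
      using that assms dp dvd_mult_left[of d e n] dvd_div_iff_mult[of e n d] dvd_div_iff_mult[of d n e]
      by (auto simp: mult.commute)
    fix p assume "p \<in> (SIGMA e:{e. e dvd n}. {d. d dvd n div e})"
    then have "fst p dvd n" "snd p dvd n div fst p" by auto
    from *[OF this] show "prod.swap p \<in> (SIGMA e:{e. e dvd n}. {d. d dvd n div e})" by (cases p) simp
    then show "prod.swap p \<in> (SIGMA e:{e. e dvd n}. {d. d dvd n div e})" .
  qed (auto simp: mult.commute)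
  also have "\<dots> = (\<Sum>d | d dvd n. \<Sum>e | e dvd n div d. moebius_mu d * mangoldt e)"
    using assms dp by (intro sum.Sigma[symmetric]) (auto intro!: finite_divisors_nat simp: div_greater_zero_iff dvd_imp_le)
  also have "\<dots> = (\<Sum>d | d dvd n. moebius_mu d * ln (real (n div d)))"
  proof (intro sum.cong refl)
    fix d assume d: "d \<in> {d. d dvd n}"
    then have "n div d \<noteq> 0" using assms dp by (auto simp: dvd_imp_le)
    from mangoldt_sum[OF this, where 'a = real]
    show "(\<Sum>e | e dvd n div d. moebius_mu d * mangoldt e) = moebius_mu d * ln (real (n div d))"
      by (simp add: sum_distrib_left[symmetric])
  qed
  also have "\<dots> = (\<Sum>d | d dvd n. moebius_mu d * ln (x / d) + (ln n - ln x) * moebius_mu d)"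
  proof (intro sum.cong refl)
    fix d assume d: "d \<in> {d. d dvd n}"
    then have "ln (real (n div d)) = ln n - ln d" using assms dp by (auto simp: real_of_nat_div ln_div)
    moreover have "ln (x / d) = ln x - ln d" using d assms dp by (auto simp: ln_div)
    ultimately show "moebius_mu d * ln (real (n div d)) = moebius_mu d * ln (x / d) + (ln n - ln x) * moebius_mu d"
      by (simp only:) (simp add: algebra_simps)
  qed
  also have "\<dots> = (\<Sum>d | d dvd n. moebius_mu d * ln (x / d)) + (ln n - ln x) * (if n = 1 then 1 else 0)"
    using assms by (simp add: sum.distrib sum_distrib_left[symmetric] sum_moebius_divisors)
  finally show ?thesis by (auto split: if_splits)
qed

section \<open>Sums of a non-principal character weighted by \<open>1 / n\<close>,
  \<open>ln n / n\<close> and \<open>mangoldt n / n\<close>\<close>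

context
  fixes k :: nat and chi :: "nat \<Rightarrow> complex"
  assumes k: "k \<ge> 1" and chi: "chi \<in> dirichlet_chars k" and np: "chi \<noteq> principal_char k"
begin

text \<open>Blocks of \<open>k\<close> consecutive terms cancel wherever they start, and fewer than
  \<open>k\<close> terms remain.\<close>

lemma norm_sum_char_le: "norm (\<Sum>n\<in>{a<..b}. chi n) \<le> k"
proof -
  have period: "(\<Sum>n\<in>{a<..a+k}. chi n) = 0" for a
  proof (induction a)
    case 0
    have "(\<Sum>n\<in>{0<..k}. chi n) + chi 0 = (\<Sum>n<k. chi n) + chi k"
    proof -
      have "{..k} = insert 0 {0<..k}" "{..k} = insert k {..<k}" by auto
      then show ?thesis
        using sum.insert[of "{0<..k}" 0 chi] sum.insert[of "{..<k}" k chi] by (simp add: add.commute)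
    qed
    moreover have "chi k = chi 0" by (rule char_cong[OF k chi]) (simp add: cong_def)
    ultimately show ?case using sum_char_period[OF k chi np] by simp
  next
    case (Suc a)
    have "{a<..Suc a + k} = insert (Suc a) {Suc a<..Suc a + k}" "{a<..Suc a + k} = insert (Suc a + k) {a<..a+k}"
      by auto
    then have "(\<Sum>n\<in>{Suc a<..Suc a + k}. chi n) + chi (Suc a) = (\<Sum>n\<in>{a<..a+k}. chi n) + chi (Suc a + k)"
      using sum.insert[of "{Suc a<..Suc a + k}" "Suc a" chi] sum.insert[of "{a<..a+k}" "Suc a + k" chi]
      by (simp add: add.commute)
    moreover have "chi (Suc a + k) = chi (Suc a)"
      by (rule char_cong[OF k chi]) (unfold cong_def, rule mod_add_self2)
    ultimately show ?case using Suc by simp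
  qed
  show ?thesis
  proof (induction "b - a" arbitrary: a rule: less_induct)
    case less
    show ?case
    proof (cases "a + k \<le> b")
      case True
      then have "{a<..b} = {a<..a+k} \<union> {a+k<..b}" by auto
      then have "(\<Sum>n\<in>{a<..b}. chi n) = (\<Sum>n\<in>{a<..a+k}. chi n) + (\<Sum>n\<in>{a+k<..b}. chi n)"
        by (simp only:) (rule sum.union_disjoint, auto)
      moreover have "norm (\<Sum>n\<in>{a+k<..b}. chi n) \<le> k" using True k by (intro less) auto
      ultimately show ?thesis using period by simp
    next
      case False
      have "norm (\<Sum>n\<in>{a<..b}. chi n) \<le> (\<Sum>n\<in>{a<..b}. 1)"
        using norm_char_le[OF k chi] by (intro order.trans[OF norm_sum sum_mono])
      also have "\<dots> = real (b - a)" by simp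
      finally show ?thesis using False by linarith
    qed
  qed
qed

lemma norm_sum_char_weighted_le:
  fixes g :: "nat \<Rightarrow> real"
  assumes "\<And>n. a < n \<Longrightarrow> g (Suc n) \<le> g n" "\<And>n. a < n \<Longrightarrow> 0 \<le> g n"
  shows "norm (\<Sum>i\<in>{a<..b}. g i *\<^sub>R chi i) \<le> k * g (Suc a)"
proof (cases "a < b")
  case True
  then show ?thesis using assms norm_sum_char_le by (intro abel_bound) auto
next
  case False
  then show ?thesis using assms(2)[of "Suc a"] by simp
qed

text \<open>The value \<open>L(1, chi)\<close>, taken as the limit of ordered partial sums because
  the series converges only conditionally.\<close>

definition L_one :: complex where
  "L_one = lim (\<lambda>N. \<Sum>n\<in>{1..N}. chi n / n)"

lemma L_one_tail: "norm (L_one - (\<Sum>n\<in>{1..N}. chi n / n)) \<le> k / (N + 1)"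
proof -
  define S where "S N = (\<Sum>n\<in>{1..N}. chi n / n)" for N :: nat
  have diff: "norm (S b - S a) \<le> k / (a + 1)" if "a \<le> b" for a b
  proof -
    have "{1..b} = {1..a} \<union> {a<..b}" using that by auto
    then have "S b = S a + (\<Sum>n\<in>{a<..b}. chi n / n)"
      unfolding S_def by (simp only:) (rule sum.union_disjoint, auto)
    moreover have "norm (\<Sum>n\<in>{a<..b}. (1 / real n) *\<^sub>R chi n) \<le> k * (1 / real (Suc a))"
      by (rule norm_sum_char_weighted_le) (auto simp: frac_le)
    ultimately show ?thesis by (simp add: scaleR_conv_of_real add.commute)
  qed
  have "Cauchy S"
  proof (rule metric_CauchyI)
    fix e :: real assume "0 < e"
    then obtain M where M: "real k / e < real M" using reals_Archimedean2 by blast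
    have "dist (S m) (S n) < e" if "M \<le> m" "M \<le> n" for m n
    proof -
      have "dist (S b) (S a) < e" if "M \<le> a" "a \<le> b" for a b
      proof -
        have "real k / e < real a + 1" using M that by simp
        then have "k / (a + 1) < e" using \<open>0 < e\<close> by (simp add: field_simps)
        then show ?thesis using diff[OF that(2)] by (simp add: dist_norm add.commute)
      qed
      then show ?thesis using that by (metis dist_commute nle_le)
    qed
    then show "\<exists>M. \<forall>m\<ge>M. \<forall>n\<ge>M. dist (S m) (S n) < e" by blast
  qed
  then have "S \<longlonglongrightarrow> L_one"
    unfolding L_one_def S_def[abs_def, symmetric] by (simp add: Cauchy_convergent_iff convergent_LIMSEQ_iff)
  then have "(\<lambda>b. norm (S b - S N)) \<longlonglongrightarrow> norm (L_one - S N)" by (intro tendsto_intros)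
  then have "norm (L_one - S N) \<le> k / (N + 1)"
    by (rule tendsto_upperbound) (use diff in \<open>auto intro!: eventually_sequentiallyI[of N] simp: add.commute\<close>)
  then show ?thesis by (simp add: S_def add.commute)
qed

text \<open>The weight \<open>ln n / n\<close> decreases only from \<open>e\<close> on, so the terms
  up to 3 are estimated trivially and partial summation handles the rest.\<close>

lemma sum_char_ln_bounded: "\<exists>C. \<forall>N. norm (\<Sum>n\<in>{1..N}. chi n * of_real (ln (real n)) / n) \<le> C"
proof -
  define g where "g n = ln (real n) / n" for n :: nat
  have g: "g (Suc n) \<le> g n" "0 \<le> g n" if "3 < Suc n" for n
  proof -
    have "exp 1 \<le> real n" using that exp_le by linarith
    then have "1 \<le> ln (real n)" using that by (subst ln_ge_iff) auto
    moreover have "real n * (ln (real (Suc n)) - ln (real n)) \<le> 1" using that by (intro ln_Suc_div_le) simp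
    ultimately have "real n * ln (real (Suc n)) \<le> real (Suc n) * ln (real n)" by (simp add: algebra_simps)
    then show "g (Suc n) \<le> g n" using that by (simp add: g_def divide_le_eq mult.commute frac_le_eq pos_le_divide_eq)
    show "0 \<le> g n" using that by (simp add: g_def)
  qed
  have eq: "chi n * of_real (ln (real n)) / n = g n *\<^sub>R chi n" for n :: nat
    by (simp add: g_def scaleR_conv_of_real)
  have "norm (\<Sum>n\<in>{1..N}. chi n * of_real (ln (real n)) / n) \<le> (\<Sum>n\<in>{1..3}. g n) + k * g 4" for N
  proof -
    have "norm (\<Sum>n\<in>{1..N}. g n *\<^sub>R chi n) \<le> norm (\<Sum>n\<in>{1..min 3 N}. g n *\<^sub>R chi n) + norm (\<Sum>n\<in>{min 3 N<..N}. g n *\<^sub>R chi n)"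
    proof -
      have "{1..N} = {1..min 3 N} \<union> {min 3 N<..N}" by auto
      then have "(\<Sum>n\<in>{1..N}. g n *\<^sub>R chi n) = (\<Sum>n\<in>{1..min 3 N}. g n *\<^sub>R chi n) + (\<Sum>n\<in>{min 3 N<..N}. g n *\<^sub>R chi n)"
        by (simp only:) (rule sum.union_disjoint, auto)
      then show ?thesis by (simp add: norm_triangle_ineq)
    qed
    also have "norm (\<Sum>n\<in>{1..min 3 N}. g n *\<^sub>R chi n) \<le> (\<Sum>n\<in>{1..3}. g n)"
    proof -
      have "norm (\<Sum>n\<in>{1..min 3 N}. g n *\<^sub>R chi n) \<le> (\<Sum>n\<in>{1..min 3 N}. g n)"
        using norm_char_le[OF k chi]
        by (intro order.trans[OF norm_sum sum_mono]) (auto simp: g_def intro!: divide_right_mono mult_left_le)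
      also have "\<dots> \<le> (\<Sum>n\<in>{1..3}. g n)" by (intro sum_mono2) (auto simp: g_def)
      finally show ?thesis .
    qed
    also have "norm (\<Sum>n\<in>{min 3 N<..N}. g n *\<^sub>R chi n) \<le> k * g 4"
    proof (cases "3 \<le> N")
      case True
      then show ?thesis using norm_sum_char_weighted_le[of 3 g N] g by (auto simp: min_def numeral_eq_Suc)
    next
      case False
      then show ?thesis using g[of 4] by (simp add: min_def)
    qed
    finally show "norm (\<Sum>n\<in>{1..N}. chi n * of_real (ln (real n)) / n) \<le> (\<Sum>n\<in>{1..3}. g n) + k * g 4"
      unfolding eq by simp
  qed
  then show ?thesis by blast
qed

lemma sum_inverse_div_le:
  assumes "d \<in> {1..N}"
  shows "norm (L_one - (\<Sum>m\<in>{1..N div d}. chi m / m)) \<le> k * d / N"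
proof -
  have "real N / real d \<le> real (N div d) + 1"
    using floor_divide_of_nat_eq[of N d, where ?'a = real] real_of_int_floor_add_one_ge[of "real N / real d"] by simp
  moreover have "0 < real N / real d" using assms by simp
  ultimately have "k / (real (N div d) + 1) \<le> k / (real N / real d)" by (intro frac_le) auto
  then show ?thesis using L_one_tail[of "N div d"] by (simp add: add.commute)
qed

lemma char_div:
  assumes "d dvd n"
  shows "chi n / n = (chi d / d) * (chi (n div d) / of_nat (n div d))"
  using assms by (cases "n = 0") (auto elim!: dvdE simp: char_mult[OF k chi])

text \<open>As \<open>ln\<close> is the divisor sum of \<open>mangoldt\<close>, the bounded sum with
  \<open>ln\<close> is a sum over \<open>d\<close> of \<open>chi d * mangoldt d / d\<close> times
  partial sums of the series for \<open>L_one\<close>. Replacing these by \<open>L_one\<close> costs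
  \<open>k * d / N\<close> each, in total at most \<open>4 * k\<close> by Chebyshev; division by
  \<open>L_one\<close> finishes.\<close>

lemma sum_char_mangoldt_bounded:
  assumes L: "L_one \<noteq> 0"
  shows "\<exists>C. \<forall>N. norm (\<Sum>n\<in>{1..N}. chi n * mangoldt n / n) \<le> C"
proof -
  obtain C where C: "\<And>N. norm (\<Sum>n\<in>{1..N}. chi n * of_real (ln (real n)) / n) \<le> C" using sum_char_ln_bounded by blast
  have "norm (\<Sum>n\<in>{1..N}. chi n * mangoldt n / n) \<le> (C + 4 * k) / norm L_one" for N
  proof (cases "N = 0")
    case True
    then show ?thesis using order.trans[OF norm_ge_zero C[of 0]] by simp
  next
    case False
    let ?S = "\<Sum>d\<in>{1..N}. chi d * mangoldt d / d"
    have "(\<Sum>n\<in>{1..N}. chi n * of_real (ln (real n)) / n) = (\<Sum>n\<in>{1..N}. \<Sum>d | d dvd n. (chi d * mangoldt d / d) * (chi (n div d) / of_nat (n div d)))"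
    proof (intro sum.cong refl)
      fix n assume n: "n \<in> {1..N}"
      have "chi n * of_real (ln (real n)) / n = (\<Sum>d | d dvd n. mangoldt d * (chi n / n))"
        unfolding sum_distrib_right[symmetric]
        using mangoldt_sum[of n, where 'a = complex] n by simp
      also have "\<dots> = (\<Sum>d | d dvd n. (chi d * mangoldt d / d) * (chi (n div d) / of_nat (n div d)))"
        by (intro sum.cong refl) (simp add: char_div mult_ac)
      finally show "chi n * of_real (ln (real n)) / n = (\<Sum>d | d dvd n. (chi d * mangoldt d / d) * (chi (n div d) / of_nat (n div d)))" .
    qed
    also have "\<dots> = (\<Sum>d\<in>{1..N}. \<Sum>m\<in>{1..N div d}. (chi d * mangoldt d / d) * (chi m / m))"
      by (rule sum_divisors_swap)
    also have "\<dots> = (\<Sum>d\<in>{1..N}. (chi d * mangoldt d / d) * (\<Sum>m\<in>{1..N div d}. chi m / m))"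
      by (simp add: sum_distrib_left)
    finally have "L_one * ?S - (\<Sum>n\<in>{1..N}. chi n * of_real (ln (real n)) / n) =
        (\<Sum>d\<in>{1..N}. (chi d * mangoldt d / d) * (L_one - (\<Sum>m\<in>{1..N div d}. chi m / m)))"
      by (simp add: sum_distrib_left sum_subtractf algebra_simps)
    also have "norm \<dots> \<le> (\<Sum>d\<in>{1..N}. mangoldt d * (k / N))"
    proof (rule order.trans[OF norm_sum sum_mono])
      fix d assume d: "d \<in> {1..N}"
      have "norm (chi d * mangoldt d / d) \<le> mangoldt d / d"
        using norm_char_le[OF k chi, of d] mangoldt_nonneg[of d]
        by (simp add: norm_mult norm_divide divide_right_mono mult_left_le_one_le)
      then have "norm ((chi d * mangoldt d / d) * (L_one - (\<Sum>m\<in>{1..N div d}. chi m / m))) \<le> (mangoldt d / d) * (k * d / N)"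
        unfolding norm_mult[of "chi d * mangoldt d / d"]
        using sum_inverse_div_le[OF d] mangoldt_nonneg[of d] by (intro mult_mono) auto
      then show "norm ((chi d * mangoldt d / d) * (L_one - (\<Sum>m\<in>{1..N div d}. chi m / m))) \<le> mangoldt d * (k / N)"
        using d by (simp add: field_simps)
    qed
    also have "\<dots> = (\<Sum>d\<in>{1..N}. mangoldt d) * (k / N)"
      by (rule sum_distrib_right[symmetric])
    also have "\<dots> \<le> (4 * N) * (k / N)" by (intro mult_right_mono order.trans[OF chebyshev_psi_le]) auto
    also have "\<dots> = 4 * k" using False by simp
    finally have "norm (L_one * ?S) \<le> C + 4 * k"
      using C[of N] norm_triangle_sub[of "L_one * ?S" "\<Sum>n\<in>{1..N}. chi n * of_real (ln (real n)) / n"] by linarith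
    then show ?thesis using L by (simp add: norm_mult pos_le_divide_eq mult.commute)
  qed
  then show ?thesis by blast
qed

text \<open>Apply \<open>sum_moebius_ln\<close> at \<open>x = N\<close>; its term at
  \<open>n = 1\<close> is the \<open>ln N\<close>. With \<open>L_one = 0\<close> the inner sums are
  themselves at most \<open>k * d / N\<close>, and the sum of \<open>ln (N / d)\<close> over
  \<open>d\<close> is at most \<open>N\<close> by \<open>sum_ln_ge\<close>.\<close>

lemma sum_char_mangoldt_add_ln_bounded:
  assumes L: "L_one = 0"
  shows "\<exists>C. \<forall>N>0. norm ((\<Sum>n\<in>{1..N}. chi n * mangoldt n / n) + of_real (ln (real N))) \<le> C"
proof (intro exI allI impI)
  fix N :: nat assume N: "N > 0"
  have "(\<Sum>n\<in>{1..N}. chi n * mangoldt n / n) + of_real (ln N) =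
      (\<Sum>n\<in>{1..N}. chi n / n * of_real ((if n = 1 then ln N else 0) + mangoldt n))"
  proof -
    have "(\<Sum>n\<in>{1..N}. chi n / n * of_real ((if n = 1 then ln N else 0) + mangoldt n)) =
        (\<Sum>n\<in>{1..N}. chi n * mangoldt n / n + (if n = 1 then of_real (ln N) else 0))"
      by (intro sum.cong refl) (auto simp: char_1[OF k chi] mangoldt_Suc_0)
    also have "\<dots> = (\<Sum>n\<in>{1..N}. chi n * mangoldt n / n) + of_real (ln N)"
      using N by (simp add: sum.distrib)
    finally show ?thesis ..
  qed
  also have "\<dots> = (\<Sum>n\<in>{1..N}. \<Sum>d | d dvd n. (chi d * of_real (moebius_mu d * ln (N / d)) / d) * (chi (n div d) / of_nat (n div d)))"
  proof (intro sum.cong refl)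
    fix n assume n: "n \<in> {1..N}"
    then have "chi n / n * of_real ((if n = 1 then ln N else 0) + mangoldt n) = (\<Sum>d | d dvd n. (chi n / n) * of_real (moebius_mu d * ln (N / d)))"
      using sum_moebius_ln[of n "real N"] N by (simp only: sum_distrib_left[symmetric] of_real_sum[symmetric]) simp
    also have "\<dots> = (\<Sum>d | d dvd n. (chi d * of_real (moebius_mu d * ln (N / d)) / d) * (chi (n div d) / of_nat (n div d)))"
      by (intro sum.cong refl) (simp only: mem_Collect_eq char_div, simp add: mult_ac)
    finally show "chi n / n * of_real ((if n = 1 then ln N else 0) + mangoldt n) =
        (\<Sum>d | d dvd n. (chi d * of_real (moebius_mu d * ln (N / d)) / d) * (chi (n div d) / of_nat (n div d)))" .
  qed
  also have "\<dots> = (\<Sum>d\<in>{1..N}. \<Sum>m\<in>{1..N div d}. (chi d * of_real (moebius_mu d * ln (N / d)) / d) * (chi m / m))"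
    by (rule sum_divisors_swap)
  also have "\<dots> = (\<Sum>d\<in>{1..N}. (chi d * of_real (moebius_mu d * ln (N / d)) / d) * (\<Sum>m\<in>{1..N div d}. chi m / m))"
    by (simp add: sum_distrib_left)
  also have "norm \<dots> \<le> (\<Sum>d\<in>{1..N}. (k / N) * (ln N - ln d))"
  proof (rule order.trans[OF norm_sum sum_mono])
    fix d assume d: "d \<in> {1..N}"
    have l: "0 \<le> ln N - ln d" "ln (N / d) = ln N - ln d" using d by (auto simp: ln_div)
    have "norm (chi d * of_real (moebius_mu d * ln (N / d)) / d) \<le> 1 * (1 * (ln N - ln d)) / d"
      unfolding norm_divide norm_mult norm_of_real norm_of_nat abs_mult
      using norm_char_le[OF k chi, of d] abs_moebius_le[of d] l
      by (intro divide_right_mono mult_mono) auto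
    moreover have "norm (\<Sum>m\<in>{1..N div d}. chi m / m) \<le> k * d / N"
      using sum_inverse_div_le[OF d] L by simp
    ultimately have "norm ((chi d * of_real (moebius_mu d * ln (N / d)) / d) * (\<Sum>m\<in>{1..N div d}. chi m / m))
        \<le> (1 * (1 * (ln N - ln d)) / d) * (k * d / N)"
      unfolding norm_mult[of "chi d * of_real (moebius_mu d * ln (N / d)) / d"] using l by (intro mult_mono) auto
    also have "(1 * (1 * (ln N - ln d)) / d) * (k * d / N) = (k / N) * (ln N - ln d)"
      using d by (simp add: field_simps)
    finally show "norm ((chi d * of_real (moebius_mu d * ln (N / d)) / d) * (\<Sum>m\<in>{1..N div d}. chi m / m)) \<le> (k / N) * (ln N - ln d)" .
  qed
  also have "\<dots> = (k / N) * (N * ln N - (\<Sum>d\<in>{1..N}. ln (real d)))"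
    unfolding sum_distrib_left[symmetric] by (simp add: sum_subtractf)
  also have "\<dots> \<le> (k / N) * N" using sum_ln_ge[of N] by (intro mult_left_mono) auto
  also have "\<dots> = k" using N by simp
  finally show "norm ((\<Sum>n\<in>{1..N}. chi n * mangoldt n / n) + of_real (ln (real N))) \<le> k" .
qed

end

section \<open>Non-vanishing for real characters\<close>

text \<open>For a real character \<open>r\<close> these are the Dirichlet coefficients of
  \<open>zeta(s) * L(s, r)\<close>.\<close>

definition char_divisor_sum :: "(nat \<Rightarrow> real) \<Rightarrow> nat \<Rightarrow> real" where
  "char_divisor_sum r n = (\<Sum>d | d dvd n. r d)"

text \<open>Divisors of \<open>p ^ Suc a * m\<close> prime to \<open>p\<close> divide
  \<open>m\<close>; the others are \<open>p\<close> times the divisors of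
  \<open>p ^ a * m\<close>.\<close>

lemma char_divisor_sum_prime_power:
  fixes r :: "nat \<Rightarrow> real"
  assumes mult: "\<And>m n. r (m * n) = r m * r n" and p: "prime p" "\<not> p dvd m"
  shows "char_divisor_sum r (p ^ a * m) = (\<Sum>i\<le>a. r p ^ i) * char_divisor_sum r m"
proof (induction a)
  case 0
  then show ?case by simp
next
  case (Suc a)
  have m: "m > 0" using p by (auto intro: gr0I)
  have p0: "p > 0" using p by (simp add: prime_gt_0_nat)
  have "{d. d dvd p ^ Suc a * m} = {d. d dvd m} \<union> (*) p ` {d. d dvd p ^ a * m}"
  proof (intro equalityI subsetI)
    fix d assume "d \<in> {d. d dvd p ^ Suc a * m}"
    then have d: "d dvd p ^ Suc a * m" by simp
    show "d \<in> {d. d dvd m} \<union> (*) p ` {d. d dvd p ^ a * m}"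
    proof (cases "p dvd d")
      case True
      then obtain e where "d = p * e" by blast
      then show ?thesis using d p0 by (auto simp: mult.assoc)
    next
      case False
      then have "coprime d (p ^ Suc a)" using p by (metis coprime_commute coprime_power_left_iff prime_imp_coprime)
      then have "d dvd m" using d by (simp add: coprime_dvd_mult_right_iff)
      then show ?thesis by simp
    qed
  qed (auto simp: mult.assoc intro: dvd_mult)
  moreover have "{d. d dvd m} \<inter> (*) p ` {d. d dvd p ^ a * m} = {}"
    using p by (auto dest: dvd_mult_left)
  ultimately have "char_divisor_sum r (p ^ Suc a * m) = char_divisor_sum r m + sum r ((*) p ` {d. d dvd p ^ a * m})"
    unfolding char_divisor_sum_def using m p0
    by (simp only:) (intro sum.union_disjoint, auto)
  also have "sum r ((*) p ` {d. d dvd p ^ a * m}) = r p * char_divisor_sum r (p ^ a * m)"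
    using p0 by (subst sum.reindex) (auto simp: inj_on_def mult char_divisor_sum_def sum_distrib_left)
  also have "char_divisor_sum r m + r p * char_divisor_sum r (p ^ a * m) = (\<Sum>i\<le>Suc a. r p ^ i) * char_divisor_sum r m"
    unfolding Suc sum.atMost_Suc_shift by (simp add: sum_distrib_left algebra_simps)
  finally show ?case .
qed

text \<open>Both claims reduce to the local factors. For \<open>r p = -1\<close> such a factor is an
  alternating sum, 1 or 0 according to parity; in a square all exponents are even.\<close>

lemma
  fixes r :: "nat \<Rightarrow> real"
  assumes mult: "\<And>m n. r (m * n) = r m * r n" and val: "\<And>n. r n \<in> {-1, 0, 1}" and one: "r 1 = 1"
  shows char_divisor_sum_nonneg: "0 < n \<Longrightarrow> 0 \<le> char_divisor_sum r n"
    and char_divisor_sum_square: "0 < n \<Longrightarrow> 1 \<le> char_divisor_sum r (n\<^sup>2)"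
proof -
  have geom: "0 \<le> (\<Sum>i\<le>a. r p ^ i)" "even a \<Longrightarrow> 1 \<le> (\<Sum>i\<le>a. r p ^ i)" for p a
  proof -
    have neg: "(\<Sum>i\<le>a. (- 1 :: real) ^ i) = (if even a then 1 else 0)" for a
      by (induction a) auto
    consider "r p = -1" | "r p = 0" | "r p = 1" using val[of p] by auto
    then have "0 \<le> (\<Sum>i\<le>a. r p ^ i) \<and> (even a \<longrightarrow> 1 \<le> (\<Sum>i\<le>a. r p ^ i))"
      by cases (auto simp: neg power_0_left)
    then show "0 \<le> (\<Sum>i\<le>a. r p ^ i)" "even a \<Longrightarrow> 1 \<le> (\<Sum>i\<le>a. r p ^ i)" by auto
  qed
  have decomp: "\<exists>p a m. prime p \<and> 0 < a \<and> n = p ^ a * m \<and> \<not> p dvd m \<and> 0 < m \<and> m < n"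
    if "1 < n" for n :: nat
  proof -
    have "n \<noteq> 1" using that by simp
    from prime_factor_nat[OF this] obtain p where p: "prime p" "p dvd n" by blast
    have p1: "1 < p" using p(1) by (rule prime_gt_1_nat)
    have "n \<noteq> 0" "\<not> is_unit p" using that p1 by auto
    then obtain m where m: "n = p ^ multiplicity p n * m" "\<not> p dvd m"
      using multiplicity_decompose' by blast
    have a: "0 < multiplicity p n" using p that by (simp add: prime_multiplicity_gt_zero_iff)
    have "0 < m" using m(2) by (auto intro: gr0I)
    moreover have "1 < p ^ multiplicity p n" using p1 a by (rule one_less_power)
    ultimately have "m < p ^ multiplicity p n * m" by simp
    also have "p ^ multiplicity p n * m = n" by (rule m(1)[symmetric])
    finally have "m < n" .
    then show ?thesis using p(1) a m \<open>0 < m\<close> by blast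
  qed
  show "0 \<le> char_divisor_sum r n" if "0 < n"
    using that
  proof (induction n rule: less_induct)
    case (less n)
    show ?case
    proof (cases "n = 1")
      case True
      then show ?thesis using one by (simp add: char_divisor_sum_def)
    next
      case False
      then obtain p a m where *: "prime p" "n = p ^ a * m" "\<not> p dvd m" "0 < m" "m < n"
        using decomp[of n] less.prems by auto
      have "0 \<le> (\<Sum>i\<le>a. r p ^ i) * char_divisor_sum r m" using less.IH[of m] * geom(1) by simp
      then show ?thesis using char_divisor_sum_prime_power[OF mult *(1,3)] *(2) by simp
    qed
  qed
  show "1 \<le> char_divisor_sum r (n\<^sup>2)" if "0 < n"
    using that
  proof (induction n rule: less_induct)
    case (less n)
    show ?case
    proof (cases "n = 1")
      case True
      then show ?thesis using one by (simp add: char_divisor_sum_def)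
    next
      case False
      then obtain p a m where *: "prime p" "n = p ^ a * m" "\<not> p dvd m" "0 < m" "m < n"
        using decomp[of n] less.prems by auto
      have "\<not> p dvd m\<^sup>2" using *(1,3) by (simp add: prime_dvd_power_iff)
      then have "char_divisor_sum r (p ^ (2 * a) * m\<^sup>2) = (\<Sum>i\<le>2*a. r p ^ i) * char_divisor_sum r (m\<^sup>2)"
        by (rule char_divisor_sum_prime_power[OF mult *(1)])
      moreover have "p ^ (2 * a) * m\<^sup>2 = n\<^sup>2" using *(2) by (simp add: power_mult_distrib power_mult[symmetric] mult.commute)
      moreover have "1 * 1 \<le> (\<Sum>i\<le>2*a. r p ^ i) * char_divisor_sum r (m\<^sup>2)"
        using less.IH[of m] * geom(1)[of p "2 * a"] geom(2)[of "2 * a" p] by (intro mult_mono) auto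
      ultimately show ?thesis by simp
    qed
  qed
qed

text \<open>The weights of the Lambert series in Monsky's proof that a real character has \<open>L(1) \<noteq> 0\<close>.\<close>

definition lambert_weight :: "real \<Rightarrow> nat \<Rightarrow> real" where
  "lambert_weight t n = 1 / (n * (1 - t)) - t ^ n / (1 - t ^ n)"

text \<open>Pair the index \<open>(i, j)\<close> of the expanded product with its reflection
  \<open>(n - Suc i, n - j)\<close>: the exponents add up to \<open>2 * n - 1\<close>, so the
  arithmetic-geometric mean inequality bounds each pair below by \<open>2 * t ^ n\<close>.\<close>

lemma geometric_product_ge:
  fixes t :: real
  assumes "0 < t" "t < 1"
  shows "real n * (real n + 1) * t ^ n \<le> (\<Sum>i<n. t ^ i) * (\<Sum>j<Suc n. t ^ j)"
proof (cases "n = 0")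
  case False
  have pair: "2 * t ^ n \<le> t ^ (i + j) + t ^ ((n - Suc i) + (n - j))" if "i < n" "j < Suc n" for i j
  proof (rule power2_le_imp_le)
    have e: "(i + j) + ((n - Suc i) + (n - j)) = 2 * n - 1" using that by simp
    have "4 * t ^ (2 * n) \<le> 4 * t ^ (2 * n - 1)" using assms by (intro mult_left_mono power_decreasing) auto
    also have "t ^ (2 * n - 1) = t ^ (i + j) * t ^ ((n - Suc i) + (n - j))" by (simp only: power_add[symmetric] e)
    also have "4 * (x * y) \<le> (x + y)\<^sup>2" for x y :: real
      using zero_le_power2[of "x - y"] by (simp add: power2_eq_square algebra_simps)
    finally show "(2 * t ^ n)\<^sup>2 \<le> (t ^ (i + j) + t ^ ((n - Suc i) + (n - j)))\<^sup>2"
      by (simp add: power_mult_distrib power_mult[symmetric] mult.commute)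
  qed (use assms in simp)
  have "real n * (real n + 1) * (2 * t ^ n) = (\<Sum>i<n. \<Sum>j<Suc n. 2 * t ^ n)"
    by (simp add: algebra_simps)
  also have "\<dots> \<le> (\<Sum>i<n. \<Sum>j<Suc n. t ^ (i + j) + t ^ ((n - Suc i) + (n - j)))"
    by (intro sum_mono pair) auto
  also have "\<dots> = (\<Sum>i<n. \<Sum>j<Suc n. t ^ (i + j)) + (\<Sum>i<n. \<Sum>j<Suc n. t ^ ((n - Suc i) + (n - j)))"
    by (simp only: sum.distrib)
  also have "(\<Sum>i<n. \<Sum>j<Suc n. t ^ ((n - Suc i) + (n - j))) = (\<Sum>i<n. \<Sum>j<Suc n. t ^ (i + (n - j)))"
    by (rule sum.nat_diff_reindex)
  also have "\<dots> = (\<Sum>i<n. \<Sum>j<Suc n. t ^ (i + j))"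
    using sum.nat_diff_reindex[of "\<lambda>j. t ^ (_ + j)" "Suc n"] by simp
  also have "(\<Sum>i<n. \<Sum>j<Suc n. t ^ (i + j)) = (\<Sum>i<n. t ^ i) * (\<Sum>j<Suc n. t ^ j)"
    by (simp only: sum_product power_add)
  finally show ?thesis by (simp add: algebra_simps)
qed simp

text \<open>With \<open>s n\<close> for the geometric sum, the claim times \<open>1 - t\<close> says
  that \<open>t ^ n / (s n * s (Suc n))\<close> is at most \<open>1 / n - 1 / Suc n\<close>, which
  is \<open>geometric_product_ge\<close>.\<close>

lemma lambert_weight_antimono:
  assumes "0 < t" "t < 1" "0 < n"
  shows "lambert_weight t (Suc n) \<le> lambert_weight t n"
proof -
  define s where "s n = (\<Sum>i<n. t ^ i)" for n
  have s: "1 - t ^ n = (1 - t) * s n" for n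
    using assms by (simp add: s_def one_diff_power_eq)
  have s0: "0 < s n" if "0 < n" for n
  proof -
    have "t ^ n < 1" using assms that by (simp add: power_less_one_iff)
    then have "0 < (1 - t) * s n" using s[of n] by linarith
    then show ?thesis using assms by (simp add: zero_less_mult_iff)
  qed
  have pos: "0 < s n" "0 < s (Suc n)" "0 < 1 - t" using s0 assms by auto
  have "t ^ n / s n - t ^ Suc n / s (Suc n) = t ^ n * (s (Suc n) - t * s n) / (s n * s (Suc n))"
    using pos by (simp add: field_simps)
  also have "s (Suc n) - t * s n = 1"
    unfolding s_def sum.lessThan_Suc_shift by (simp add: sum_distrib_left)
  also have "t ^ n * 1 / (s n * s (Suc n)) \<le> 1 / (real n * (real n + 1))"
  proof -
    have 1: "real n * (real n + 1) * t ^ n \<le> s n * s (Suc n)"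
      using geometric_product_ge[OF assms(1,2), of n] unfolding s_def .
    have "a * 1 / x \<le> 1 / y" if "y * a \<le> x" "0 < x" "0 < y" for a x y :: real
      using that by (simp add: field_simps)
    from this[OF 1] show ?thesis using pos assms(3) by simp
  qed
  also have "1 / (real n * (real n + 1)) = 1 / real n - 1 / real (Suc n)" using assms by (simp add: field_simps)
  finally have "1 / real (Suc n) - t ^ Suc n / s (Suc n) \<le> 1 / real n - t ^ n / s n" by simp
  then have "(1 / real (Suc n) - t ^ Suc n / s (Suc n)) / (1 - t) \<le> (1 / real n - t ^ n / s n) / (1 - t)"
    using pos by (intro divide_right_mono) auto
  then show ?thesis unfolding lambert_weight_def s by (simp add: diff_divide_distrib mult.commute)
qed

lemma lambert_weight_nonneg:
  assumes "0 < t" "t < 1" "0 < n"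
  shows "0 \<le> lambert_weight t n"
proof -
  have "n * t ^ n = (\<Sum>i<n. t ^ n)" by simp
  also have "\<dots> \<le> (\<Sum>i<n. t ^ i)" using assms by (intro sum_mono power_decreasing) auto
  finally have "n * t ^ n * (1 - t) \<le> (1 - t) * (\<Sum>i<n. t ^ i)"
    using assms by (simp add: mult.commute mult_left_mono)
  also have "\<dots> = 1 - t ^ n" by (simp add: one_diff_power_eq)
  finally have *: "n * t ^ n * (1 - t) \<le> 1 - t ^ n" .
  have "t ^ n < 1" using assms by (simp add: power_less_one_iff)
  then show ?thesis using * assms by (simp add: lambert_weight_def divide_simps mult_ac)
qed

lemma lambert_weight_1: "0 < t \<Longrightarrow> t < 1 \<Longrightarrow> lambert_weight t 1 = 1"
  by (simp add: lambert_weight_def field_simps)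

text \<open>The power series with coefficients \<open>B n\<close> is at least the sum of
  \<open>t ^ (s\<^sup>2)\<close>, which grows without bound as \<open>t\<close> tends to 1. As a
  Lambert series it is \<open>L_one / (1 - t)\<close> minus a sum with the weights above, and
  partial summation bounds the latter by \<open>k\<close> times the first weight, which is 1. If
  \<open>L_one\<close> vanished, the series would stay below \<open>k\<close>.\<close>

lemma real_L_one_nonzero:
  fixes k :: nat and chi :: "nat \<Rightarrow> complex"
  assumes k: "k \<ge> 1" and chi: "chi \<in> dirichlet_chars k" "chi \<noteq> principal_char k"
    and real: "\<And>n. cnj (chi n) = chi n"
  shows "L_one chi \<noteq> 0"
proof
  assume L: "L_one chi = 0"
  define r where "r n = Re (chi n)" for n
  have chir: "chi n = of_real (r n)" for n using real[of n] by (simp add: r_def complex_eq_iff)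
  have mult: "r (m * n) = r m * r n" for m n
    using char_mult[OF k chi(1), of m n] unfolding chir of_real_mult[symmetric] of_real_eq_iff .
  have one: "r 1 = 1" using char_1[OF k chi(1)] by (simp add: r_def)
  have val: "r n \<in> {-1, 0, 1}" for n
  proof (cases "coprime n k")
    case True
    then have "\<bar>r n\<bar> = 1" using norm_char[OF k chi(1) True] unfolding chir by simp
    then show ?thesis by auto
  qed (use char_0[OF k chi(1)] in \<open>simp add: r_def\<close>)
  define B where "B = char_divisor_sum r"
  have B0: "0 \<le> B n" if "0 < n" for n
    unfolding B_def using that by (intro char_divisor_sum_nonneg mult val one)
  have Bsq: "1 \<le> B (n\<^sup>2)" if "0 < n" for n
    unfolding B_def using that by (intro char_divisor_sum_square mult val one)
  have bound: "(\<Sum>s\<in>{1..M}. t ^ (s\<^sup>2)) \<le> k" if t: "0 < t" "t < 1" for t :: real and M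
  proof -
    have tn: "t ^ n < 1" if "0 < n" for n using t that by (simp add: power_less_one_iff)
    define U where "U N = (\<Sum>n\<in>{1..N}. r n / n)" for N :: nat
    have U: "U \<longlonglongrightarrow> 0"
    proof (rule Lim_null_comparison)
      show "\<forall>\<^sub>F N in sequentially. norm (U N) \<le> k / (real N + 1)"
      proof (intro always_eventually allI)
        fix N
        have "(\<Sum>n\<in>{1..N}. chi n / n) = of_real (U N)" by (simp add: U_def chir)
        then show "norm (U N) \<le> k / (real N + 1)"
          using L_one_tail[OF k chi, of N] L by simp
      qed
      show "(\<lambda>N. k / (real N + 1)) \<longlonglongrightarrow> 0" by real_asymp
    qed
    \<comment> \<open>Cutting at \<open>N\<close> keeps every sum finite. The two costs, the partial
      sum \<open>U N\<close> of a series with value 0 and the tails of the geometric series, vanish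
      as \<open>N\<close> grows with \<open>t\<close> fixed.\<close>
    have main: "(\<Sum>s\<in>{1..M}. t ^ (s\<^sup>2)) \<le> k + \<bar>U N\<bar> / (1 - t) + N * t ^ N / (1 - t)" if N: "M\<^sup>2 \<le> N" for N
    proof -
      have "(\<Sum>s\<in>{1..M}. t ^ (s\<^sup>2)) = (\<Sum>n\<in>(\<lambda>s. s\<^sup>2) ` {1..M}. t ^ n)"
        by (subst sum.reindex) (auto simp: inj_on_def power2_eq_iff_nonneg)
      also have "\<dots> \<le> (\<Sum>n\<in>(\<lambda>s. s\<^sup>2) ` {1..M}. B n * t ^ n)"
      proof (rule sum_mono)
        fix n assume "n \<in> (\<lambda>s. s\<^sup>2) ` {1..M}"
        then have "1 \<le> B n" using Bsq by auto
        then show "t ^ n \<le> B n * t ^ n" using t mult_right_mono[of 1 "B n" "t ^ n"] by simp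
      qed
      also have "\<dots> \<le> (\<Sum>n\<in>{1..N}. B n * t ^ n)"
      proof (rule sum_mono2)
        show "(\<lambda>s. s\<^sup>2) ` {1..M} \<subseteq> {1..N}"
        proof
          fix n assume "n \<in> (\<lambda>s. s\<^sup>2) ` {1..M}"
          then obtain s where "n = s\<^sup>2" "1 \<le> s" "s \<le> M" by auto
          moreover have "s\<^sup>2 \<le> N" using order.trans[OF power_mono N] \<open>s \<le> M\<close> by simp
          ultimately show "n \<in> {1..N}" using N by auto
        qed
      qed (use B0 t in auto)
      also have "\<dots> = (\<Sum>n\<in>{1..N}. \<Sum>d | d dvd n. r d * t ^ (d * (n div d)))"
        unfolding B_def char_divisor_sum_def sum_distrib_right by (intro sum.cong) auto
      also have "\<dots> = (\<Sum>d\<in>{1..N}. \<Sum>m\<in>{1..N div d}. r d * t ^ (d * m))"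
        by (rule sum_divisors_swap)
      also have "\<dots> = (\<Sum>d\<in>{1..N}. r d * (t ^ d / (1 - t ^ d)) - r d * (t ^ (d * (N div d + 1)) / (1 - t ^ d)))"
      proof (rule sum.cong[OF refl])
        fix d assume d: "d \<in> {1..N}"
        have geo: "(\<Sum>m\<in>{1..K}. (t ^ d) ^ m) = (t ^ d - (t ^ d) ^ (K + 1)) / (1 - t ^ d)" for K
        proof -
          have "(1 - q) * (\<Sum>m\<in>{1..K}. q ^ m) = q - q ^ (K + 1)" for q :: real
          proof (induction K)
            case (Suc K)
            have "(1 - q) * (\<Sum>m\<in>{1..Suc K}. q ^ m) = (1 - q) * (\<Sum>m\<in>{1..K}. q ^ m) + (1 - q) * q ^ Suc K"
              by (simp add: distrib_left)
            also have "\<dots> = q - q ^ (Suc K + 1)" unfolding Suc by (simp add: algebra_simps)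
            finally show ?case .
          qed simp
          then show ?thesis using tn[of d] d by (simp add: nonzero_eq_divide_eq mult.commute)
        qed
        show "(\<Sum>m\<in>{1..N div d}. r d * t ^ (d * m)) = r d * (t ^ d / (1 - t ^ d)) - r d * (t ^ (d * (N div d + 1)) / (1 - t ^ d))"
          unfolding sum_distrib_left[symmetric] power_mult geo
          by (simp only: diff_divide_distrib right_diff_distrib)
      qed
      also have "\<dots> = (\<Sum>d\<in>{1..N}. r d * (t ^ d / (1 - t ^ d))) - (\<Sum>d\<in>{1..N}. r d * (t ^ (d * (N div d + 1)) / (1 - t ^ d)))"
        by (rule sum_subtractf)
      also have "(\<Sum>d\<in>{1..N}. r d * (t ^ d / (1 - t ^ d))) = U N / (1 - t) - (\<Sum>d\<in>{1..N}. lambert_weight t d * r d)"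
        unfolding U_def sum_divide_distrib sum_subtractf[symmetric]
        by (intro sum.cong refl) (simp add: lambert_weight_def algebra_simps)
      finally have 1: "(\<Sum>s\<in>{1..M}. t ^ (s\<^sup>2)) \<le> U N / (1 - t) - (\<Sum>d\<in>{1..N}. lambert_weight t d * r d)
          - (\<Sum>d\<in>{1..N}. r d * (t ^ (d * (N div d + 1)) / (1 - t ^ d)))" .
      have 2: "\<bar>\<Sum>d\<in>{1..N}. lambert_weight t d * r d\<bar> \<le> k"
      proof -
        have "norm (\<Sum>d\<in>{0<..N}. lambert_weight t d *\<^sub>R chi d) \<le> k * lambert_weight t (Suc 0)"
          using t by (intro norm_sum_char_weighted_le[OF k chi] lambert_weight_antimono lambert_weight_nonneg) auto
        also have "(\<Sum>d\<in>{0<..N}. lambert_weight t d *\<^sub>R chi d) = of_real (\<Sum>d\<in>{0<..N}. lambert_weight t d * r d)"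
          by (simp add: chir scaleR_conv_of_real)
        also have "{0<..N} = {1..N}" by auto
        finally show ?thesis using lambert_weight_1[OF t] unfolding norm_of_real by simp
      qed
      have 3: "U N / (1 - t) \<le> \<bar>U N\<bar> / (1 - t)" using t by (intro divide_right_mono) auto
      have 4: "\<bar>\<Sum>d\<in>{1..N}. r d * (t ^ (d * (N div d + 1)) / (1 - t ^ d))\<bar> \<le> (\<Sum>d\<in>{1..N}. t ^ N / (1 - t))"
      proof (rule order.trans[OF sum_abs sum_mono])
        fix d assume d: "d \<in> {1..N}"
        have "N < d * (N div d + 1)" using d dividend_less_times_div[of d N] by (simp add: algebra_simps)
        then have "t ^ (d * (N div d + 1)) \<le> t ^ N" using t by (intro power_decreasing) auto
        moreover have "t ^ d \<le> t" using t d power_decreasing[of 1 d t] by simp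
        ultimately have "t ^ (d * (N div d + 1)) / (1 - t ^ d) \<le> t ^ N / (1 - t)"
          using t by (intro frac_le) auto
        moreover have "0 \<le> t ^ (d * (N div d + 1)) / (1 - t ^ d)" using t tn[of d] d by (intro divide_nonneg_nonneg) auto
        moreover have "\<bar>r d\<bar> \<le> 1" using val[of d] by auto
        ultimately show "\<bar>r d * (t ^ (d * (N div d + 1)) / (1 - t ^ d))\<bar> \<le> t ^ N / (1 - t)"
          unfolding abs_mult by (smt (verit, ccfv_SIG) mult_left_le_one_le abs_ge_zero)
      qed
      have 5: "(\<Sum>d\<in>{1..N}. t ^ N / (1 - t)) = N * t ^ N / (1 - t)" by simp
      show ?thesis using 1 2 3 4 unfolding 5 by linarith
    qed
    have "(\<lambda>N. k + \<bar>U N\<bar> / (1 - t) + N * t ^ N / (1 - t)) \<longlonglongrightarrow> k + \<bar>0\<bar> / (1 - t) + 0 / (1 - t)"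
      using t by (intro tendsto_intros U powser_times_n_limit_0) auto
    then have "(\<lambda>N. k + \<bar>U N\<bar> / (1 - t) + N * t ^ N / (1 - t)) \<longlonglongrightarrow> k" by simp
    from tendsto_lowerbound[OF this eventually_sequentiallyI[OF main] sequentially_bot] show ?thesis .
  qed
  \<comment> \<open>\<open>k + 1\<close> squares contribute \<open>k + 1\<close> in the limit, one
    more than the bound.\<close>
  have "((\<lambda>t::real. \<Sum>s\<in>{1..k+1}. t ^ (s\<^sup>2)) \<longlongrightarrow> (\<Sum>s\<in>{1..k+1}. 1 ^ (s\<^sup>2))) (at_left 1)"
    by (intro tendsto_intros)
  then have "(\<Sum>s\<in>{1..k+1}. (1::real) ^ (s\<^sup>2)) \<le> k"
  proof (rule tendsto_upperbound)
    have "\<forall>\<^sub>F t in at_left (1::real). t \<in> {0<..<1}"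
      by (intro eventually_at_leftI[of 0]) auto
    then show "\<forall>\<^sub>F t in at_left (1::real). (\<Sum>s\<in>{1..k+1}. t ^ (s\<^sup>2)) \<le> k"
      by eventually_elim (intro bound, auto)
  qed simp
  then show False by simp
qed

section \<open>Mertens sums over residue classes\<close>

lemma sum_power_from_2_le:
  fixes q :: real
  assumes "0 \<le> q" "q \<le> 1 / 2"
  shows "(\<Sum>j\<in>{2..N}. q ^ j) \<le> 2 * q\<^sup>2"
proof (cases "N = 0")
  case False
  then have "1 \<le> N" by simp
  \<comment> \<open>Strengthened by a bound for the remaining tail, so that the induction
    closes.\<close>
  then have "(\<Sum>j\<in>{2..N}. q ^ j) + 2 * q ^ Suc N \<le> 2 * q\<^sup>2"
  proof (induction N rule: dec_induct)
    case base
    then show ?case by (simp add: power2_eq_square)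
  next
    case (step N)
    have "2 * q * q ^ Suc N \<le> 1 * q ^ Suc N" using assms by (intro mult_right_mono) auto
    moreover have "(\<Sum>j\<in>{2..Suc N}. q ^ j) = (\<Sum>j\<in>{2..N}. q ^ j) + q ^ Suc N" using step by simp
    ultimately show ?case using step by simp
  qed
  moreover have "0 \<le> 2 * q ^ Suc N" using assms by simp
  ultimately show ?thesis by linarith
qed simp

text \<open>Only powers \<open>p ^ j\<close> with \<open>j >= 2\<close> count. For each
  \<open>p\<close> they sum to at most \<open>2 * ln p / p\<^sup>2\<close>, and
  \<open>ln p <= 2 * sqrt p\<close> turns this into the summable \<open>u p\<close>.\<close>

lemma sum_mangoldt_nonprime_bounded:
  "\<exists>C. \<forall>N. (\<Sum>n | n \<in> {1..N} \<and> \<not> prime n. mangoldt n / n) \<le> (C::real)"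
proof -
  define u where "u p = 4 * real p powr - (3 / 2)" for p :: nat
  have su: "summable u" unfolding u_def using summable_real_powr_iff[of "- (3 / 2)"] by (intro summable_mult) simp
  have "(\<Sum>n | n \<in> {1..N} \<and> \<not> prime n. mangoldt n / n) \<le> suminf u" for N
  proof -
    let ?P = "{p\<in>{1..N}. prime p}"
    let ?I = "?P \<times> {2..N}"
    have sub: "{n. n \<in> {1..N} \<and> \<not> prime n \<and> primepow n} \<subseteq> (\<lambda>(p,j). p ^ j) ` ?I"
    proof
      fix n assume "n \<in> {n. n \<in> {1..N} \<and> \<not> prime n \<and> primepow n}"
      then have n: "n \<le> N" "\<not> prime n" "primepow n" by auto
      then obtain p j where pj: "prime p" "0 < j" "n = p ^ j" unfolding primepow_def by blast
      have "j \<noteq> 1" using n pj by auto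
      then have "2 \<le> j" using pj by simp
      have p2: "2 \<le> p" using pj(1) by (rule prime_ge_2_nat)
      have "j < p ^ j" using p2 by (simp add: power_gt_expt)
      moreover have "p \<le> p ^ j" using p2 pj by (simp add: self_le_power)
      ultimately have "(p, j) \<in> ?I" using n pj \<open>2 \<le> j\<close> p2 by auto
      then show "n \<in> (\<lambda>(p,j). p ^ j) ` ?I" using pj by force
    qed
    have "(\<Sum>n | n \<in> {1..N} \<and> \<not> prime n. mangoldt n / n) = (\<Sum>n | n \<in> {1..N} \<and> \<not> prime n \<and> primepow n. mangoldt n / n)"
      by (rule sum.mono_neutral_right) (auto simp: mangoldt_def)
    also have "\<dots> \<le> (\<Sum>n\<in>(\<lambda>(p,j). p ^ j) ` ?I. mangoldt n / n)"
      using sub by (intro sum_mono2) (auto simp: mangoldt_nonneg)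
    also have "\<dots> \<le> (\<Sum>(p,j)\<in>?I. mangoldt (p ^ j) / real (p ^ j))"
      using sum_image_le[of ?I "\<lambda>n. mangoldt n / real n" "\<lambda>(p,j). p ^ j"]
      by (simp add: mangoldt_nonneg case_prod_unfold o_def)
    also have "\<dots> = (\<Sum>p\<in>?P. \<Sum>j\<in>{2..N}. mangoldt (p ^ j) / real (p ^ j))"
      by (rule sum.cartesian_product[symmetric])
    also have "\<dots> \<le> (\<Sum>p\<in>?P. u p)"
    proof (rule sum_mono)
      fix p assume p: "p \<in> ?P"
      then have p2: "2 \<le> p" using prime_ge_2_nat by auto
      have "(\<Sum>j\<in>{2..N}. mangoldt (p ^ j) / real (p ^ j)) = (\<Sum>j\<in>{2..N}. ln p * (1 / real p) ^ j)"
        using p by (intro sum.cong) (auto simp: power_divide)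
      also have "\<dots> = ln p * (\<Sum>j\<in>{2..N}. (1 / real p) ^ j)" by (simp add: sum_distrib_left)
      also have "\<dots> \<le> ln p * (2 * (1 / real p)\<^sup>2)"
        using p2 by (intro mult_left_mono sum_power_from_2_le) (auto simp: field_simps)
      also have "\<dots> \<le> (2 * sqrt p) * (2 * (1 / real p)\<^sup>2)"
      proof (rule mult_right_mono)
        have "ln (real p) = 2 * ln (sqrt p)" using p2 by (simp add: ln_sqrt)
        also have "\<dots> \<le> 2 * sqrt p" using p2 ln_le_minus_one[of "sqrt p"] by simp
        finally show "ln (real p) \<le> 2 * sqrt p" .
      qed simp
      also have "\<dots> = u p"
      proof -
        have "sqrt p * (1 / real p)\<^sup>2 = real p powr (1 / 2) * real p powr - 2"
        proof -
          have "sqrt p = real p powr (1 / 2)" by (simp add: powr_half_sqrt)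
          moreover have "(1 / real p)\<^sup>2 = real p powr - 2"
            using p2 by (simp add: powr_minus_divide power_divide)
          ultimately show ?thesis by (simp only:)
        qed
        also have "\<dots> = real p powr - (3 / 2)" by (simp add: powr_add[symmetric])
        finally show ?thesis by (simp add: u_def)
      qed
      finally show "(\<Sum>j\<in>{2..N}. mangoldt (p ^ j) / real (p ^ j)) \<le> u p" .
    qed
    also have "\<dots> \<le> suminf u" by (rule sum_le_suminf[OF su]) (auto simp: u_def)
    finally show ?thesis .
  qed
  then show ?thesis by blast
qed

text \<open>A vanishing \<open>L(1)\<close> contributes \<open>-log N\<close> to the sum over all characters, which is nonnegative by
  orthogonality, while the principal character contributes only one \<open>log N\<close>.\<close>

lemma card_vanishing_L_one_le:
  assumes k: "k \<ge> 1"
  shows "card {chi \<in> dirichlet_chars k. chi \<noteq> principal_char k \<and> L_one chi = 0} \<le> 1"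
proof (rule ccontr)
  define X where "X = dirichlet_chars k"
  define Z where "Z = {chi \<in> X. chi \<noteq> principal_char k \<and> L_one chi = 0}"
  assume "\<not> ?thesis"
  then have Z2: "2 \<le> card Z" by (simp add: Z_def X_def)
  have finX: "finite X" unfolding X_def by (rule finite_dirichlet_chars[OF k])
  define S where "S chi N = (\<Sum>n\<in>{1..N}. chi n * mangoldt n / n)" for chi :: "nat \<Rightarrow> complex" and N :: nat
  have "\<exists>C. \<forall>N>0. Re (S chi N) + (if chi \<in> Z then ln N else 0) \<le> C" if "chi \<in> X - {principal_char k}" for chi
  proof (cases "chi \<in> Z")
    case True
    then have "chi \<in> dirichlet_chars k" "chi \<noteq> principal_char k" "L_one chi = 0"
      by (auto simp: Z_def X_def)
    from sum_char_mangoldt_add_ln_bounded[OF k this]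
    obtain C where C: "\<And>N. N > 0 \<Longrightarrow> norm (S chi N + of_real (ln (real N))) \<le> C"
      unfolding S_def by blast
    have "Re (S chi N) + ln N \<le> C" if "N > 0" for N
      using C[OF that] complex_Re_le_cmod[of "S chi N + of_real (ln (real N))"] by simp
    then show ?thesis using True by auto
  next
    case False
    then have "chi \<in> dirichlet_chars k" "chi \<noteq> principal_char k" "L_one chi \<noteq> 0"
      using that by (auto simp: Z_def X_def)
    from sum_char_mangoldt_bounded[OF k this] obtain C where C: "\<And>N. norm (S chi N) \<le> C"
      unfolding S_def by blast
    have "Re (S chi N) \<le> C" for N
      using C[of N] complex_Re_le_cmod[of "S chi N"] by simp
    then show ?thesis using False by auto
  qed
  then obtain C where C: "\<And>chi N. chi \<in> X - {principal_char k} \<Longrightarrow> N > 0 \<Longrightarrow>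
      Re (S chi N) + (if chi \<in> Z then ln (real N) else 0) \<le> C chi" by metis
  have main: "ln (real N) \<le> 4 + (\<Sum>chi\<in>X - {principal_char k}. C chi)" if "N > 0" for N :: nat
  proof -
    have "(\<Sum>chi\<in>X. S chi N) = (\<Sum>n\<in>{1..N}. of_real (mangoldt n / n) * (\<Sum>chi\<in>X. chi n))"
      unfolding S_def sum_distrib_left by (subst sum.swap) (simp add: mult_ac)
    also have "\<dots> = of_real (\<Sum>n\<in>{1..N}. mangoldt n / n * (if [n = 1] (mod k) then real (card X) else 0))"
      unfolding X_def sum_chars[OF k] of_real_sum by (intro sum.cong) auto
    finally have "Re (\<Sum>chi\<in>X. S chi N) = (\<Sum>n\<in>{1..N}. mangoldt n / n * (if [n = 1] (mod k) then real (card X) else 0))"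
      by simp
    also have "\<dots> \<ge> 0" using mangoldt_nonneg by (intro sum_nonneg) auto
    finally have "0 \<le> (\<Sum>chi\<in>X. Re (S chi N))" by simp
    also have "\<dots> = Re (S (principal_char k) N) + (\<Sum>chi\<in>X - {principal_char k}. Re (S chi N))"
      using finX principal_char_in by (intro sum.remove) (auto simp: X_def)
    also have "Re (S (principal_char k) N) \<le> ln N + 4"
    proof -
      have "Re (S (principal_char k) N) = (\<Sum>n\<in>{1..N}. if coprime n k then mangoldt n / n else 0)"
        unfolding S_def Re_sum by (intro sum.cong) (auto simp: principal_char_def Re_divide_of_nat)
      also have "\<dots> \<le> (\<Sum>n\<in>{1..N}. mangoldt n / n)"
        using mangoldt_nonneg by (intro sum_mono) auto
      also have "\<dots> \<le> ln N + 4" using that by (rule sum_mangoldt_div_le)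
      finally show ?thesis .
    qed
    also have "(\<Sum>chi\<in>X - {principal_char k}. Re (S chi N)) \<le> (\<Sum>chi\<in>X - {principal_char k}. C chi - (if chi \<in> Z then ln N else 0))"
      using C[OF _ that] by (intro sum_mono) (simp add: le_diff_eq)
    also have "\<dots> = (\<Sum>chi\<in>X - {principal_char k}. C chi) - (\<Sum>chi\<in>X - {principal_char k}. if chi \<in> Z then ln N else 0)"
      by (rule sum_subtractf)
    also have "(\<Sum>chi\<in>X - {principal_char k}. if chi \<in> Z then ln N else 0) = (\<Sum>chi\<in>Z. ln N)"
      using finX by (intro sum.mono_neutral_cong_right) (auto simp: Z_def)
    also have "\<dots> = card Z * ln N" by simp
    finally have "card Z * ln N - ln N \<le> 4 + (\<Sum>chi\<in>X - {principal_char k}. C chi)" by simp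
    moreover have "2 * ln N \<le> card Z * ln N" using Z2 that by (intro mult_right_mono) auto
    ultimately show ?thesis by linarith
  qed
  obtain N :: nat where N: "exp (5 + (\<Sum>chi\<in>X - {principal_char k}. C chi)) < N" using reals_Archimedean2 by blast
  have "0 < real N" using N exp_gt_zero less_trans by blast
  then have "5 + (\<Sum>chi\<in>X - {principal_char k}. C chi) < ln N" using N by (metis exp_ln exp_less_cancel_iff)
  moreover have "0 < N" using \<open>0 < real N\<close> by simp
  ultimately show False using main[of N] by linarith
qed

text \<open>A vanishing value passes to the conjugate character. Since at most one character can
  vanish, the two coincide, so \<open>chi\<close> is real and Monsky's argument excludes it.\<close>

theorem L_one_nonzero:
  assumes k: "k \<ge> 1" and chi: "chi \<in> dirichlet_chars k" "chi \<noteq> principal_char k"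
  shows "L_one chi \<noteq> 0"
proof
  assume L: "L_one chi = 0"
  define chi' where "chi' n = cnj (chi n)" for n
  have chi': "chi' \<in> dirichlet_chars k" unfolding chi'_def[abs_def] by (rule char_cnj_in[OF k chi(1)])
  have np: "chi' \<noteq> principal_char k"
  proof
    assume *: "chi' = principal_char k"
    have "chi n = principal_char k n" for n
      using fun_cong[OF *, of n] by (metis chi'_def complex_cnj_cnj complex_cnj_one complex_cnj_zero principal_char_def)
    then show False using chi(2) by blast
  qed
  have bd: "norm (L_one chi') \<le> 2 * k / (real N + 1)" for N
  proof -
    have "(\<Sum>n\<in>{1..N}. chi' n / n) = cnj (\<Sum>n\<in>{1..N}. chi n / n)" by (simp add: chi'_def)
    then have "norm (\<Sum>n\<in>{1..N}. chi' n / n) = norm (\<Sum>n\<in>{1..N}. chi n / n)"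
      by (simp only: complex_mod_cnj)
    then have "norm (\<Sum>n\<in>{1..N}. chi' n / n) \<le> k / (real N + 1)"
      using L_one_tail[OF k chi, of N] L by simp
    moreover have "norm (L_one chi' - (\<Sum>n\<in>{1..N}. chi' n / n)) \<le> k / (real N + 1)"
      using L_one_tail[OF k chi' np, of N] by simp
    moreover have "2 * k / (real N + 1) = k / (real N + 1) + k / (real N + 1)" by simp
    ultimately show ?thesis
      using norm_triangle_sub[of "L_one chi'" "\<Sum>n\<in>{1..N}. chi' n / n"] by linarith
  qed
  have "(\<lambda>N. 2 * k / (real N + 1)) \<longlonglongrightarrow> 0" by real_asymp
  then have "norm (L_one chi') \<le> 0" by (rule tendsto_lowerbound) (use bd in \<open>auto intro!: always_eventually\<close>)
  then have L': "L_one chi' = 0" by simp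
  have "chi' = chi"
  proof (rule ccontr)
    assume "chi' \<noteq> chi"
    then have "card {chi, chi'} = 2" by simp
    moreover have "card {chi, chi'} \<le> card {chi \<in> dirichlet_chars k. chi \<noteq> principal_char k \<and> L_one chi = 0}"
      using chi chi' np L L' finite_dirichlet_chars[OF k] by (intro card_mono) auto
    ultimately show False using card_vanishing_L_one_le[OF k] by simp
  qed
  then have "cnj (chi n) = chi n" for n unfolding chi'_def[abs_def] by metis
  then show False using real_L_one_nonzero[OF k chi] L by blast
qed

lemma sum_char_primes_bounded:
  assumes k: "k \<ge> 1" and chi: "chi \<in> dirichlet_chars k" "chi \<noteq> principal_char k"
  shows "\<exists>C. \<forall>N. norm (\<Sum>p | p \<in> {1..N} \<and> prime p. chi p * of_real (ln (real p) / p)) \<le> C"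
proof -
  obtain C where C: "\<And>N. norm (\<Sum>n\<in>{1..N}. chi n * mangoldt n / n) \<le> C"
    using sum_char_mangoldt_bounded[OF k chi L_one_nonzero[OF k chi]] by blast
  obtain D where D: "\<And>N. (\<Sum>n | n \<in> {1..N} \<and> \<not> prime n. mangoldt n / n) \<le> (D::real)"
    using sum_mangoldt_nonprime_bounded by blast
  have "norm (\<Sum>p | p \<in> {1..N} \<and> prime p. chi p * of_real (ln (real p) / p)) \<le> C + D" for N
  proof -
    let ?f = "\<lambda>n. chi n * mangoldt n / n"
    have U: "{1..N} = {p. p \<in> {1..N} \<and> prime p} \<union> {n. n \<in> {1..N} \<and> \<not> prime n}" by auto
    have "sum ?f {1..N} = sum ?f {p. p \<in> {1..N} \<and> prime p} + sum ?f {n. n \<in> {1..N} \<and> \<not> prime n}"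
      by (subst U, rule sum.union_disjoint) auto
    also have "sum ?f {p. p \<in> {1..N} \<and> prime p} = (\<Sum>p | p \<in> {1..N} \<and> prime p. chi p * of_real (ln (real p) / p))"
      by (intro sum.cong) auto
    finally have e: "(\<Sum>p | p \<in> {1..N} \<and> prime p. chi p * of_real (ln (real p) / p)) = sum ?f {1..N} - sum ?f {n. n \<in> {1..N} \<and> \<not> prime n}"
      by simp
    have "norm (sum ?f {n. n \<in> {1..N} \<and> \<not> prime n}) \<le> (\<Sum>n | n \<in> {1..N} \<and> \<not> prime n. mangoldt n / n)"
      using norm_char_le[OF k chi(1)] mangoldt_nonneg
      by (intro order.trans[OF norm_sum sum_mono])
        (auto simp: norm_mult norm_divide intro!: divide_right_mono mult_left_le_one_le)
    then show ?thesis unfolding e using C[of N] D[of N] norm_triangle_ineq4[of "sum ?f {1..N}" "sum ?f {n. n \<in> {1..N} \<and> \<not> prime n}"]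
      by linarith
  qed
  then show ?thesis by blast
qed

text \<open>The function called \<open>f\<close> in the overview. Subtracting the mean is what
  removes the principal character.\<close>

definition residue_deviation :: "int \<Rightarrow> nat \<Rightarrow> nat \<Rightarrow> real" where
  "residue_deviation l k n = (if [int n = l] (mod int k) then 1 else 0) - 1 / totient k"

lemma abs_residue_deviation_le:
  assumes "k \<ge> 1"
  shows "\<bar>residue_deviation l k n\<bar> \<le> 1"
proof -
  have "1 \<le> real (totient k)" using assms by (simp add: Suc_le_eq)
  then have "0 \<le> 1 / real (totient k)" "1 / real (totient k) \<le> 1"
    using frac_le[of 1 1 1 "real (totient k)"] by auto
  moreover have "\<bar>(if P then 1 else 0) - x\<bar> \<le> 1" if "0 \<le> x" "x \<le> 1" for P and x :: real
    using that by (auto simp: abs_le_iff)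
  ultimately show ?thesis unfolding residue_deviation_def by blast
qed

text \<open>Orthogonality at \<open>l' * n\<close>, where \<open>l'\<close> is an inverse of
  \<open>l\<close> modulo \<open>k\<close>, obtained as a power by Euler's theorem; so
  \<open>chi l'\<close> plays the part of the conjugate of \<open>chi l\<close>. The principal
  character contributes the 1 that cancels against the mean.\<close>

lemma residue_deviation_eq_sum_chars:
  assumes k: "k \<ge> 1" and l: "coprime l (int k)"
  obtains l' where "\<And>n. coprime n k \<Longrightarrow> complex_of_real (residue_deviation l k n) =
    (\<Sum>chi\<in>dirichlet_chars k - {principal_char k}. chi l' * chi n) / totient k"
proof -
  define l0 where "l0 = nat (l mod int k)"
  have l0: "int l0 = l mod int k" using k by (simp add: l0_def)
  have l0c: "[int l0 = l] (mod int k)" unfolding l0 by (simp add: cong_def)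
  have cop: "coprime l0 k"
    using cong_imp_coprime[OF cong_sym[OF l0c] l] by (simp add: coprime_int_iff)
  define l' where "l' = l0 ^ (totient k - 1)"
  have "l0 * l' = l0 ^ totient k"
    unfolding l'_def using k by (metis mult.commute power_minus_mult totient_gt_0_iff less_eq_Suc_le One_nat_def)
  then have inv: "[l0 * l' = 1] (mod k)" using euler_theorem[OF cop] by simp
  have cop': "coprime l' k" using cop by (simp add: l'_def)
  have iff: "[l' * n = 1] (mod k) \<longleftrightarrow> [int n = l] (mod int k)" for n
  proof -
    have "[l' * n = 1] (mod k) \<longleftrightarrow> [l' * n = l' * l0] (mod k)"
      using inv by (metis cong_sym cong_trans mult.commute)
    also have "\<dots> \<longleftrightarrow> [n = l0] (mod k)" using cong_mult_lcancel_nat[OF cop'] by blast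
    also have "\<dots> \<longleftrightarrow> [int n = int l0] (mod int k)" by (simp add: cong_int_iff)
    also have "\<dots> \<longleftrightarrow> [int n = l] (mod int k)" using l0c by (metis cong_sym cong_trans)
    finally show ?thesis .
  qed
  show ?thesis
  proof
    fix n assume n: "coprime n k"
    have t: "real (totient k) \<noteq> 0" using k by simp
    have pr: "principal_char k (l' * n) = 1" using n cop' by (simp add: principal_char_def)
    have "(\<Sum>chi\<in>dirichlet_chars k. chi (l' * n)) = 1 + (\<Sum>chi\<in>dirichlet_chars k - {principal_char k}. chi (l' * n))"
      using sum.remove[OF finite_dirichlet_chars[OF k] principal_char_in, of "\<lambda>chi. chi (l' * n)"] pr by simp
    moreover have "(\<Sum>chi\<in>dirichlet_chars k - {principal_char k}. chi (l' * n)) = (\<Sum>chi\<in>dirichlet_chars k - {principal_char k}. chi l' * chi n)"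
      by (intro sum.cong refl) (auto simp: char_mult[OF k])
    ultimately have "(\<Sum>chi\<in>dirichlet_chars k - {principal_char k}. chi l' * chi n) = (if [int n = l] (mod int k) then of_nat (totient k) else 0) - 1"
      unfolding sum_chars[OF k] iff card_dirichlet_chars[OF k] by (simp add: algebra_simps)
    then show "complex_of_real (residue_deviation l k n) = (\<Sum>chi\<in>dirichlet_chars k - {principal_char k}. chi l' * chi n) / totient k"
      using t by (simp add: residue_deviation_def field_simps)
  qed
qed

text \<open>Primes not dividing \<open>k\<close> are handled through the characters. The character
  formula does not cover the others, but they are at most \<open>k\<close> and add a
  constant.\<close>

lemma sum_residue_deviation_ln_bounded:
  assumes k: "k \<ge> 1" and l: "coprime l (int k)"
  shows "\<exists>C. \<forall>N. \<bar>\<Sum>p | p \<in> {1..N} \<and> prime p. residue_deviation l k p * (ln p / p)\<bar> \<le> C"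
proof -
  obtain l' where l': "\<And>n. coprime n k \<Longrightarrow> complex_of_real (residue_deviation l k n) =
    (\<Sum>chi\<in>dirichlet_chars k - {principal_char k}. chi l' * chi n) / totient k"
    using residue_deviation_eq_sum_chars[OF k l] by blast
  let ?X = "dirichlet_chars k - {principal_char k}"
  have "\<forall>chi\<in>?X. \<exists>C. \<forall>N. norm (\<Sum>p | p \<in> {1..N} \<and> prime p. chi p * of_real (ln (real p) / p)) \<le> C"
    using sum_char_primes_bounded[OF k] by blast
  from bchoice[OF this]
  obtain C where C: "\<And>chi N. chi \<in> ?X \<Longrightarrow> norm (\<Sum>p | p \<in> {1..N} \<and> prime p. chi p * of_real (ln (real p) / p)) \<le> C chi"
    by blast
  define f where "f p = residue_deviation l k p * (ln p / p)" for p :: nat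
  have "\<bar>\<Sum>p | p \<in> {1..N} \<and> prime p. f p\<bar> \<le> (\<Sum>chi\<in>?X. C chi) + (\<Sum>p\<in>{1..k}. ln p / p)" for N
  proof -
    have "{p. p \<in> {1..N} \<and> prime p} = {p. p \<in> {1..N} \<and> prime p \<and> coprime p k} \<union> {p. p \<in> {1..N} \<and> prime p \<and> \<not> coprime p k}"
      by auto
    then have "(\<Sum>p | p \<in> {1..N} \<and> prime p. f p) = sum f ({p. p \<in> {1..N} \<and> prime p \<and> coprime p k} \<union> {p. p \<in> {1..N} \<and> prime p \<and> \<not> coprime p k})"
      by simp
    also have "\<dots> = sum f {p. p \<in> {1..N} \<and> prime p \<and> coprime p k} + sum f {p. p \<in> {1..N} \<and> prime p \<and> \<not> coprime p k}"
      by (rule sum.union_disjoint) auto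
    finally have split: "(\<Sum>p | p \<in> {1..N} \<and> prime p. f p) =
      sum f {p. p \<in> {1..N} \<and> prime p \<and> coprime p k} + sum f {p. p \<in> {1..N} \<and> prime p \<and> \<not> coprime p k}" .
    have "complex_of_real (sum f {p. p \<in> {1..N} \<and> prime p \<and> coprime p k}) =
        (\<Sum>p | p \<in> {1..N} \<and> prime p \<and> coprime p k. \<Sum>chi\<in>?X. chi l' / totient k * (chi p * of_real (ln (real p) / p)))"
      unfolding of_real_sum
    proof (intro sum.cong refl)
      fix p assume "p \<in> {p. p \<in> {1..N} \<and> prime p \<and> coprime p k}"
      then have "coprime p k" by simp
      then show "complex_of_real (f p) = (\<Sum>chi\<in>?X. chi l' / totient k * (chi p * of_real (ln (real p) / p)))"
        unfolding f_def of_real_mult l'[OF \<open>coprime p k\<close>] sum_divide_distrib sum_distrib_right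
        by (intro sum.cong refl) simp
    qed
    also have "\<dots> = (\<Sum>chi\<in>?X. chi l' / totient k * (\<Sum>p | p \<in> {1..N} \<and> prime p \<and> coprime p k. chi p * of_real (ln (real p) / p)))"
      unfolding sum_distrib_left by (rule sum.swap)
    also have "\<dots> = (\<Sum>chi\<in>?X. chi l' / totient k * (\<Sum>p | p \<in> {1..N} \<and> prime p. chi p * of_real (ln (real p) / p)))"
    proof (rule sum.cong[OF refl])
      fix chi assume "chi \<in> ?X"
      then have "(\<Sum>p | p \<in> {1..N} \<and> prime p \<and> coprime p k. chi p * of_real (ln (real p) / p)) =
          (\<Sum>p | p \<in> {1..N} \<and> prime p. chi p * of_real (ln (real p) / p))"
        using char_0[OF k, of chi] by (intro sum.mono_neutral_left) auto
      then show "chi l' / totient k * (\<Sum>p | p \<in> {1..N} \<and> prime p \<and> coprime p k. chi p * of_real (ln (real p) / p)) =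
          chi l' / totient k * (\<Sum>p | p \<in> {1..N} \<and> prime p. chi p * of_real (ln (real p) / p))"
        by (simp only:)
    qed
    also have "norm \<dots> \<le> (\<Sum>chi\<in>?X. C chi)"
    proof (rule order.trans[OF norm_sum sum_mono])
      fix chi assume chi: "chi \<in> ?X"
      have "1 \<le> real (totient k)" using k by (simp add: Suc_le_eq)
      then have "norm (chi l' / totient k) \<le> 1"
        using norm_char_le[OF k, of chi l'] chi by (simp add: norm_divide divide_le_eq)
      then have "norm (chi l' / totient k * (\<Sum>p | p \<in> {1..N} \<and> prime p. chi p * of_real (ln (real p) / p))) \<le> 1 * C chi"
        unfolding norm_mult[of "chi l' / totient k"] using C[OF chi] by (intro mult_mono) auto
      then show "norm (chi l' / totient k * (\<Sum>p | p \<in> {1..N} \<and> prime p. chi p * of_real (ln (real p) / p))) \<le> C chi"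
        by simp
    qed
    finally have 1: "\<bar>sum f {p. p \<in> {1..N} \<and> prime p \<and> coprime p k}\<bar> \<le> (\<Sum>chi\<in>?X. C chi)"
      unfolding norm_of_real .
    have "\<bar>sum f {p. p \<in> {1..N} \<and> prime p \<and> \<not> coprime p k}\<bar> \<le> (\<Sum>p | p \<in> {1..N} \<and> prime p \<and> \<not> coprime p k. ln p / p)"
    proof (rule order.trans[OF sum_abs sum_mono])
      fix p assume "p \<in> {p. p \<in> {1..N} \<and> prime p \<and> \<not> coprime p k}"
      then have "0 \<le> ln p / p" by auto
      moreover have "\<bar>f p\<bar> \<le> 1 * \<bar>ln p / p\<bar>"
        unfolding f_def abs_mult by (intro mult_right_mono abs_residue_deviation_le[OF k]) auto
      ultimately show "\<bar>f p\<bar> \<le> ln p / p" by (simp only: mult_1 abs_of_nonneg)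
    qed
    also have "\<dots> \<le> (\<Sum>p\<in>{1..k}. ln p / p)"
    proof (rule sum_mono2)
      show "{p. p \<in> {1..N} \<and> prime p \<and> \<not> coprime p k} \<subseteq> {1..k}"
      proof
        fix p assume p: "p \<in> {p. p \<in> {1..N} \<and> prime p \<and> \<not> coprime p k}"
        then have "p dvd k" using prime_imp_coprime[of p k] by blast
        then show "p \<in> {1..k}" using p k dvd_imp_le[of p k] by simp
      qed
    qed auto
    finally show ?thesis unfolding split using 1 by linarith
  qed
  then show ?thesis unfolding f_def by blast
qed

text \<open>Partial summation with weight \<open>1 / ln n\<close> removes the logarithm; sums over
  an interval are differences of two bounded sums, hence \<open>2 * C\<close>.\<close>

theorem mertens_residue_deviation:
  assumes k: "k \<ge> 1" and l: "coprime l (int k)"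
  shows "\<exists>B\<ge>0. \<forall>a\<ge>1. \<forall>b. \<bar>\<Sum>p | p \<in> {a<..b} \<and> prime p. residue_deviation l k p / p\<bar> \<le> B / ln (Suc a)"
proof -
  obtain C where C: "\<And>N. \<bar>\<Sum>p | p \<in> {1..N} \<and> prime p. residue_deviation l k p * (ln p / p)\<bar> \<le> C"
    using sum_residue_deviation_ln_bounded[OF k l] by blast
  have C0: "0 \<le> C" using order.trans[OF abs_ge_zero C[of 0]] .
  define f where "f n = (if prime n then residue_deviation l k n * (ln n / n) else 0)" for n :: nat
  have f: "\<bar>\<Sum>n\<in>{a<..b}. f n\<bar> \<le> 2 * C" if "a \<le> b" for a b
  proof -
    have F: "(\<Sum>n\<in>{1..N}. f n) = (\<Sum>p | p \<in> {1..N} \<and> prime p. residue_deviation l k p * (ln p / p))" for N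
      unfolding f_def by (rule sum.inter_filter[symmetric]) auto
    have "{1..b} = {1..a} \<union> {a<..b}" using that by auto
    then have "(\<Sum>n\<in>{1..b}. f n) = (\<Sum>n\<in>{1..a} \<union> {a<..b}. f n)" by simp
    also have "\<dots> = (\<Sum>n\<in>{1..a}. f n) + (\<Sum>n\<in>{a<..b}. f n)" by (rule sum.union_disjoint) auto
    finally show ?thesis using C[of a] C[of b] unfolding F by linarith
  qed
  have "\<bar>\<Sum>p | p \<in> {a<..b} \<and> prime p. residue_deviation l k p / p\<bar> \<le> (2 * C) / ln (Suc a)" if a: "a \<ge> 1" for a b
  proof (cases "a < b")
    case False
    then show ?thesis using C0 a by simp
  next
    case True
    have "(\<Sum>p | p \<in> {a<..b} \<and> prime p. residue_deviation l k p / p) = (\<Sum>n\<in>{a<..b}. (1 / ln n) *\<^sub>R f n)"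
      unfolding f_def by (subst sum.inter_filter) (use a in \<open>auto intro!: sum.cong\<close>)
    also have "norm \<dots> \<le> (2 * C) * (1 / ln (Suc a))"
      using f a True by (intro abel_bound) (auto simp: frac_le)
    finally show ?thesis by simp
  qed
  then show ?thesis using C0 by (intro exI[of _ "2 * C"]) auto
qed

section \<open>Alladi's duality sum and Ramanujan sums\<close>

lemma least_prime_divisor_eqI:
  assumes "prime p" "p dvd n" "rough (p - 1) n"
  shows "least_prime_divisor n = p"
  unfolding least_prime_divisor_def
proof (rule Least_equality)
  fix q assume "prime q \<and> q dvd n"
  then have "p - 1 < q" using assms(3) by (simp add: rough_def)
  then show "p \<le> q" by simp
qed (use assms in simp)

text \<open>Sorts by the least prime up to \<open>Q\<close>, one Buchstab step per prime.
  \<open>G\<close> is constrained only on numbers with such a prime, which permits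
  \<open>Q = x\<close> in one use and a fixed \<open>Q\<close> below the least prime of
  \<open>d\<close> in the other.\<close>

lemma sum_moebius_by_least_prime:
  fixes G g :: "nat \<Rightarrow> real"
  assumes G: "\<And>p n. prime p \<Longrightarrow> p \<le> Q \<Longrightarrow> p dvd n \<Longrightarrow> rough (p - 1) n \<Longrightarrow> G n = g p"
  shows "(\<Sum>n\<in>{1..y}. G n * (moebius_mu n / n)) = (\<Sum>n | n \<in> {1..y} \<and> rough Q n. G n * (moebius_mu n / n))
    - (\<Sum>p | p \<in> {1..Q} \<and> prime p. g p / p * moebius_mean p (y div p))"
  using G
proof (induction Q)
  case 0
  have "{n. n \<in> {1..y} \<and> rough 0 n} = {1..y}" by auto
  then show ?case by simp
next
  case (Suc Q)
  let ?h = "\<lambda>n. G n * (moebius_mu n / n)"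
  have IH: "(\<Sum>n\<in>{1..y}. ?h n) = (\<Sum>n | n \<in> {1..y} \<and> rough Q n. ?h n)
    - (\<Sum>p | p \<in> {1..Q} \<and> prime p. g p / p * moebius_mean p (y div p))"
    using Suc.prems by (intro Suc.IH) auto
  show ?case
  proof (cases "prime (Suc Q)")
    case False
    then have "{p. p \<in> {1..Suc Q} \<and> prime p} = {p. p \<in> {1..Q} \<and> prime p}" by (auto simp: le_Suc_eq)
    moreover have "rough (Suc Q) n \<longleftrightarrow> rough Q n" for n using False by (simp add: rough_Suc_iff)
    ultimately show ?thesis using IH by simp
  next
    case True
    let ?A = "{n. n \<in> {1..y} \<and> rough (Suc Q) n}" and ?B = "{n. n \<in> {1..y} \<and> Suc Q dvd n \<and> rough Q n}"
    have U: "{n. n \<in> {1..y} \<and> rough Q n} = ?A \<union> ?B" using True by (auto simp: rough_Suc_iff)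
    have "(\<Sum>n | n \<in> {1..y} \<and> rough Q n. ?h n) = sum ?h ?A + sum ?h ?B"
      unfolding U using True by (intro sum.union_disjoint) (auto simp: rough_Suc_iff)
    also have "sum ?h ?B = (\<Sum>n\<in>?B. g (Suc Q) * (moebius_mu n / n))"
    proof (rule sum.cong[OF refl])
      fix n assume "n \<in> ?B"
      then have "G n = g (Suc Q)" using True by (intro Suc.prems) auto
      then show "?h n = g (Suc Q) * (moebius_mu n / n)" by simp
    qed
    also have "\<dots> = g (Suc Q) * (- moebius_mean (Suc Q) (y div Suc Q) / Suc Q)"
      unfolding sum_distrib_left[symmetric] sum_moebius_least_prime[OF True] ..
    finally have 1: "(\<Sum>n | n \<in> {1..y} \<and> rough Q n. ?h n) = sum ?h ?A - g (Suc Q) / Suc Q * moebius_mean (Suc Q) (y div Suc Q)"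
      by simp
    have "{p. p \<in> {1..Suc Q} \<and> prime p} = insert (Suc Q) {p. p \<in> {1..Q} \<and> prime p}"
      using True by auto
    then have 2: "(\<Sum>p | p \<in> {1..Suc Q} \<and> prime p. g p / p * moebius_mean p (y div p)) =
        g (Suc Q) / Suc Q * moebius_mean (Suc Q) (y div Suc Q) + (\<Sum>p | p \<in> {1..Q} \<and> prime p. g p / p * moebius_mean p (y div p))"
      by simp
    show ?thesis unfolding IH 1 2 by simp
  qed
qed

text \<open>Partial summation from the right end, so that the increments of \<open>W\<close> meet
  the tails of \<open>a\<close>, the quantities for which Mertens' estimate gives decay.\<close>

lemma abel_tail:
  fixes a W :: "nat \<Rightarrow> real"
  assumes "m \<le> T"
  shows "(\<Sum>t\<in>{m..T}. a t * W t) = (\<Sum>j\<in>{m..T}. a j) * W m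
    + (\<Sum>t\<in>{m..<T}. (\<Sum>j\<in>{Suc t..T}. a j) * (W (Suc t) - W t))"
  using assms
proof (induction m rule: inc_induct)
  case base
  then show ?case by simp
next
  case (step m)
  have "{m..T} = insert m {Suc m..T}" "{m..<T} = insert m {Suc m..<T}" using step by auto
  then show ?case using step by (simp add: algebra_simps)
qed

section \<open>Variation of \<open>moebius_mean p (x div p)\<close> in \<open>p\<close>\<close>

lemma moebius_mean_diff:
  assumes "a \<le> b"
  shows "\<bar>moebius_mean t b - moebius_mean t a\<bar> \<le> (\<Sum>n | n \<in> {a<..b} \<and> rough t n. 1 / real n)"
proof -
  have U: "{n. n \<in> {1..b} \<and> rough t n} = {n. n \<in> {1..a} \<and> rough t n} \<union> {n. n \<in> {a<..b} \<and> rough t n}"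
    using assms by (auto simp: rough_def)
  have "moebius_mean t b = moebius_mean t a + (\<Sum>n | n \<in> {a<..b} \<and> rough t n. moebius_mu n / n)"
    unfolding moebius_mean_def U by (rule sum.union_disjoint) auto
  then have "\<bar>moebius_mean t b - moebius_mean t a\<bar> = \<bar>\<Sum>n | n \<in> {a<..b} \<and> rough t n. moebius_mu n / n\<bar>" by simp
  also have "\<dots> \<le> (\<Sum>n | n \<in> {a<..b} \<and> rough t n. 1 / real n)"
    using abs_moebius_le by (intro order.trans[OF sum_abs sum_mono]) (auto simp: divide_right_mono)
  finally show ?thesis .
qed

lemma div_eq_iff_range:
  fixes t n x :: nat
  assumes "t > 0" "n > 0"
  shows "x div n = t \<longleftrightarrow> n \<in> {x div Suc t<..x div t}"
proof -
  have "x div n = t \<longleftrightarrow> t \<le> x div n \<and> x div n < Suc t" by auto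
  also have "t \<le> x div n \<longleftrightarrow> n \<le> x div t"
    using assms by (simp add: less_eq_div_iff_mult_less_eq mult.commute)
  also have "x div n < Suc t \<longleftrightarrow> x div Suc t < n"
    using assms by (simp only: div_less_iff_less_mult mult.commute zero_less_Suc)
  finally show ?thesis by auto
qed

text \<open>Two things change from \<open>t\<close> to \<open>Suc t\<close>: the sifting level,
  which by Buchstab costs at most \<open>1 / Suc t\<close> and only at a prime, and the cut-off,
  which drops the rough \<open>n\<close> with \<open>x div n = t\<close>.\<close>

lemma moebius_mean_variation_le:
  assumes "t > 0"
  shows "\<bar>moebius_mean (Suc t) (x div Suc t) - moebius_mean t (x div t)\<bar> \<le>
    (if prime (Suc t) then 1 / real (Suc t) else 0) + (\<Sum>n | n \<in> {1..x} \<and> x div n = t \<and> rough t n. 1 / real n)"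
proof -
  define y where "y = x div Suc t"
  have yx: "y \<le> x div t" using assms by (simp add: y_def div_le_mono2)
  have "\<bar>moebius_mean (Suc t) y - moebius_mean t y\<bar> \<le> (if prime (Suc t) then 1 / real (Suc t) else 0)"
    using moebius_mean_Suc[of t y] abs_moebius_mean_le[of "Suc t" "y div Suc t"]
    by (auto simp: divide_right_mono simp del: of_nat_Suc)
  moreover have "{n. n \<in> {y<..x div t} \<and> rough t n} = {n. n \<in> {1..x} \<and> x div n = t \<and> rough t n}"
  proof -
    have "n \<in> {y<..x div t} \<longleftrightarrow> n \<in> {1..x} \<and> x div n = t" for n
    proof (cases "n = 0")
      case False
      then have "n \<le> x" if "x div n = t" using that assms by (auto simp: div_greater_zero_iff)
      then show ?thesis using div_eq_iff_range[OF assms, of n x] False unfolding y_def by auto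
    qed simp
    then show ?thesis by blast
  qed
  with moebius_mean_diff[OF yx, of t]
  have "\<bar>moebius_mean t (x div t) - moebius_mean t y\<bar> \<le> (\<Sum>n | n \<in> {1..x} \<and> x div n = t \<and> rough t n. 1 / real n)"
    by (simp only:)
  ultimately show ?thesis unfolding y_def by linarith
qed

lemma ln_2_ge_half: "1 / 2 \<le> ln (2::real)"
proof -
  have "exp (1 / 2 :: real) ^ 2 \<le> 2 ^ 2" using exp_le by (simp add: exp_of_nat_mult[symmetric])
  then have "exp (1 / 2 :: real) \<le> 2" by (rule power2_le_imp_le) simp
  then show ?thesis by (subst ln_ge_iff) auto
qed

text \<open>Both parts of the variation are sums of \<open>1 / n\<close> over \<open>z\<close>-rough
  \<open>n\<close> in ranges of logarithmic length of order \<open>ln z\<close>, and the sieve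
  divides such a length by \<open>ln z\<close>. The primes in the block give 2, the moving cut-off
  gives 4.\<close>

lemma variation_block_le:
  fixes z :: nat
  assumes z: "2 \<le> z"
  shows "(\<Sum>t\<in>{z..<z\<^sup>2}. \<bar>moebius_mean (Suc t) (x div Suc t) - moebius_mean t (x div t)\<bar>) \<le> 6"
proof -
  have lz: "0 < ln z" "1 \<le> 2 * ln z" "ln 2 \<le> ln z"
  proof -
    show "ln 2 \<le> ln z" using z by simp
    then show "1 \<le> 2 * ln z" "0 < ln z" using ln_2_ge_half by linarith+
  qed
  have "(\<Sum>t\<in>{z..<z\<^sup>2}. \<bar>moebius_mean (Suc t) (x div Suc t) - moebius_mean t (x div t)\<bar>)
      \<le> (\<Sum>t\<in>{z..<z\<^sup>2}. (if prime (Suc t) then 1 / real (Suc t) else 0) + (\<Sum>n | n \<in> {1..x} \<and> x div n = t \<and> rough t n. 1 / real n))"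
    using z by (intro sum_mono moebius_mean_variation_le) auto
  also have "\<dots> = (\<Sum>t\<in>{z..<z\<^sup>2}. if prime (Suc t) then 1 / real (Suc t) else 0)
      + (\<Sum>t\<in>{z..<z\<^sup>2}. \<Sum>n | n \<in> {1..x} \<and> x div n = t \<and> rough t n. 1 / real n)"
    by (rule sum.distrib)
  also have "(\<Sum>t\<in>{z..<z\<^sup>2}. if prime (Suc t) then 1 / real (Suc t) else 0) \<le> 2"
  proof -
    have "(\<Sum>t\<in>{z..<z\<^sup>2}. if prime (Suc t) then 1 / real (Suc t) else 0) = (\<Sum>n\<in>{z<..z\<^sup>2}. if prime n then 1 / real n else 0)"
      by (rule sum.reindex_bij_witness[of _ "\<lambda>n. n - 1" Suc]) auto
    also have "\<dots> \<le> (\<Sum>n\<in>{z<..z\<^sup>2}. if rough z n then 1 / real n else 0)"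
      by (intro sum_mono) (auto simp: rough_prime_iff)
    also have "\<dots> = (\<Sum>n | n \<in> {z<..z\<^sup>2} \<and> rough z n. 1 / real n)"
      by (rule sum.inter_filter[symmetric]) simp
    finally have "ln z * (\<Sum>t\<in>{z..<z\<^sup>2}. if prime (Suc t) then 1 / real (Suc t) else 0) \<le> ln z * (\<Sum>n | n \<in> {z<..z\<^sup>2} \<and> rough z n. 1 / real n)"
      using lz by (intro mult_left_mono) auto
    also have "\<dots> \<le> (\<Sum>n\<in>{z<..z\<^sup>2*z}. 1 / real n)"
      using z self_le_power[of z 2] by (intro sum_inverse_rough_le) auto
    also have "\<dots> \<le> ln (real (z\<^sup>2*z)) - ln (real z)"
      using z by (intro sum_inverse_le_ln) (auto simp: power2_eq_square)
    also have "\<dots> = ln z * 2" using z by (simp add: ln_mult ln_realpow)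
    finally show ?thesis using lz by simp
  qed
  also have "(\<Sum>t\<in>{z..<z\<^sup>2}. \<Sum>n | n \<in> {1..x} \<and> x div n = t \<and> rough t n. 1 / real n) \<le> 4"
  proof -
    \<comment> \<open>The inner sets are disjoint, as \<open>n\<close> determines \<open>t\<close>;
      together they lie among the \<open>z\<close>-rough \<open>n\<close> with
      \<open>a < n <= x div z\<close>.\<close>
    define a where "a = x div z\<^sup>2"
    have "(\<Sum>t\<in>{z..<z\<^sup>2}. \<Sum>n | n \<in> {1..x} \<and> x div n = t \<and> rough t n. 1 / real n)
        = (\<Sum>n\<in>(\<Union>t\<in>{z..<z\<^sup>2}. {n. n \<in> {1..x} \<and> x div n = t \<and> rough t n}). 1 / real n)"
      by (rule sum.UNION_disjoint[symmetric]) auto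
    also have "\<dots> \<le> (\<Sum>n | n \<in> {a<..x div z} \<and> rough z n. 1 / real n)"
    proof (rule sum_mono2)
      show "(\<Union>t\<in>{z..<z\<^sup>2}. {n. n \<in> {1..x} \<and> x div n = t \<and> rough t n}) \<subseteq> {n. n \<in> {a<..x div z} \<and> rough z n}"
      proof
        fix n assume "n \<in> (\<Union>t\<in>{z..<z\<^sup>2}. {n. n \<in> {1..x} \<and> x div n = t \<and> rough t n})"
        then have n: "0 < n" "z \<le> x div n" "x div n < z\<^sup>2" "rough (x div n) n" by auto
        have "n \<le> x div z" using n z by (simp add: less_eq_div_iff_mult_less_eq mult.commute)
        moreover have "a < n" unfolding a_def using n z by (simp add: div_less_iff_less_mult mult.commute)
        moreover have "rough z n" using n rough_mono by blast
        ultimately show "n \<in> {n. n \<in> {a<..x div z} \<and> rough z n}" by simp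
      qed
    qed auto
    finally have "ln z * (\<Sum>t\<in>{z..<z\<^sup>2}. \<Sum>n | n \<in> {1..x} \<and> x div n = t \<and> rough t n. 1 / real n)
        \<le> ln z * (\<Sum>n | n \<in> {a<..x div z} \<and> rough z n. 1 / real n)"
      using lz by (intro mult_left_mono) auto
    also have "\<dots> \<le> (\<Sum>n\<in>{a<..x div z * z}. 1 / real n)"
    proof (rule sum_inverse_rough_le)
      have "x div z\<^sup>2 = x div z div z" by (simp add: power2_eq_square div_mult2_eq)
      then show "a \<le> x div z" unfolding a_def by (simp add: div_le_dividend)
    qed (use z in simp)
    also have "\<dots> \<le> (\<Sum>n\<in>{a<..x}. 1 / real n)"
      by (intro sum_mono2) (auto intro: order.trans[OF _ div_times_less_eq_dividend])
    also have "\<dots> \<le> ln z * 4"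
    proof (cases "a = 0")
      \<comment> \<open>Here \<open>ln a\<close> is no usable lower limit, so \<open>n = 1\<close>
        is split off; its 1 is absorbed by \<open>1 <= 2 * ln z\<close>.\<close>
      case True
      then have xz: "x < z\<^sup>2" unfolding a_def using z by (simp add: div_eq_0_iff)
      show ?thesis
      proof (cases "x = 0")
        case True
        then show ?thesis using lz by simp
      next
        case False
        have "{a<..x} = insert 1 {1<..x}" using True False by auto
        then have "(\<Sum>n\<in>{a<..x}. 1 / real n) = 1 + (\<Sum>n\<in>{1<..x}. 1 / real n)" by simp
        also have "(\<Sum>n\<in>{1<..x}. 1 / real n) \<le> ln x - ln (real 1)" using False by (intro sum_inverse_le_ln) auto
        also have "ln x \<le> ln (real (z\<^sup>2))" using xz False by (intro ln_mono) auto
        also have "ln (real (z\<^sup>2)) = 2 * ln z" using z by (simp add: ln_realpow)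
        finally show ?thesis using lz by simp
      qed
    next
      case False
      have "a \<le> x" by (simp add: a_def)
      then have "(\<Sum>n\<in>{a<..x}. 1 / real n) \<le> ln x - ln a" using False by (intro sum_inverse_le_ln) auto
      also have "x < Suc a * z\<^sup>2" unfolding a_def using z dividend_less_div_times[of "z\<^sup>2" x] by simp
      then have "x \<le> 2 * a * z\<^sup>2" using False mult_le_mono1[of "Suc a" "2 * a" "z\<^sup>2"] by linarith
      then have "real x \<le> real (2 * a * z\<^sup>2)" by (simp only: of_nat_le_iff)
      then have "ln x \<le> ln (real (2 * a * z\<^sup>2))"
        by (intro ln_mono) (use False \<open>a \<le> x\<close> in \<open>simp_all del: of_nat_mult of_nat_power\<close>)
      also have "ln (real (2 * a * z\<^sup>2)) = ln 2 + ln a + 2 * ln z" using False z by (simp add: ln_mult ln_realpow)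
      finally show ?thesis using lz by simp
    qed
    finally show ?thesis using lz by simp
  qed
  finally show ?thesis by simp
qed

text \<open>Abel summation against the tails of the Mertens sums. The scale \<open>2 ^ 2 ^ i\<close> makes the tails
  decay geometrically from block to block, while the variation over a block stays bounded.\<close>

theorem sum_residue_deviation_moebius_mean_tendsto:
  assumes k: "k \<ge> 1" and l: "coprime l (int k)"
  shows "(\<lambda>x. \<Sum>p | p \<in> {1..x} \<and> prime p. residue_deviation l k p / p * moebius_mean p (x div p)) \<longlonglongrightarrow> 0"
proof -
  obtain B where B: "0 \<le> B" "\<And>a b. a \<ge> 1 \<Longrightarrow> \<bar>\<Sum>p | p \<in> {a<..b} \<and> prime p. residue_deviation l k p / p\<bar> \<le> B / ln (Suc a)"
    using mertens_residue_deviation[OF k l] by blast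
  define a where "a p = (if prime p then residue_deviation l k p / p else 0)" for p :: nat
  define W where "W x t = moebius_mean t (x div t)" for x t
  define z :: "nat \<Rightarrow> nat" where "z i = 2 ^ 2 ^ i" for i
  have z2: "2 \<le> z i" for i
    unfolding z_def using self_le_power[of 2 "2 ^ i"] by simp
  have zS: "z (Suc i) = (z i)\<^sup>2" for i by (simp add: z_def power_mult[symmetric] mult.commute)
  have lnz: "ln (real (z i)) = 2 ^ i * ln 2" for i by (simp add: z_def ln_realpow)
  have z_mono: "z i \<le> z (i + j)" for i j by (simp add: z_def)
  have tail: "\<bar>\<Sum>j\<in>{t..T}. a j\<bar> \<le> B / ln t" if "2 \<le> t" for t T
  proof -
    have "(\<Sum>j\<in>{t..T}. a j) = (\<Sum>p | p \<in> {t - 1<..T} \<and> prime p. residue_deviation l k p / p)"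
    proof -
      have "{t..T} = {t - 1<..T}" using that by auto
      then show ?thesis unfolding a_def by (simp only:) (rule sum.inter_filter[symmetric], simp)
    qed
    then show ?thesis using B(2)[of "t - 1" T] that by simp
  qed
  \<comment> \<open>\<open>2 - 2 / 2 ^ J\<close> is the partial sum of a geometric series: on the
    block starting at \<open>z (I + J)\<close> the tails are at most
    \<open>B / (2 ^ (I + J) * ln 2)\<close> and the variation is at most 6.\<close>
  have blocks: "(\<Sum>t\<in>{z I..<z (I + J)}. \<bar>(\<Sum>j\<in>{Suc t..T}. a j) * (W x (Suc t) - W x t)\<bar>) \<le> (2 - 2 / 2 ^ J) * (6 * (B / (2 ^ I * ln 2)))" for I J T x
  proof (induction J)
    case 0
    then show ?case by simp
  next
    case (Suc J)
    let ?h = "\<lambda>t. \<bar>(\<Sum>j\<in>{Suc t..T}. a j) * (W x (Suc t) - W x t)\<bar>"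
    have sq: "z (I + J) \<le> (z (I + J))\<^sup>2" by (simp add: power2_eq_square)
    have "{z I..<z (I + Suc J)} = {z I..<z (I + J)} \<union> {z (I + J)..<(z (I + J))\<^sup>2}"
      using z_mono[of I J] sq by (auto simp: zS)
    then have "sum ?h {z I..<z (I + Suc J)} = sum ?h {z I..<z (I + J)} + sum ?h {z (I + J)..<(z (I + J))\<^sup>2}"
      by (simp only:) (rule sum.union_disjoint, auto)
    also have "sum ?h {z (I + J)..<(z (I + J))\<^sup>2} \<le> (\<Sum>t\<in>{z (I + J)..<(z (I + J))\<^sup>2}. B / ln (z (I + J)) * \<bar>W x (Suc t) - W x t\<bar>)"
    proof (rule sum_mono)
      fix t assume t: "t \<in> {z (I + J)..<(z (I + J))\<^sup>2}"
      have "\<bar>\<Sum>j\<in>{Suc t..T}. a j\<bar> \<le> B / ln (Suc t)" using t z2[of "I + J"] by (intro tail) auto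
      also have "\<dots> \<le> B / ln (z (I + J))"
        using t z2[of "I + J"] B(1) by (intro divide_left_mono mult_pos_pos) (auto intro!: ln_mono)
      finally show "?h t \<le> B / ln (z (I + J)) * \<bar>W x (Suc t) - W x t\<bar>"
        unfolding abs_mult by (intro mult_right_mono) auto
    qed
    also have "\<dots> = B / ln (z (I + J)) * (\<Sum>t\<in>{z (I + J)..<(z (I + J))\<^sup>2}. \<bar>W x (Suc t) - W x t\<bar>)"
      by (simp add: sum_distrib_left)
    also have "\<dots> \<le> B / ln (z (I + J)) * 6"
      unfolding W_def using B(1) z2[of "I + J"] by (intro mult_left_mono variation_block_le) auto
    also have "B / ln (z (I + J)) * 6 = (1 / 2 ^ J) * (6 * (B / (2 ^ I * ln 2)))"
      by (simp add: lnz power_add mult_ac)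
    finally have "sum ?h {z I..<z (I + Suc J)} \<le> (2 - 2 / 2 ^ J) * (6 * (B / (2 ^ I * ln 2))) + (1 / 2 ^ J) * (6 * (B / (2 ^ I * ln 2)))"
      using Suc by simp
    also have "\<dots> = (2 - 2 / 2 ^ Suc J) * (6 * (B / (2 ^ I * ln 2)))"
      unfolding distrib_right[symmetric] by simp
    finally show ?case .
  qed
  \<comment> \<open>Twelve units come from the blocks, the thirteenth from the boundary term at
    \<open>z I\<close>.\<close>
  have large: "\<bar>\<Sum>t\<in>{z I..T}. a t * W x t\<bar> \<le> 13 * (B / (2 ^ I * ln 2))" for I T x
  proof (cases "z I \<le> T")
    case False
    then show ?thesis using B(1) by simp
  next
    case True
    have "\<bar>(\<Sum>j\<in>{z I..T}. a j) * W x (z I)\<bar> \<le> B / ln (z I) * 1"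
      unfolding abs_mult W_def using z2[of I] by (intro mult_mono tail abs_moebius_mean_le) (auto intro: order.trans[OF abs_ge_zero tail])
    moreover have "\<bar>\<Sum>t\<in>{z I..<T}. (\<Sum>j\<in>{Suc t..T}. a j) * (W x (Suc t) - W x t)\<bar> \<le> 12 * (B / (2 ^ I * ln 2))"
    proof -
      \<comment> \<open>A crude number of blocks that certainly covers the range; the geometric
        bound does not grow with it.\<close>
      have "T \<le> z (I + T)"
      proof -
        have "T < 2 ^ T" by (rule less_exp)
        also have "2 ^ T \<le> (2::nat) ^ (I + T)" by simp
        also have "\<dots> < z (I + T)" unfolding z_def by (rule less_exp)
        finally show ?thesis by simp
      qed
      then have "(\<Sum>t\<in>{z I..<T}. \<bar>(\<Sum>j\<in>{Suc t..T}. a j) * (W x (Suc t) - W x t)\<bar>)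
          \<le> (\<Sum>t\<in>{z I..<z (I + T)}. \<bar>(\<Sum>j\<in>{Suc t..T}. a j) * (W x (Suc t) - W x t)\<bar>)"
        by (intro sum_mono2) auto
      also have "\<dots> \<le> (2 - 2 / 2 ^ T) * (6 * (B / (2 ^ I * ln 2)))" by (rule blocks)
      also have "\<dots> \<le> 2 * (6 * (B / (2 ^ I * ln 2)))" using B(1) by (intro mult_right_mono) auto
      finally show ?thesis by (intro order.trans[OF sum_abs]) simp
    qed
    ultimately show ?thesis unfolding abel_tail[OF True] lnz by linarith
  qed
  show ?thesis
  proof (rule LIMSEQ_I)
    fix \<epsilon> :: real assume \<epsilon>: "0 < \<epsilon>"
    obtain I where I: "13 * (B / (2 ^ I * ln 2)) < \<epsilon> / 2"
    proof -
      have "(\<lambda>I. 13 * (B / (2 ^ I * ln 2))) \<longlonglongrightarrow> 0" by real_asymp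
      then have "\<forall>\<^sub>F I in sequentially. 13 * (B / (2 ^ I * ln 2)) < \<epsilon> / 2" using \<epsilon> by (intro order_tendstoD) auto
      then show ?thesis using that by (auto dest: eventually_happens)
    qed
    \<comment> \<open>Below the fixed scale \<open>z I\<close> there are finitely many terms, and
      each tends to 0 by the prime number theorem.\<close>
    have "(\<lambda>x. \<Sum>t\<in>{1..<z I}. a t * W x t) \<longlonglongrightarrow> (\<Sum>t\<in>{1..<z I}. a t * 0)"
    proof (intro tendsto_sum tendsto_mult tendsto_const)
      fix t assume "t \<in> {1..<z I}"
      then have "filterlim (\<lambda>x. x div t) at_top sequentially"
        by (intro filterlim_at_top_div_const_nat) auto
      then show "(\<lambda>x. W x t) \<longlonglongrightarrow> 0"
        unfolding W_def by (rule filterlim_compose[OF moebius_mean_tendsto])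
    qed
    then have "(\<lambda>x. \<Sum>t\<in>{1..<z I}. a t * W x t) \<longlonglongrightarrow> 0" by simp
    from LIMSEQ_D[OF this half_gt_zero[OF \<epsilon>]]
    obtain N where N: "\<And>x. x \<ge> N \<Longrightarrow> \<bar>\<Sum>t\<in>{1..<z I}. a t * W x t\<bar> < \<epsilon> / 2"
      unfolding diff_0_right real_norm_def by blast
    show "\<exists>no. \<forall>x\<ge>no. norm ((\<Sum>p | p \<in> {1..x} \<and> prime p. residue_deviation l k p / p * moebius_mean p (x div p)) - 0) < \<epsilon>"
    proof (intro exI allI impI)
      fix x assume x: "max N (z I) \<le> x"
      have "(\<Sum>p | p \<in> {1..x} \<and> prime p. residue_deviation l k p / p * moebius_mean p (x div p)) = (\<Sum>t\<in>{1..x}. a t * W x t)"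
        unfolding a_def W_def by (subst sum.inter_filter) (auto intro!: sum.cong)
      also have "\<dots> = (\<Sum>t\<in>{1..<z I}. a t * W x t) + (\<Sum>t\<in>{z I..x}. a t * W x t)"
      proof -
        have "{1..x} = {1..<z I} \<union> {z I..x}" using x z2[of I] by auto
        then show ?thesis by (simp only:) (rule sum.union_disjoint, auto)
      qed
      finally show "norm ((\<Sum>p | p \<in> {1..x} \<and> prime p. residue_deviation l k p / p * moebius_mean p (x div p)) - 0) < \<epsilon>"
        using N[of x] x large[where I = I and T = x and x = x] I by (simp add: real_norm_def)
    qed
  qed
qed


text \<open>With \<open>Q = x\<close> only \<open>n = 1\<close> remains unsifted. The constant part
  of the indicator gives \<open>(moebius_mean 0 x - 1) / totient k\<close>, so the limit comes from
  the missing term \<open>n = 1\<close>.\<close>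

theorem alladi_residue_class:
  assumes k: "k \<ge> 1" and l: "coprime l (int k)"
  shows "(\<lambda>x. \<Sum>n\<in>{1..x}. (if n \<noteq> 1 \<and> [int (least_prime_divisor n) = l] (mod int k) then 1 else 0) * (moebius_mu n / n))
    \<longlonglongrightarrow> - (1 / totient k)"
proof -
  define G where "G n = (if n \<noteq> 1 \<and> [int (least_prime_divisor n) = l] (mod int k) then 1 else 0 :: real)" for n
  \<comment> \<open>Set to 0 at \<open>n = 1\<close>, where \<open>least_prime_divisor\<close> has
    no meaning.\<close>
  define G' where "G' n = (if n = 1 then 0 else residue_deviation l k (least_prime_divisor n))" for n
  have GG: "G n = G' n + (if n = 1 then 0 else 1 / totient k)" for n
    by (simp add: G_def G'_def residue_deviation_def)
  have "(\<Sum>n\<in>{1..x}. G n * (moebius_mu n / n)) =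
      - (\<Sum>p | p \<in> {1..x} \<and> prime p. residue_deviation l k p / p * moebius_mean p (x div p))
      + 1 / totient k * (moebius_mean 0 x - 1)" if "x \<ge> 1" for x
  proof -
    have "(\<Sum>n\<in>{1..x}. G' n * (moebius_mu n / n)) = (\<Sum>n | n \<in> {1..x} \<and> rough x n. G' n * (moebius_mu n / n))
        - (\<Sum>p | p \<in> {1..x} \<and> prime p. residue_deviation l k p / p * moebius_mean p (x div p))"
    proof (rule sum_moebius_by_least_prime)
      fix p n :: nat assume "prime p" "p dvd n" "rough (p - 1) n"
      then have "least_prime_divisor n = p" "n \<noteq> 1" by (auto intro: least_prime_divisor_eqI)
      then show "G' n = residue_deviation l k p" by (simp add: G'_def)
    qed
    moreover have "(\<Sum>n | n \<in> {1..x} \<and> rough x n. G' n * (moebius_mu n / n)) = 0"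
    proof (rule sum.neutral, rule ballI)
      fix n assume "n \<in> {n. n \<in> {1..x} \<and> rough x n}"
      then have "n = 1" using rough_gt[of x n] by auto
      then show "G' n * (moebius_mu n / n) = 0" by (simp add: G'_def)
    qed
    moreover have "(\<Sum>n\<in>{1..x}. (if n = 1 then 0 else 1 / totient k) * (moebius_mu n / n)) = 1 / totient k * (moebius_mean 0 x - 1)"
    proof -
      have "moebius_mean 0 x = (\<Sum>n\<in>{1..x}. moebius_mu n / n)"
        unfolding moebius_mean_def by (intro sum.cong) auto
      also have "{1..x} = insert 1 {2..x}" using that by auto
      also have "(\<Sum>n\<in>insert 1 {2..x}. moebius_mu n / n) = 1 + (\<Sum>n\<in>{2..x}. moebius_mu n / n)"
        by (subst sum.insert) auto
      finally have "moebius_mean 0 x - 1 = (\<Sum>n\<in>{2..x}. moebius_mu n / n)" by simp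
      moreover have "(\<Sum>n\<in>{1..x}. (if n = 1 then 0 else 1 / totient k) * (moebius_mu n / n)) = (\<Sum>n\<in>{2..x}. 1 / totient k * (moebius_mu n / n))"
        by (rule sum.mono_neutral_cong_right) auto
      ultimately show ?thesis by (simp only: sum_distrib_left)
    qed
    ultimately show ?thesis unfolding GG distrib_right sum.distrib by linarith
  qed
  then have "\<forall>\<^sub>F x in sequentially. - (\<Sum>p | p \<in> {1..x} \<and> prime p. residue_deviation l k p / p * moebius_mean p (x div p))
      + 1 / totient k * (moebius_mean 0 x - 1) = (\<Sum>n\<in>{1..x}. G n * (moebius_mu n / n))"
    by (intro eventually_sequentiallyI[of 1]) simp
  moreover have "(\<lambda>x. - (\<Sum>p | p \<in> {1..x} \<and> prime p. residue_deviation l k p / p * moebius_mean p (x div p))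
      + 1 / totient k * (moebius_mean 0 x - 1)) \<longlonglongrightarrow> - 0 + 1 / totient k * (0 - 1)"
    by (intro tendsto_intros sum_residue_deviation_moebius_mean_tendsto[OF k l] moebius_mean_tendsto)
  ultimately have "(\<lambda>x. \<Sum>n\<in>{1..x}. G n * (moebius_mu n / n)) \<longlonglongrightarrow> - 0 + 1 / totient k * (0 - 1)"
    by (rule Lim_transform_eventually[rotated])
  then show ?thesis by (simp add: G_def)
qed

text \<open>The least prime of \<open>d * n\<close> is that of \<open>n\<close> if it is below
  \<open>P\<close>, and \<open>P\<close> otherwise. Sifting stops at \<open>P - 1\<close> because
  multiples of \<open>P\<close> belong to the second case.\<close>

lemma sum_moebius_multiple_tendsto:
  fixes g :: "nat \<Rightarrow> real"
  assumes "1 < d"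
  shows "(\<lambda>x. \<Sum>n\<in>{1..x}. g (least_prime_divisor (d * n)) * (moebius_mu n / n)) \<longlonglongrightarrow> 0"
proof -
  define P where "P = least_prime_divisor d"
  obtain q where "prime q" "q dvd d" using assms prime_factor_nat[of d] by auto
  then have "prime P \<and> P dvd d"
    unfolding P_def least_prime_divisor_def by (rule_tac LeastI) simp
  then have P: "prime P" "P dvd d" by auto
  have rd: "rough (P - 1) d"
  proof -
    have "P \<le> q" if "prime q" "q dvd d" for q
      unfolding P_def least_prime_divisor_def using that by (intro Least_le) simp
    moreover have "0 < P" using P(1) by (rule prime_gt_0_nat)
    ultimately have "P - 1 < q" if "prime q" "q dvd d" for q
      using that by (metis Suc_le_lessD Suc_pred' diff_less less_le_trans less_numeral_extra(1) One_nat_def)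
    then show ?thesis using assms unfolding rough_def by simp
  qed
  have eq: "(\<Sum>n\<in>{1..x}. g (least_prime_divisor (d * n)) * (moebius_mu n / n)) =
      g P * moebius_mean (P - 1) x - (\<Sum>p | p \<in> {1..P - 1} \<and> prime p. g p / p * moebius_mean p (x div p))" for x
  proof -
    have "(\<Sum>n\<in>{1..x}. g (least_prime_divisor (d * n)) * (moebius_mu n / n)) =
        (\<Sum>n | n \<in> {1..x} \<and> rough (P - 1) n. g (least_prime_divisor (d * n)) * (moebius_mu n / n))
        - (\<Sum>p | p \<in> {1..P - 1} \<and> prime p. g p / p * moebius_mean p (x div p))"
    proof (rule sum_moebius_by_least_prime)
      fix p n assume p: "prime p" "p \<le> P - 1" "p dvd n" "rough (p - 1) n"
      have "rough (p - 1) d" by (rule rough_mono[OF rd]) (use p(2) in simp)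
      then have "least_prime_divisor (d * n) = p"
        using p by (intro least_prime_divisor_eqI) (auto simp: rough_mult_iff)
      then show "g (least_prime_divisor (d * n)) = g p" by simp
    qed
    also have "(\<Sum>n | n \<in> {1..x} \<and> rough (P - 1) n. g (least_prime_divisor (d * n)) * (moebius_mu n / n)) =
        (\<Sum>n | n \<in> {1..x} \<and> rough (P - 1) n. g P * (moebius_mu n / n))"
    proof (rule sum.cong[OF refl])
      fix n assume "n \<in> {n. n \<in> {1..x} \<and> rough (P - 1) n}"
      then have "least_prime_divisor (d * n) = P"
        using P rd by (intro least_prime_divisor_eqI) (auto simp: rough_mult_iff)
      then show "g (least_prime_divisor (d * n)) * (moebius_mu n / n) = g P * (moebius_mu n / n)" by simp
    qed
    also have "\<dots> = g P * moebius_mean (P - 1) x"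
      by (simp add: moebius_mean_def sum_distrib_left)
    finally show ?thesis .
  qed
  have "(\<lambda>x. g P * moebius_mean (P - 1) x - (\<Sum>p | p \<in> {1..P - 1} \<and> prime p. g p / p * moebius_mean p (x div p)))
      \<longlonglongrightarrow> g P * 0 - (\<Sum>p | p \<in> {1..P - 1} \<and> prime p. g p / p * 0)"
    by (intro tendsto_intros moebius_mean_tendsto filterlim_compose[OF moebius_mean_tendsto filterlim_at_top_div_const_nat]) auto
  then show ?thesis unfolding eq by simp
qed

section \<open>Ramanujan sums\<close>

lemma sum_exp_multiples:
  assumes "N > 0"
  shows "(\<Sum>q\<in>{1..N}. exp (2 * of_real pi * \<i> * of_nat q * of_nat m / of_nat N)) = (if N dvd m then of_nat N else 0 :: complex)"
proof -
  define w where "w = exp (2 * of_real pi * \<i> * of_nat m / of_nat N)"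
  have pw: "exp (2 * of_real pi * \<i> * of_nat q * of_nat m / of_nat N) = w ^ q" for q
    unfolding w_def exp_of_nat_mult[symmetric] by (simp add: mult_ac)
  have wN: "w ^ N = 1"
  proof -
    have "w ^ N = exp (2 * of_real pi * \<i> * of_nat m)"
      unfolding w_def exp_of_nat_mult[symmetric] using assms by simp
    also have "\<dots> = 1" using exp_integer_2pi[of "of_nat m"] by (simp add: mult_ac)
    finally show ?thesis .
  qed
  have w1: "w = 1 \<longleftrightarrow> N dvd m"
  proof
    assume "w = 1"
    then obtain n :: int where "2 * pi * real m / real N = of_int (2 * n) * pi"
      unfolding w_def exp_eq_1 by (auto simp: Im_divide_of_nat)
    then have "real m = of_int n * real N" using assms by (simp add: field_simps)
    then have "int m = n * int N" by (metis of_int_eq_iff of_int_mult of_int_of_nat_eq)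
    then show "N dvd m" by (metis dvd_triv_right int_dvd_int_iff)
  next
    assume "N dvd m"
    then obtain c where "m = N * c" by blast
    then show "w = 1" using assms exp_integer_2pi[of "of_nat c"] by (simp add: w_def mult_ac)
  qed
  show ?thesis
  proof (cases "N dvd m")
    case True
    then have "w = 1" using w1 by simp
    then show ?thesis using True unfolding pw by simp
  next
    case False
    have "(1 - w) * (\<Sum>q\<in>{1..N}. w ^ q) = w * (1 - w ^ N)"
    proof -
      have "(\<Sum>q\<in>{1..N}. w ^ q) = w * (\<Sum>q<N. w ^ q)"
        unfolding sum_distrib_left by (rule sum.reindex_bij_witness[of _ Suc "\<lambda>q. q - 1"]) (auto simp flip: power_Suc)
      then show ?thesis by (simp add: one_diff_power_eq mult_ac)
    qed
    then have "(\<Sum>q\<in>{1..N}. w ^ q) = 0" using wN w1 False by simp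
    then show ?thesis using False unfolding pw by simp
  qed
qed

text \<open>The Moebius function detects coprimality of \<open>q\<close> and \<open>n\<close>; for
  each common divisor \<open>d\<close> the inner sum runs over all residues modulo
  \<open>n div d\<close>.\<close>

lemma ramanujan_sum_eq:
  assumes "n > 0"
  shows "ramanujan_sum n m = (\<Sum>d | d dvd n. of_real (moebius_mu d) * (if n div d dvd m then of_nat (n div d) else 0))"
proof -
  let ?e = "\<lambda>q. exp (2 * of_real pi * \<i> * of_nat q * of_nat m / of_nat n) :: complex"
  have "ramanujan_sum n m = (\<Sum>q\<in>{1..n}. if coprime q n then ?e q else 0)"
    unfolding ramanujan_sum_def by (rule sum.inter_filter) simp
  also have "\<dots> = (\<Sum>q\<in>{1..n}. \<Sum>d | d \<in> {d. d dvd n} \<and> d dvd q. of_real (moebius_mu d) * ?e q)"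
  proof (rule sum.cong[OF refl])
    fix q assume q: "q \<in> {1..n}"
    have "(\<Sum>d | d \<in> {d. d dvd n} \<and> d dvd q. of_real (moebius_mu d) * ?e q) = of_real (\<Sum>d | d dvd gcd n q. moebius_mu d) * ?e q"
      by (simp add: sum_distrib_right)
    also have "(\<Sum>d | d dvd gcd n q. moebius_mu d) = (if gcd n q = 1 then 1 else 0)"
      using assms by (intro sum_moebius_divisors) simp
    also have "gcd n q = 1 \<longleftrightarrow> coprime q n" by (metis coprime_iff_gcd_eq_1 gcd.commute)
    finally show "(if coprime q n then ?e q else 0) = (\<Sum>d | d \<in> {d. d dvd n} \<and> d dvd q. of_real (moebius_mu d) * ?e q)"
      by (cases "coprime q n") (simp_all only: if_True if_False of_real_1 of_real_0 mult_1 mult_zero_left)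
  qed
  also have "\<dots> = (\<Sum>d\<in>{d. d dvd n}. \<Sum>q | q \<in> {1..n} \<and> d dvd q. of_real (moebius_mu d) * ?e q)"
    using assms by (intro sum.swap_restrict) auto
  also have "\<dots> = (\<Sum>d | d dvd n. of_real (moebius_mu d) * (if n div d dvd m then of_nat (n div d) else 0))"
  proof (rule sum.cong[OF refl])
    fix d assume "d \<in> {d. d dvd n}"
    then obtain c where c: "n = d * c" by blast
    then have pos: "d > 0" "c > 0" using assms by auto
    have "(\<Sum>q | q \<in> {1..n} \<and> d dvd q. ?e q) = (\<Sum>q | q \<in> {1..n div d} \<and> True. ?e (d * q))"
      using sum.reindex_bij_betw[OF bij_betw_mult_atLeastAtMost[OF pos(1), of n "\<lambda>_. True"], of ?e] by simp
    also have "\<dots> = (\<Sum>q\<in>{1..c}. exp (2 * of_real pi * \<i> * of_nat q * of_nat m / of_nat c))"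
      using c pos by (intro sum.cong) (auto simp: mult_ac)
    also have "\<dots> = (if c dvd m then of_nat c else 0)" by (rule sum_exp_multiples[OF pos(2)])
    finally show "(\<Sum>q | q \<in> {1..n} \<and> d dvd q. of_real (moebius_mu d) * ?e q) =
        of_real (moebius_mu d) * (if n div d dvd m then of_nat (n div d) else 0)"
      using c pos by (simp add: sum_distrib_left[symmetric])
  qed
  finally show ?thesis .
qed

lemma ramanujan_sum_div_eq:
  assumes "n > 0"
  shows "ramanujan_sum n m / of_nat n =
    of_real (\<Sum>e | e dvd n. if e dvd m then moebius_mu (n div e) / real (n div e) else 0)"
proof -
  have "ramanujan_sum n m / of_nat n = of_real (\<Sum>d | d dvd n. if n div d dvd m then moebius_mu d / d else 0)"
    unfolding ramanujan_sum_eq[OF assms] sum_divide_distrib of_real_sum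
  proof (rule sum.cong[OF refl])
    fix d assume "d \<in> {d. d dvd n}"
    then obtain c where c: "n = d * c" by blast
    then have "d > 0" "c > 0" using assms by auto
    then show "of_real (moebius_mu d) * (if n div d dvd m then of_nat (n div d) else 0) / of_nat n =
        complex_of_real (if n div d dvd m then moebius_mu d / d else 0)"
      unfolding c by simp
  qed
  also have "(\<Sum>d | d dvd n. if n div d dvd m then moebius_mu d / d else 0) =
      (\<Sum>e | e dvd n. if e dvd m then moebius_mu (n div e) / real (n div e) else 0)"
    using assms by (intro sum.reindex_bij_witness[of _ "\<lambda>d. n div d" "\<lambda>d. n div d"]) (auto elim!: dvdE)
  finally show ?thesis .
qed

theorem corollary1p2:
  fixes k m :: nat and l :: int
  assumes "k \<ge> 1"
    and "coprime l (int k)"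
    and "m \<ge> 1"
  shows "((\<lambda>x::real. - (\<Sum>n | 2 \<le> n \<and> real n \<le> x \<and>
                               [int (least_prime_divisor n) = l] (mod (int k)).
                         ramanujan_sum n m / of_nat n))
           \<longlongrightarrow> 1 / of_nat (totient k)) at_top"
proof -
  define G where "G n = (if n \<noteq> 1 \<and> [int (least_prime_divisor n) = l] (mod int k) then 1 else 0 :: real)" for n
  \<comment> \<open>The contribution of the common divisor \<open>e\<close>, with
    \<open>n = e * j\<close>; the condition on \<open>n\<close> is tested at the product, not at
    \<open>j\<close>.\<close>
  define T where "T e x = (\<Sum>j\<in>{1..x}. G (e * j) * (moebius_mu j / j))" for e x
  have T: "(\<lambda>x. T e (x div e)) \<longlonglongrightarrow> (if e = 1 then - (1 / totient k) else 0)" if "e dvd m" for e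
  proof (cases "e = 1")
    case True
    then show ?thesis using alladi_residue_class[OF assms(1,2)] by (simp add: T_def G_def)
  next
    case False
    have e: "1 < e" using that assms(3) False by (cases "e = 0") auto
    define g where "g p = (if [int p = l] (mod int k) then 1 else 0 :: real)" for p
    have "T e = (\<lambda>x. \<Sum>j\<in>{1..x}. g (least_prime_divisor (e * j)) * (moebius_mu j / j))"
      unfolding T_def using e by (intro ext sum.cong) (auto simp: G_def g_def)
    then have "T e \<longlonglongrightarrow> 0" using sum_moebius_multiple_tendsto[OF e, of g] by (simp only:)
    moreover have "filterlim (\<lambda>x. x div e) at_top sequentially" using e by (intro filterlim_at_top_div_const_nat) simp
    ultimately have "(\<lambda>x. T e (x div e)) \<longlonglongrightarrow> 0" by (rule filterlim_compose)
    then show ?thesis using False by simp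
  qed
  define S where "S N = (\<Sum>n | 2 \<le> n \<and> n \<le> N \<and> [int (least_prime_divisor n) = l] (mod (int k)). ramanujan_sum n m / of_nat n)" for N :: nat
  \<comment> \<open>\<open>m <= N\<close> ensures that all divisors of \<open>m\<close> occur among
    the outer indices up to \<open>N\<close>.\<close>
  have S: "S N = of_real (\<Sum>e | e dvd m. T e (N div e))" if "m \<le> N" for N
  proof -
    have "S N = (\<Sum>n | n \<in> {1..N} \<and> n \<noteq> 1 \<and> [int (least_prime_divisor n) = l] (mod (int k)). ramanujan_sum n m / of_nat n)"
      unfolding S_def by (intro sum.cong) auto
    also have "\<dots> = (\<Sum>n\<in>{1..N}. if n \<noteq> 1 \<and> [int (least_prime_divisor n) = l] (mod (int k)) then ramanujan_sum n m / of_nat n else 0)"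
      by (rule sum.inter_filter) simp
    also have "\<dots> = of_real (\<Sum>n\<in>{1..N}. \<Sum>e | e dvd n. if e dvd m then G (e * (n div e)) * (moebius_mu (n div e) / real (n div e)) else 0)"
      unfolding of_real_sum[of _ "{1..N}"]
    proof (rule sum.cong[OF refl])
      fix n assume n: "n \<in> {1..N}"
      have "(\<Sum>e | e dvd n. if e dvd m then G (e * (n div e)) * (moebius_mu (n div e) / real (n div e)) else 0) =
          G n * (\<Sum>e | e dvd n. if e dvd m then moebius_mu (n div e) / real (n div e) else 0)"
        unfolding sum_distrib_left by (intro sum.cong refl) auto
      then show "(if n \<noteq> 1 \<and> [int (least_prime_divisor n) = l] (mod (int k)) then ramanujan_sum n m / of_nat n else 0) =
          complex_of_real (\<Sum>e | e dvd n. if e dvd m then G (e * (n div e)) * (moebius_mu (n div e) / real (n div e)) else 0)"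
        using n ramanujan_sum_div_eq[of n m] by (simp add: G_def)
    qed
    also have "(\<Sum>n\<in>{1..N}. \<Sum>e | e dvd n. if e dvd m then G (e * (n div e)) * (moebius_mu (n div e) / real (n div e)) else 0) =
        (\<Sum>e\<in>{1..N}. \<Sum>j\<in>{1..N div e}. if e dvd m then G (e * j) * (moebius_mu j / real j) else 0)"
      by (rule sum_divisors_swap)
    also have "\<dots> = (\<Sum>e\<in>{1..N}. if e dvd m then T e (N div e) else 0)"
      by (intro sum.cong) (auto simp: T_def)
    also have "\<dots> = (\<Sum>e | e \<in> {1..N} \<and> e dvd m. T e (N div e))"
      by (rule sum.inter_filter[symmetric]) simp
    also have "{e. e \<in> {1..N} \<and> e dvd m} = {e. e dvd m}"
      using that assms(3) by (auto dest: dvd_imp_le intro: gr0I order.trans)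
    finally show ?thesis .
  qed
  have "(\<lambda>N. complex_of_real (\<Sum>e | e dvd m. T e (N div e))) \<longlonglongrightarrow> of_real (\<Sum>e | e dvd m. if e = 1 then - (1 / totient k) else 0)"
    by (intro tendsto_of_real tendsto_sum T) simp
  moreover have "(\<Sum>e | e dvd m. if e = 1 then - (1 / real (totient k)) else 0) = - (1 / totient k)"
    using assms(3) by (subst sum.delta) auto
  moreover have "\<forall>\<^sub>F N in sequentially. complex_of_real (\<Sum>e | e dvd m. T e (N div e)) = S N"
    using S by (intro eventually_sequentiallyI[of m]) simp
  ultimately have "S \<longlonglongrightarrow> - (1 / of_nat (totient k))"
    using Lim_transform_eventually by fastforce
  then have "(\<lambda>N. - S N) \<longlonglongrightarrow> 1 / of_nat (totient k)"
    using tendsto_minus by fastforce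
  \<comment> \<open>Passes from integer cut-offs to real \<open>x\<close> through the floor.\<close>
  moreover have "filterlim (\<lambda>x::real. nat \<lfloor>x\<rfloor>) at_top at_top"
    by (rule filterlim_compose[OF filterlim_nat_sequentially filterlim_floor_sequentially])
  ultimately have "((\<lambda>x::real. - S (nat \<lfloor>x\<rfloor>)) \<longlongrightarrow> 1 / of_nat (totient k)) at_top"
    by (rule filterlim_compose)
  moreover have "- S (nat \<lfloor>x\<rfloor>) = - (\<Sum>n | 2 \<le> n \<and> real n \<le> x \<and> [int (least_prime_divisor n) = l] (mod (int k)). ramanujan_sum n m / of_nat n)" for x :: real
  proof -
    have "2 \<le> n \<and> n \<le> nat \<lfloor>x\<rfloor> \<longleftrightarrow> 2 \<le> n \<and> real n \<le> x" for n by (auto simp: le_nat_iff le_floor_iff) linarith+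
    then have "{n. 2 \<le> n \<and> n \<le> nat \<lfloor>x\<rfloor> \<and> [int (least_prime_divisor n) = l] (mod (int k))} =
        {n. 2 \<le> n \<and> real n \<le> x \<and> [int (least_prime_divisor n) = l] (mod (int k))}" by blast
    then show ?thesis unfolding S_def by simp
  qed
  ultimately show ?thesis by simp
qed

end
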